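(* Let $A$ be a finite set with at least two elements and $F$ the free group on $A$. Then there exist normal subgroups $N_i$ ($i\ge5$) of $F$ with $F/N_i\cong\mathbb{A}_i$ (the alternating group of degree $i$) for every $i\ge 5$ such that, for $\mathsf{N}$ the set of all intersections of finitely many of the groups $N_i$ and $\mathfrak{N}=\{F/N\mid N\in\mathsf{N}\}$: (a) the Cayley graph of the profinite group $\widehat{F_{\mathfrak N}}=\varprojlim_{N\in\mathsf N}F/N$ with respect to $A$ is tree-like; (b) the Ribes–Zalesskiĭ Theorem holds for the pro-$\mathfrak{N}$-topology of $F$, that is, for every $n\ge 1$ and all finitely generated subgroups $H_1,\dots,H_n$ of $F$ which are closed in the pro-$\mathfrak N$-topology, the product set $H_1H_2\cdots H_n$ is closed in the pro-$\mathfrak N$-topology.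
   Context: The pro-$\mathfrak{N}$-topology on $F$ is the group topology having $\mathsf N$ as a basis of neighborhoods of $1$ (the empty intersection $F$ is included in $\mathsf N$). Write $\widetilde A=A\cup A^{-1}$. A graph (in the sense of Serre) has a vertex set and an edge set with initial/terminal vertex maps and an edge inversion $e\mapsto e^{-1}$ exchanging positive and negative edges; subgraphs are closed under endpoints and inversion. A profinite graph is a projective limit of finite discrete graphs; a subgraph of a profinite graph is required to be topologically closed. A profinite graph is connected if all its finite continuous quotient graphs are connected as abstract graphs. A connected profinite graph $\Gamma$ is tree-like if for every pair $\{u,v\}$ of vertices the intersection of all connected subgraphs of $\Gamma$ containing $\{u,v\}$ is connected. For a finite quotient $G=F/N$ the Cayley graph $\Gamma(G)$ has vertex set $G$ and edge set $G\times\widetilde A$, the edge $(g,a)$ going from $g$ to $ga$, with inverse $(ga,a^{-1})$. The Cayley graph of $\widehat{F_{\mathfrak N}}$ is the profinite graph $\varprojlim_{N\in\mathsf N}\Gamma(F/N)$, with vertex set $\widehat{F_{\mathfrak N}}$ and edge set $\widehat{F_{\mathfrak N}}\times\widetilde A$. *)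

theory Defs
  imports "HOL-Analysis.Analysis" "HOL-Algebra.Algebra"
begin

section \<open>The free group on a set\<close>

text \<open>The letter \<open>(a, True)\<close> stands for the generator \<open>a\<close> and \<open>(a, False)\<close> for its formal
  inverse; the elements of the free group are the reduced words.\<close>

type_synonym 'a letter = "'a \<times> bool"

definition letters :: "'a set \<Rightarrow> 'a letter set" where
  "letters A = A \<times> UNIV"

definition letter_inv :: "'a letter \<Rightarrow> 'a letter" where
  "letter_inv x = (fst x, \<not> snd x)"

definition reduced_word :: "'a letter list \<Rightarrow> bool" where
  "reduced_word w = successively (\<lambda>x y. y \<noteq> letter_inv x) w"

definition push_letter :: "'a letter \<Rightarrow> 'a letter list \<Rightarrow> 'a letter list" where
  "push_letter x w =
     (case w of [] \<Rightarrow> [x] | y # ys \<Rightarrow> if y = letter_inv x then ys else x # w)"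

definition free_group :: "'a set \<Rightarrow> 'a letter list monoid" where
  "free_group A = \<lparr>carrier = {w \<in> lists (letters A). reduced_word w},
                   mult = foldr push_letter, one = []\<rparr>"

lemma letter_inv_letter_inv [simp]: "letter_inv (letter_inv x) = x"
  by (simp add: letter_inv_def)

lemma letter_inv_neq [simp]: "letter_inv x \<noteq> x" "x \<noteq> letter_inv x"
  by (cases x, simp add: letter_inv_def)+

lemma letter_inv_in_letters [simp]: "letter_inv x \<in> letters A \<longleftrightarrow> x \<in> letters A"
  by (cases x) (simp add: letter_inv_def letters_def)

lemma reduced_Nil [simp]: "reduced_word []"
  by (simp add: reduced_word_def)

lemma reduced_Cons:
  "reduced_word (x # w) \<longleftrightarrow> (w = [] \<or> hd w \<noteq> letter_inv x) \<and> reduced_word w"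
  by (cases w) (auto simp: reduced_word_def)

lemma reduced_push: "reduced_word w \<Longrightarrow> reduced_word (push_letter x w)"
  by (cases w) (auto simp: push_letter_def reduced_Cons)

lemma push_reduced: "reduced_word (x # w) \<Longrightarrow> push_letter x w = x # w"
  by (cases w) (auto simp: push_letter_def reduced_Cons)

lemma push_push: "reduced_word w \<Longrightarrow> push_letter x (push_letter (letter_inv x) w) = w"
  by (cases w) (auto simp: push_letter_def reduced_Cons split: list.splits)

lemma reduced_foldr_push: "reduced_word w \<Longrightarrow> reduced_word (foldr push_letter u w)"
  by (induction u) (auto simp: reduced_push)

lemma push_in_lists:
  "x \<in> letters A \<Longrightarrow> w \<in> lists (letters A) \<Longrightarrow> push_letter x w \<in> lists (letters A)"
  by (cases w) (auto simp: push_letter_def)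

lemma foldr_push_in_lists:
  "u \<in> lists (letters A) \<Longrightarrow> w \<in> lists (letters A) \<Longrightarrow> foldr push_letter u w \<in> lists (letters A)"
  by (induction u) (auto simp: push_in_lists simp del: in_lists_conv_set)

lemma foldr_push_push:
  assumes "reduced_word v" "reduced_word w"
  shows "foldr push_letter (push_letter x v) w = push_letter x (foldr push_letter v w)"
proof (cases v)
  case (Cons y ys)
  have push_def: "push_letter x (y # ys) = (if y = letter_inv x then ys else x # y # ys)"
    by (simp add: push_letter_def)
  show ?thesis
    using push_push[of "foldr push_letter ys w" x] reduced_foldr_push[of w ys] assms
    unfolding Cons push_def by (cases "y = letter_inv x") simp_all
qed (simp add: push_letter_def)

lemma foldr_push_assoc:
  assumes "reduced_word v" "reduced_word w"
  shows "foldr push_letter (foldr push_letter u v) w = foldr push_letter u (foldr push_letter v w)"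
  using assms by (induction u) (auto simp: foldr_push_push reduced_foldr_push)

lemma foldr_push_Nil: "reduced_word u \<Longrightarrow> foldr push_letter u [] = u"
  by (induction u) (auto simp: push_reduced reduced_Cons)

lemma foldr_push_rev:
  "reduced_word w \<Longrightarrow> foldr push_letter (rev (map letter_inv u)) (foldr push_letter u w) = w"
proof (induction u arbitrary: w)
  case (Cons x u)
  then show ?case
    using push_push[of "foldr push_letter u w" "letter_inv x"] by (simp add: reduced_foldr_push)
qed simp

lemma free_group_simps:
  "w \<in> carrier (free_group A) \<longleftrightarrow> w \<in> lists (letters A) \<and> reduced_word w"
  "u \<otimes>\<^bsub>free_group A\<^esub> v = foldr push_letter u v"
  "\<one>\<^bsub>free_group A\<^esub> = []"
  by (simp_all only: free_group_def partial_object.simps monoid.simps mem_Collect_eq)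

lemma group_free_group: "group (free_group A)"
proof (rule groupI, unfold free_group_simps)
  fix u v
  assume u: "u \<in> lists (letters A) \<and> reduced_word u" and v: "v \<in> lists (letters A) \<and> reduced_word v"
  show "foldr push_letter u v \<in> lists (letters A) \<and> reduced_word (foldr push_letter u v)"
    using u v by (intro conjI foldr_push_in_lists reduced_foldr_push) blast+
  fix w assume w: "w \<in> lists (letters A) \<and> reduced_word w"
  show "foldr push_letter (foldr push_letter u v) w = foldr push_letter u (foldr push_letter v w)"
    using v w by (intro foldr_push_assoc) blast+
next
  fix u assume u: "u \<in> lists (letters A) \<and> reduced_word u"
  show "foldr push_letter [] u = u" by simp
  define u' where "u' = rev (map letter_inv u)"
  define v where "v = foldr push_letter u' []"
  have "u' \<in> lists (letters A)"
    using u unfolding u'_def by (simp add: in_lists_conv_set)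
  then have "v \<in> lists (letters A)" "reduced_word v"
    unfolding v_def by (simp_all only: foldr_push_in_lists lists.Nil reduced_foldr_push reduced_Nil)
  moreover have "foldr push_letter v u = []"
  proof -
    have "foldr push_letter v u = foldr push_letter u' u"
      unfolding v_def using foldr_push_assoc[of "[]" u u'] u by simp
    also have "\<dots> = foldr push_letter u' (foldr push_letter u [])"
      using u by (simp only: foldr_push_Nil)
    also have "\<dots> = []"
      unfolding u'_def by (rule foldr_push_rev) (rule reduced_Nil)
    finally show ?thesis .
  qed
  ultimately show "\<exists>v\<in>carrier (free_group A). foldr push_letter v u = []"
    unfolding free_group_simps Bex_def by blast
qed (simp only: lists.Nil reduced_Nil simp_thms)

lemma free_group_universal:
  assumes "group H" and f: "f \<in> A \<rightarrow> carrier H"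
  shows "\<exists>h \<in> hom (free_group A) H. \<forall>a\<in>A. h [(a, True)] = f a"
proof -
  interpret H: group H by fact
  define val where "val = (\<lambda>x. if snd x then f (fst x) else inv\<^bsub>H\<^esub> f (fst x))"
  define h where "h = (\<lambda>w. foldr (\<lambda>x r. val x \<otimes>\<^bsub>H\<^esub> r) w \<one>\<^bsub>H\<^esub>)"
  have val: "val x \<in> carrier H" if "x \<in> letters A" for x
    using that f by (auto simp: val_def letters_def)
  have hc: "h w \<in> carrier H" if "w \<in> lists (letters A)" for w
    using that by (induction w) (auto simp: h_def val)
  have vi: "val x \<otimes>\<^bsub>H\<^esub> val (letter_inv x) = \<one>\<^bsub>H\<^esub>" if "x \<in> letters A" for x
    using that f by (auto simp: val_def letters_def letter_inv_def Pi_iff)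
  have hp: "h (push_letter x w) = val x \<otimes>\<^bsub>H\<^esub> h w"
    if "x \<in> letters A" "w \<in> lists (letters A)" for x w
  proof (cases w)
    case (Cons y ys)
    have "ys \<in> lists (letters A)" using that Cons by simp
    hence "h ys = val x \<otimes>\<^bsub>H\<^esub> (val (letter_inv x) \<otimes>\<^bsub>H\<^esub> h ys)"
      using that by (simp add: H.m_assoc[symmetric] vi val hc)
    thus ?thesis using Cons by (auto simp: push_letter_def h_def)
  qed (simp add: push_letter_def h_def)
  have hm: "h (foldr push_letter u v) = h u \<otimes>\<^bsub>H\<^esub> h v"
    if "u \<in> lists (letters A)" "v \<in> lists (letters A)" for u v
    using that(1)
  proof (induction u)
    case Nil
    then show ?case using hc[OF that(2)] by (simp add: h_def)
  next
    case (Cons x u)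
    have "h (x # u) = val x \<otimes>\<^bsub>H\<^esub> h u" by (simp add: h_def)
    then show ?case
      using Cons hp[of x "foldr push_letter u v"] foldr_push_in_lists[OF Cons.hyps(2) that(2)]
        val[OF Cons.hyps(1)] hc[OF Cons.hyps(2)] hc[OF that(2)]
      by (simp add: H.m_assoc)
  qed
  have "h \<in> hom (free_group A) H"
    using hm hc by (auto simp: hom_def free_group_def simp del: in_lists_conv_set)
  moreover have "\<forall>a\<in>A. h [(a, True)] = f a"
    using f by (auto simp: h_def val_def Pi_iff)
  ultimately show ?thesis by blast
qed


section \<open>The pro-topology and the Ribes--Zalesskii property\<close>

definition finite_intersections ::
    "('g, 'm) monoid_scheme \<Rightarrow> (nat \<Rightarrow> 'g set) \<Rightarrow> nat set \<Rightarrow> 'g set set" where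
  "finite_intersections F N I = {carrier F \<inter> (\<Inter>i\<in>J. N i) |J. finite J \<and> J \<subseteq> I}"

definition pro_topology :: "('g, 'm) monoid_scheme \<Rightarrow> 'g set set \<Rightarrow> 'g topology" where
  "pro_topology F NN =
     topology (\<lambda>U. U \<subseteq> carrier F \<and> (\<forall>x\<in>U. \<exists>N\<in>NN. N #>\<^bsub>F\<^esub> x \<subseteq> U))"

lemma openin_pro_topology:
  assumes "group F" "NN \<noteq> {}" "\<And>N. N \<in> NN \<Longrightarrow> N \<subseteq> carrier F"
    and "\<And>M N. M \<in> NN \<Longrightarrow> N \<in> NN \<Longrightarrow> M \<inter> N \<in> NN"
  shows "openin (pro_topology F NN) U \<longleftrightarrow>
           U \<subseteq> carrier F \<and> (\<forall>x\<in>U. \<exists>N\<in>NN. N #>\<^bsub>F\<^esub> x \<subseteq> U)"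
proof -
  have "istopology (\<lambda>U. U \<subseteq> carrier F \<and> (\<forall>x\<in>U. \<exists>N\<in>NN. N #>\<^bsub>F\<^esub> x \<subseteq> U))"
    unfolding istopology_def
  proof safe
    fix S T x
    assume "\<forall>x\<in>S. \<exists>N\<in>NN. N #>\<^bsub>F\<^esub> x \<subseteq> S" "\<forall>x\<in>T. \<exists>N\<in>NN. N #>\<^bsub>F\<^esub> x \<subseteq> T" "x \<in> S" "x \<in> T"
    then obtain M N where "M \<in> NN" "N \<in> NN" "M #>\<^bsub>F\<^esub> x \<subseteq> S" "N #>\<^bsub>F\<^esub> x \<subseteq> T"
      by meson
    moreover have "(M \<inter> N) #>\<^bsub>F\<^esub> x \<subseteq> (M #>\<^bsub>F\<^esub> x) \<inter> (N #>\<^bsub>F\<^esub> x)"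
      by (auto simp: r_coset_def)
    ultimately show "\<exists>N\<in>NN. N #>\<^bsub>F\<^esub> x \<subseteq> S \<inter> T"
      using assms(4) by (meson Int_mono order_trans)
  next
    fix K x S assume "\<forall>S\<in>K. S \<subseteq> carrier F \<and> (\<forall>x\<in>S. \<exists>N\<in>NN. N #>\<^bsub>F\<^esub> x \<subseteq> S)" "S \<in> K" "x \<in> S"
    then show "\<exists>N\<in>NN. N #>\<^bsub>F\<^esub> x \<subseteq> \<Union> K"
      by (meson Union_upper order_trans)
  qed auto
  thus ?thesis by (simp add: pro_topology_def)
qed

definition finitely_generated_subgroup :: "('g, 'm) monoid_scheme \<Rightarrow> 'g set \<Rightarrow> bool" where
  "finitely_generated_subgroup F H \<longleftrightarrow>
     (\<exists>S. finite S \<and> S \<subseteq> carrier F \<and> H = generate F S)"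

definition product_set :: "('g, 'm) monoid_scheme \<Rightarrow> 'g set list \<Rightarrow> 'g set" where
  "product_set F Hs = foldr (set_mult F) Hs {\<one>\<^bsub>F\<^esub>}"

definition Ribes_Zalesskii :: "('g, 'm) monoid_scheme \<Rightarrow> 'g set set \<Rightarrow> bool" where
  "Ribes_Zalesskii F NN \<longleftrightarrow>
     (\<forall>Hs. Hs \<noteq> [] \<and>
           (\<forall>H\<in>set Hs. finitely_generated_subgroup F H \<and> closedin (pro_topology F NN) H)
        \<longrightarrow> closedin (pro_topology F NN) (product_set F Hs))"


section \<open>Graphs in the sense of Serre and profinite graphs\<close>

record ('v, 'e) sgraph =
  verts :: "'v set"
  edges :: "'e set"
  ini :: "'e \<Rightarrow> 'v"
  ter :: "'e \<Rightarrow> 'v"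
  einv :: "'e \<Rightarrow> 'e"
  pos :: "'e set"

definition serre_graph :: "('v, 'e, 'm) sgraph_scheme \<Rightarrow> bool" where
  "serre_graph G \<longleftrightarrow> pos G \<subseteq> edges G \<and>
     (\<forall>e\<in>edges G. ini G e \<in> verts G \<and> ter G e \<in> verts G \<and> einv G e \<in> edges G \<and>
        einv G (einv G e) = e \<and> ini G (einv G e) = ter G e \<and> ter G (einv G e) = ini G e \<and>
        (einv G e \<in> pos G \<longleftrightarrow> e \<notin> pos G))"

definition graph_morphism ::
    "('v, 'e, 'm) sgraph_scheme \<Rightarrow> ('w, 'f, 'n) sgraph_scheme \<Rightarrow> ('v \<Rightarrow> 'w) \<Rightarrow> ('e \<Rightarrow> 'f) \<Rightarrow> bool"
  where
  "graph_morphism G D p q \<longleftrightarrow> p \<in> verts G \<rightarrow> verts D \<and> q \<in> edges G \<rightarrow> edges D \<and>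
     (\<forall>e\<in>edges G. ini D (q e) = p (ini G e) \<and> ter D (q e) = p (ter G e) \<and>
        einv D (q e) = q (einv G e) \<and> (q e \<in> pos D \<longleftrightarrow> e \<in> pos G))"

definition graph_connected :: "('v, 'e, 'm) sgraph_scheme \<Rightarrow> bool" where
  "graph_connected G \<longleftrightarrow>
     (\<forall>u\<in>verts G. \<forall>v\<in>verts G. (u, v) \<in> {(ini G e, ter G e) |e. e \<in> edges G}\<^sup>*)"

record ('v, 'e) top_sgraph = "('v, 'e) sgraph" +
  vtop :: "'v topology"
  etop :: "'e topology"

text \<open>Every finite graph is isomorphic to one whose vertices and edges are natural numbers, so it
  suffices to let the finite quotient graphs \<open>D\<close> range over those.\<close>

definition profinite_connected :: "('v, 'e) top_sgraph \<Rightarrow> bool" where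
  "profinite_connected G \<longleftrightarrow>
     (\<forall>(D :: (nat, nat) sgraph) p q.
        serre_graph D \<and> finite (verts D) \<and> finite (edges D) \<and>
        graph_morphism G D p q \<and> p ` verts G = verts D \<and> q ` edges G = edges D \<and>
        continuous_map (vtop G) (discrete_topology (verts D)) p \<and>
        continuous_map (etop G) (discrete_topology (edges D)) q
        \<longrightarrow> graph_connected D)"

definition closed_subgraph :: "('v, 'e) top_sgraph \<Rightarrow> 'v set \<Rightarrow> 'e set \<Rightarrow> bool" where
  "closed_subgraph G V E \<longleftrightarrow>
     V \<subseteq> verts G \<and> E \<subseteq> edges G \<and> closedin (vtop G) V \<and> closedin (etop G) E \<and>
     (\<forall>e\<in>E. ini G e \<in> V \<and> ter G e \<in> V \<and> einv G e \<in> E)"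

definition restrict_graph :: "('v, 'e) top_sgraph \<Rightarrow> 'v set \<Rightarrow> 'e set \<Rightarrow> ('v, 'e) top_sgraph" where
  "restrict_graph G V E = G\<lparr>verts := V, edges := E, pos := pos G \<inter> E,
     vtop := subtopology (vtop G) V, etop := subtopology (etop G) E\<rparr>"

definition connected_subgraphs :: "('v, 'e) top_sgraph \<Rightarrow> 'v set \<Rightarrow> ('v set \<times> 'e set) set" where
  "connected_subgraphs G S =
     {(V, E). closed_subgraph G V E \<and> profinite_connected (restrict_graph G V E) \<and> S \<subseteq> V}"

definition tree_like :: "('v, 'e) top_sgraph \<Rightarrow> bool" where
  "tree_like G \<longleftrightarrow> profinite_connected G \<and>
     (\<forall>u\<in>verts G. \<forall>v\<in>verts G.
        profinite_connected
          (restrict_graph G (\<Inter>(fst ` connected_subgraphs G {u, v}))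
                            (\<Inter>(snd ` connected_subgraphs G {u, v}))))"


section \<open>Projective limits\<close>

text \<open>For \<open>leq i j\<close> the bonding map \<open>p i j\<close> goes from \<open>S j\<close> to \<open>S i\<close>.\<close>

definition proj_limit ::
    "'i set \<Rightarrow> ('i \<Rightarrow> 'i \<Rightarrow> bool) \<Rightarrow> ('i \<Rightarrow> 'x set) \<Rightarrow> ('i \<Rightarrow> 'i \<Rightarrow> 'x \<Rightarrow> 'x) \<Rightarrow> ('i \<Rightarrow> 'x) set" where
  "proj_limit I leq S p =
     {x \<in> \<Pi>\<^sub>E i\<in>I. S i. \<forall>i\<in>I. \<forall>j\<in>I. leq i j \<longrightarrow> p i j (x j) = x i}"

definition proj_limit_topology ::
    "'i set \<Rightarrow> ('i \<Rightarrow> 'i \<Rightarrow> bool) \<Rightarrow> ('i \<Rightarrow> 'x set) \<Rightarrow> ('i \<Rightarrow> 'i \<Rightarrow> 'x \<Rightarrow> 'x) \<Rightarrow> ('i \<Rightarrow> 'x) topology" where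
  "proj_limit_topology I leq S p =
     subtopology (product_topology (\<lambda>i. discrete_topology (S i)) I) (proj_limit I leq S p)"

definition proj_limit_group ::
    "'i set \<Rightarrow> ('i \<Rightarrow> 'i \<Rightarrow> bool) \<Rightarrow> ('i \<Rightarrow> ('x, 'm) monoid_scheme) \<Rightarrow> ('i \<Rightarrow> 'i \<Rightarrow> 'x \<Rightarrow> 'x)
      \<Rightarrow> ('i \<Rightarrow> 'x) monoid" where
  "proj_limit_group I leq G p =
     (product_group I G)\<lparr>carrier := proj_limit I leq (\<lambda>i. carrier (G i)) p\<rparr>"

definition proj_limit_graph ::
    "'i set \<Rightarrow> ('i \<Rightarrow> 'i \<Rightarrow> bool) \<Rightarrow> ('i \<Rightarrow> ('v, 'e) sgraph) \<Rightarrow> ('i \<Rightarrow> 'i \<Rightarrow> 'v \<Rightarrow> 'v)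
      \<Rightarrow> ('i \<Rightarrow> 'i \<Rightarrow> 'e \<Rightarrow> 'e) \<Rightarrow> ('i \<Rightarrow> 'v, 'i \<Rightarrow> 'e) top_sgraph" where
  "proj_limit_graph I leq G p q =
     \<lparr>verts = proj_limit I leq (\<lambda>i. verts (G i)) p,
      edges = proj_limit I leq (\<lambda>i. edges (G i)) q,
      ini = (\<lambda>e. \<lambda>i\<in>I. ini (G i) (e i)),
      ter = (\<lambda>e. \<lambda>i\<in>I. ter (G i) (e i)),
      einv = (\<lambda>e. \<lambda>i\<in>I. einv (G i) (e i)),
      pos = proj_limit I leq (\<lambda>i. pos (G i)) q,
      vtop = proj_limit_topology I leq (\<lambda>i. verts (G i)) p,
      etop = proj_limit_topology I leq (\<lambda>i. edges (G i)) q\<rparr>"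


section \<open>Cayley graphs\<close>

text \<open>\<open>val x\<close> is the element of the group represented by the letter \<open>x\<close>.\<close>

definition cayley_graph ::
    "('g, 'm) monoid_scheme \<Rightarrow> 'a set \<Rightarrow> ('a letter \<Rightarrow> 'g) \<Rightarrow> ('g, 'g \<times> 'a letter) sgraph" where
  "cayley_graph G A val =
     \<lparr>verts = carrier G,
      edges = carrier G \<times> letters A,
      ini = fst,
      ter = (\<lambda>(g, x). g \<otimes>\<^bsub>G\<^esub> val x),
      einv = (\<lambda>(g, x). (g \<otimes>\<^bsub>G\<^esub> val x, letter_inv x)),
      pos = carrier G \<times> {x \<in> letters A. snd x}\<rparr>"

definition quotient_cayley_graph ::
    "'a set \<Rightarrow> 'a letter list set
      \<Rightarrow> ('a letter list set, 'a letter list set \<times> 'a letter) sgraph" where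
  "quotient_cayley_graph A N =
     cayley_graph (free_group A Mod N) A (\<lambda>x. N #>\<^bsub>free_group A\<^esub> [x])"

text \<open>The index set is ordered by reverse inclusion; for \<open>N \<subseteq> M\<close> the canonical projection from
  \<open>F/N\<close> to \<open>F/M\<close> sends a coset \<open>C\<close> to \<open>MC\<close>.\<close>

definition pro_completion ::
    "'a set \<Rightarrow> 'a letter list set set \<Rightarrow> ('a letter list set \<Rightarrow> 'a letter list set) monoid" where
  "pro_completion A NN =
     proj_limit_group NN (\<supseteq>) (\<lambda>N. free_group A Mod N) (\<lambda>M N C. M <#>\<^bsub>free_group A\<^esub> C)"

definition pro_cayley_graph ::
    "'a set \<Rightarrow> 'a letter list set set
      \<Rightarrow> ('a letter list set \<Rightarrow> 'a letter list set,
          'a letter list set \<Rightarrow> 'a letter list set \<times> 'a letter) top_sgraph" where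
  "pro_cayley_graph A NN =
     proj_limit_graph NN (\<supseteq>) (quotient_cayley_graph A)
       (\<lambda>M N C. M <#>\<^bsub>free_group A\<^esub> C)
       (\<lambda>M N (C, x). (M <#>\<^bsub>free_group A\<^esub> C, x))"

lemma verts_pro_cayley_graph:
  "verts (pro_cayley_graph A NN) = carrier (pro_completion A NN)"
  by (simp add: pro_cayley_graph_def proj_limit_graph_def pro_completion_def proj_limit_group_def
      quotient_cayley_graph_def cayley_graph_def)

lemma edges_pro_cayley_graph:
  assumes ne: "NN \<noteq> {}" and dir: "\<And>M N. M \<in> NN \<Longrightarrow> N \<in> NN \<Longrightarrow> M \<inter> N \<in> NN"
  shows "bij_betw (\<lambda>(g, x). \<lambda>N\<in>NN. (g N, x))
           (carrier (pro_completion A NN) \<times> letters A) (edges (pro_cayley_graph A NN))"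
proof -
  let ?f = "\<lambda>(g, x). \<lambda>N\<in>NN. (g N, x :: 'a letter)"
  let ?F = "free_group A"
  let ?E = "proj_limit NN (\<supseteq>) (\<lambda>N. carrier (?F Mod N) \<times> letters A)
              (\<lambda>M N (C, x). (M <#>\<^bsub>?F\<^esub> C, x))"
  let ?V = "proj_limit NN (\<supseteq>) (\<lambda>N. carrier (?F Mod N)) (\<lambda>M N C. M <#>\<^bsub>?F\<^esub> C)"
  have "inj_on ?f (?V \<times> letters A)"
  proof (rule inj_onI)
    fix a b assume ab: "a \<in> ?V \<times> letters A" "b \<in> ?V \<times> letters A" and eq: "?f a = ?f b"
    have *: "(fst a N, snd a) = (fst b N, snd b)" if "N \<in> NN" for N
      using fun_cong[OF eq, of N] that by (simp add: case_prod_unfold)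
    have "fst a \<in> (\<Pi>\<^sub>E N\<in>NN. carrier (?F Mod N))" "fst b \<in> (\<Pi>\<^sub>E N\<in>NN. carrier (?F Mod N))"
      using ab by (simp_all add: proj_limit_def mem_Times_iff)
    then have "fst a = fst b" using * by (intro PiE_ext) auto
    moreover have "snd a = snd b" using * ne by auto
    ultimately show "a = b" by (rule prod_eqI)
  qed
  moreover have "?f ` (?V \<times> letters A) = ?E"
  proof (intro equalityI subsetI)
    fix e assume "e \<in> ?f ` (?V \<times> letters A)"
    then obtain g x where g: "g \<in> ?V" and x: "x \<in> letters A" and e: "e = ?f (g, x)"
      by blast
    have "g N \<in> carrier (?F Mod N)" if "N \<in> NN" for N
      using g that unfolding proj_limit_def by blast
    moreover have "M <#>\<^bsub>?F\<^esub> g N = g M" if "M \<in> NN" "N \<in> NN" "N \<subseteq> M" for M N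
      using g that unfolding proj_limit_def by blast
    ultimately show "e \<in> ?E"
      using x unfolding e proj_limit_def by (simp add: restrict_PiE_iff)
  next
    fix e assume e: "e \<in> ?E"
    obtain K where K: "K \<in> NN" using ne by blast
    have compat: "(M <#>\<^bsub>?F\<^esub> fst (e N), snd (e N)) = e M"
      if "M \<in> NN" "N \<in> NN" "N \<subseteq> M" for M N
    proof -
      have "(\<lambda>(C, x). (M <#>\<^bsub>?F\<^esub> C, x)) (e N) = e M"
        using e that unfolding proj_limit_def by blast
      then show ?thesis by (simp add: case_prod_unfold)
    qed
    have lab: "snd (e M) = snd (e N)" if "M \<in> NN" "N \<in> NN" for M N
    proof -
      have "snd (e M) = snd (e (M \<inter> N))" "snd (e N) = snd (e (M \<inter> N))"
        using arg_cong[OF compat[of M "M \<inter> N"], of snd] arg_cong[OF compat[of N "M \<inter> N"], of snd]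
          dir[OF that] that by simp_all
      then show ?thesis by simp
    qed
    have emem: "fst (e N) \<in> carrier (?F Mod N)" "snd (e N) \<in> letters A" if "N \<in> NN" for N
    proof -
      have "e N \<in> carrier (?F Mod N) \<times> letters A"
        using e that by (simp only: proj_limit_def mem_Collect_eq PiE_iff)
      then show "fst (e N) \<in> carrier (?F Mod N)" "snd (e N) \<in> letters A"
        by (simp_all only: mem_Times_iff)
    qed
    have undef: "e N = undefined" if "N \<notin> NN" for N
      using e that by (simp add: proj_limit_def PiE_iff extensional_def)
    define g where "g = (\<lambda>N\<in>NN. fst (e N))"
    have gN: "g N = fst (e N)" if "N \<in> NN" for N
      using that by (simp add: g_def)
    have "g \<in> (\<Pi>\<^sub>E N\<in>NN. carrier (?F Mod N))"
      unfolding g_def using emem(1) by (intro restrict_PiE_iff[THEN iffD2] ballI)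
    moreover have "M <#>\<^bsub>?F\<^esub> g N = g M" if "M \<in> NN" "N \<in> NN" "N \<subseteq> M" for M N
      using arg_cong[OF compat[OF that], of fst] gN that by simp
    ultimately have "g \<in> ?V"
      unfolding proj_limit_def by blast
    moreover have "snd (e K) \<in> letters A"
      using emem(2) K .
    moreover have "e = ?f (g, snd (e K))"
    proof (rule HOL.ext)
      fix N show "e N = ?f (g, snd (e K)) N"
      proof (cases "N \<in> NN")
        case True
        then show ?thesis using lab[OF True K] by (simp add: gN prod_eq_iff)
      qed (simp add: undef)
    qed
    ultimately show "e \<in> ?f ` (?V \<times> letters A)" by blast
  qed
  ultimately show ?thesis
    by (simp add: bij_betw_def pro_cayley_graph_def proj_limit_graph_def pro_completion_def
        proj_limit_group_def quotient_cayley_graph_def cayley_graph_def)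
qed

lemma serre_graph_quotient_cayley_graph:
  assumes "N \<lhd> free_group A"
  shows "serre_graph (quotient_cayley_graph A N)"
proof -
  interpret N: normal N "free_group A" by fact
  interpret Q: group "free_group A Mod N" by (rule N.factorgroup_is_group)
  let ?val = "\<lambda>x. N #>\<^bsub>free_group A\<^esub> [x]"
  have car: "[x] \<in> carrier (free_group A)" if "x \<in> letters A" for x
    using that by (simp add: free_group_def reduced_Cons)
  have val: "?val x \<in> carrier (free_group A Mod N)" if "x \<in> letters A" for x
    using car[OF that] by (auto simp: FactGroup_def RCOSETS_def)
  have "?val x \<otimes>\<^bsub>free_group A Mod N\<^esub> ?val (letter_inv x) = \<one>\<^bsub>free_group A Mod N\<^esub>"
    if "x \<in> letters A" for x
  proof -
    have "[x] \<otimes>\<^bsub>free_group A\<^esub> [letter_inv x] = \<one>\<^bsub>free_group A\<^esub>"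
      by (simp add: free_group_def push_letter_def)
    then show ?thesis
      using N.rcos_sum[of "[x]" "[letter_inv x]"] car[OF that] car[of "letter_inv x"] that
      by (simp add: FactGroup_def N.coset_mult_one[OF N.subset])
  qed
  then have cancel:
    "(g \<otimes>\<^bsub>free_group A Mod N\<^esub> ?val x) \<otimes>\<^bsub>free_group A Mod N\<^esub> ?val (letter_inv x) = g"
    if "x \<in> letters A" "g \<in> carrier (free_group A Mod N)" for g x
    using that val[of x] val[of "letter_inv x"] by (simp add: Q.m_assoc del: mult_FactGroup one_FactGroup)
  have closed: "g \<otimes>\<^bsub>free_group A Mod N\<^esub> ?val x \<in> carrier (free_group A Mod N)"
    if "x \<in> letters A" "g \<in> carrier (free_group A Mod N)" for g x
    using that val by (intro Q.m_closed)
  show ?thesis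
    unfolding serre_graph_def quotient_cayley_graph_def cayley_graph_def sgraph.simps
    by (intro conjI ballI; clarify?;
        simp only: mem_Times_iff fst_conv snd_conv case_prod_conv closed cancel letter_inv_in_letters
          letter_inv_letter_inv mem_Collect_eq)
      (auto simp: letter_inv_def)
qed

end

theory Submission
  imports Defs
begin

text \<open>Write \<open>E\<close> for a congruence on words with finite quotient, and refine it by also recording, for
  every set of edges of its Cayley graph, the parity of the number of crossings. If a closed polygon
  in an iterated refinement has sides that are read in a finite inverse automaton, then a cut argument
  splits it into polygons with fewer sides one level below; by induction the sides can be replaced by
  words with the same end states whose product is trivial in the free group. Applied to Schreier
  graphs, this separates an element \<open>w\<close> from a product \<open>H\<^sub>1\<dots>H\<^sub>n\<close> of finitely generated subgroups in a
  finite quotient.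

  If the \<open>H\<^sub>i\<close> have infinite index, then some vertex of the finite Cayley graph is avoided by all the
  relevant paths. Inserting long new segments into the cycles of two generators at this vertex turns
  the quotient into an alternating group of arbitrarily large degree (the commutator of two suitable
  powers is a 3-cycle) and still separates \<open>w\<close>. There are only countably many pairs consisting of a
  tuple of subgroups and an element, so each of them gets a degree of its own.

  Closed subgroups of finite index are open and therefore harmless, which yields the product theorem.
  If two connected subgraphs of the profinite Cayley graph contain \<open>u\<close> and \<open>v\<close>, then separating products
  of two fundamental groups shows that \<open>u\<close> and \<open>v\<close> lie in one component of their intersection, so
  the connected subgraphs containing \<open>u\<close> and \<open>v\<close> form a directed family.\<close>

section \<open>Words, inverse automata and word congruences\<close>

text \<open>The quotients that first separate a product are extensions by 2-groups, and a simple
  group of large degree does not in general map back onto them. The enlarged action therefore keeps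
  information only about paths that miss the altered vertex. This is where infinite index enters:
  the Schreier graph of a subgroup of finite index is finite and reads every word, so no vertex
  could be kept free. Parity has a second task. In the refined Cayley graph the cycles of two
  generators through a common vertex meet only there, and this makes the commutator of permutations
  supported on them a 3-cycle. Each refinement pays for one more side of a polygon, so the number of
  factors fixes the number of refinements. Only one quotient is available in each degree, yet the
  sequence has to serve all products at once; hence the demand that every single separation can be
  achieved in arbitrarily large degree.\<close>

definition inv_word :: "'a letter list \<Rightarrow> 'a letter list" where
  "inv_word u = rev (map letter_inv u)"

definition red :: "'a letter list \<Rightarrow> 'a letter list" where
  "red u = foldr push_letter u []"

lemma inv_word_simps [simp]:
  "inv_word [] = []" "inv_word (x # u) = inv_word u @ [letter_inv x]"
  "inv_word (u @ v) = inv_word v @ inv_word u" "inv_word (inv_word u) = u"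
  by (simp_all add: inv_word_def rev_map comp_def)

lemma inv_word_in_lists [simp]: "inv_word u \<in> lists (letters A) \<longleftrightarrow> u \<in> lists (letters A)"
  by (auto simp: inv_word_def)

lemma red_Nil [simp]: "red [] = []"
  by (simp add: red_def)

lemma reduced_red [simp]: "reduced_word (red u)"
  by (simp add: red_def reduced_foldr_push)

lemma red_reduced: "reduced_word u \<Longrightarrow> red u = u"
  by (simp add: red_def foldr_push_Nil)

lemma red_in_lists: "u \<in> lists (letters A) \<Longrightarrow> red u \<in> lists (letters A)"
  unfolding red_def by (rule foldr_push_in_lists) (auto simp del: in_lists_conv_set)

lemma foldr_push_red: "foldr push_letter u (red v) = red (u @ v)"
  by (simp add: red_def)

lemma red_append: "red (u @ v) = foldr push_letter (red u) (red v)"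
  using foldr_push_assoc[of "[]" "red v" u] by (simp add: foldr_push_red flip: red_def)

lemma red_red_append [simp]: "red (red u @ v) = red (u @ v)" "red (u @ red v) = red (u @ v)"
  by (simp_all add: red_append red_reduced)

lemma red_inv_left [simp]: "red (inv_word u @ u) = []"
  using foldr_push_rev[of "[]" u] by (simp add: red_def inv_word_def)

lemma red_inv_right [simp]: "red (u @ inv_word u) = []"
  using red_inv_left[of "inv_word u"] by simp

lemma red_eq_iff: "red u = red v \<longleftrightarrow> red (u @ inv_word v) = []"
proof
  assume "red u = red v"
  then show "red (u @ inv_word v) = []"
    by (metis red_append red_inv_right)
next
  assume "red (u @ inv_word v) = []"
  then have "red (red (u @ inv_word v) @ v) = red v" by simp
  then show "red u = red v"
    by (metis append_assoc append_Nil2 red_inv_left red_red_append)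
qed

lemma carrier_free_group: "u \<in> carrier (free_group A) \<longleftrightarrow> u \<in> lists (letters A) \<and> reduced_word u"
  by (simp add: free_group_simps)

lemma mult_free_group: "reduced_word v \<Longrightarrow> u \<otimes>\<^bsub>free_group A\<^esub> v = red (u @ v)"
  using foldr_push_red[of u v] by (simp add: free_group_simps red_reduced)

lemma inv_free_group:
  assumes "u \<in> carrier (free_group A)"
  shows "inv\<^bsub>free_group A\<^esub> u = red (inv_word u)"
proof (rule group.inv_equality[OF group_free_group])
  show "red (inv_word u) \<in> carrier (free_group A)"
    using assms red_in_lists[of "inv_word u" A] unfolding carrier_free_group by simp
  show "red (inv_word u) \<otimes>\<^bsub>free_group A\<^esub> u = \<one>\<^bsub>free_group A\<^esub>"
    using assms unfolding carrier_free_group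
    by (simp only: mult_free_group) (simp add: free_group_simps)
qed (rule assms)

text \<open>\<open>reads \<delta> u s t\<close> applies the last letter of \<open>u\<close> first, so words act from the left.\<close>

primrec reads :: "('a letter \<Rightarrow> 's \<Rightarrow> 's \<Rightarrow> bool) \<Rightarrow> 'a letter list \<Rightarrow> 's \<Rightarrow> 's \<Rightarrow> bool" where
  "reads \<delta> [] s t \<longleftrightarrow> s = t"
| "reads \<delta> (x # u) s t \<longleftrightarrow> (\<exists>m. reads \<delta> u s m \<and> \<delta> x m t)"

text \<open>By \<open>det\<close> and \<open>sym\<close> every letter acts as a partial injection,
  so readable words stay readable under free reduction. Pieces of Schreier graphs are of this
  kind.\<close>

locale inverse_automaton =
  fixes \<delta> :: "'a letter \<Rightarrow> 's \<Rightarrow> 's \<Rightarrow> bool"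
  assumes det: "\<delta> x s t \<Longrightarrow> \<delta> x s t' \<Longrightarrow> t = t'"
    and sym: "\<delta> x s t \<Longrightarrow> \<delta> (letter_inv x) t s"
begin

lemma reads_append: "reads \<delta> (u @ v) s t \<longleftrightarrow> (\<exists>m. reads \<delta> v s m \<and> reads \<delta> u m t)"
  by (induction u arbitrary: t) auto

lemma reads_inv: "reads \<delta> u s t \<Longrightarrow> reads \<delta> (inv_word u) t s"
  by (induction u arbitrary: t) (auto simp: reads_append intro: sym)

lemma reads_det: "reads \<delta> u s t \<Longrightarrow> reads \<delta> u s t' \<Longrightarrow> t = t'"
  by (induction u arbitrary: t t') (auto dest: det)

lemma reads_push: "reads \<delta> (x # u) s t \<Longrightarrow> reads \<delta> (push_letter x u) s t"
  by (cases u) (simp_all add: push_letter_def, metis det letter_inv_letter_inv sym)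

lemma reads_red: "reads \<delta> u s t \<Longrightarrow> reads \<delta> (red u) s t"
proof (induction u arbitrary: t)
  case (Cons x u)
  then obtain m where "reads \<delta> (red u) s m" "\<delta> x m t" by auto
  then have "reads \<delta> (x # red u) s t" by auto
  then show ?case using reads_push by (simp add: red_def)
qed simp

end

text \<open>The kernels of maps from words to quotient groups of a free group: \<open>cancel\<close>
  turns formal inverses into inverses. Words need not be reduced, so paths can be joined and split
  freely.\<close>

locale word_congruence =
  fixes E :: "'a letter list \<Rightarrow> 'a letter list \<Rightarrow> bool"
  assumes refl [simp]: "E u u"
    and sym: "E u v \<Longrightarrow> E v u"
    and trans [trans]: "E u v \<Longrightarrow> E v w \<Longrightarrow> E u w"
    and app: "E u v \<Longrightarrow> E (w @ u @ z) (w @ v @ z)"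
    and cancel: "E [x, letter_inv x] []"
begin

lemma app_left: "E u v \<Longrightarrow> E (w @ u) (w @ v)"
  using app[of u v w "[]"] by simp

lemma app_right: "E u v \<Longrightarrow> E (u @ z) (v @ z)"
  using app[of u v "[]" z] by simp

lemma app_Cons: "E u v \<Longrightarrow> E (x # u) (x # v)"
  using app_left[of u v "[x]"] by simp

lemma cancel_Cons: "E (x # letter_inv x # u) u" "E (letter_inv x # x # u) u"
  using app_right[OF cancel[of x], of u] app_right[OF cancel[of "letter_inv x"], of u] by simp_all

lemma inv_left: "E (inv_word u @ u) []"
proof (induction u)
  case (Cons x u)
  then show ?case
    using trans[OF app[OF cancel[of "letter_inv x"], of "inv_word u" u]] by simp
qed simp

lemma inv_right: "E (u @ inv_word u) []"
  using inv_left[of "inv_word u"] by simp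

lemma left_inv_iff: "E (u @ v) w \<longleftrightarrow> E v (inv_word u @ w)"
proof
  assume "E (u @ v) w"
  then have "E (inv_word u @ u @ v) (inv_word u @ w)" by (rule app_left)
  then show "E v (inv_word u @ w)"
    using app_right[OF inv_left[of u], of v] by (auto intro: trans sym)
next
  assume "E v (inv_word u @ w)"
  then have "E (u @ v) (u @ inv_word u @ w)" by (rule app_left)
  then show "E (u @ v) w"
    using app_right[OF inv_right[of u], of w] by (auto intro: trans)
qed

lemma right_inv_iff: "E (u @ v) w \<longleftrightarrow> E u (w @ inv_word v)"
proof
  assume "E (u @ v) w"
  then have "E ((u @ v) @ inv_word v) (w @ inv_word v)" by (rule app_right)
  then show "E u (w @ inv_word v)"
    using app_left[OF inv_right[of v], of u] by (auto intro: trans sym)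
next
  assume "E u (w @ inv_word v)"
  then have "E (u @ v) ((w @ inv_word v) @ v)" by (rule app_right)
  then show "E (u @ v) w"
    using app_left[OF inv_left[of v], of w] by (auto intro: trans)
qed

lemma rotate: "E (u @ v) [] \<Longrightarrow> E (v @ u) []"
  using left_inv_iff[of u v "[]"] right_inv_iff[of v u "[]"] by simp

lemma E_push: "E (push_letter x u) (x # u)"
  by (cases u) (simp_all add: push_letter_def sym[OF cancel_Cons(1)])

lemma E_red: "E (red u) u"
proof (induction u)
  case (Cons x u)
  have "E (red (x # u)) (x # red u)" using E_push by (simp add: red_def)
  also have "E (x # red u) (x # u)" using Cons by (rule app_Cons)
  finally show ?case .
qed simp

end

section \<open>Parity of edge crossings\<close>

text \<open>A set \<open>T\<close> of geometric edges of the left Cayley graph is given by the pairs of an initial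
  vertex and a generator; \<open>crosses T u g\<close> is the parity of the number of edges of \<open>T\<close> on the path
  that starts at \<open>g\<close> and reads \<open>u\<close>.\<close>

definition letter_edge :: "('a letter list \<Rightarrow> 'a \<Rightarrow> bool) \<Rightarrow> 'a letter \<Rightarrow> 'a letter list \<Rightarrow> bool" where
  "letter_edge T x g = (if snd x then T g (fst x) else T (x # g) (fst x))"

primrec crosses ::
    "('a letter list \<Rightarrow> 'a \<Rightarrow> bool) \<Rightarrow> 'a letter list \<Rightarrow> 'a letter list \<Rightarrow> bool" where
  "crosses T [] g = False"
| "crosses T (x # u) g = (letter_edge T x (u @ g) \<noteq> crosses T u g)"

text \<open>Invariance makes \<open>T\<close> a set of edges of the Cayley graph of the quotient by
  \<open>E\<close>.\<close>

definition edge_invariant ::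
    "('a letter list \<Rightarrow> 'a letter list \<Rightarrow> bool) \<Rightarrow> ('a letter list \<Rightarrow> 'a \<Rightarrow> bool) \<Rightarrow> bool" where
  "edge_invariant E T \<longleftrightarrow> (\<forall>g h a. E g h \<longrightarrow> T g a = T h a)"

text \<open>If \<open>E\<close> is the congruence of a normal subgroup N, this is the congruence of
  N^2[N,N]: two paths with the same end are identified when they agree as mod 2 chains of the Cayley
  graph.\<close>

definition even_refinement ::
    "('a letter list \<Rightarrow> 'a letter list \<Rightarrow> bool) \<Rightarrow> 'a letter list \<Rightarrow> 'a letter list \<Rightarrow> bool" where
  "even_refinement E u v \<longleftrightarrow>
     E u v \<and> (\<forall>T. edge_invariant E T \<longrightarrow> crosses T u [] = crosses T v [])"

lemma crosses_append: "crosses T (u @ v) g = (crosses T u (v @ g) \<noteq> crosses T v g)"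
  by (induction u) auto

text \<open>Translating the edge set replaces moving the base point. Thus parity conditions at the
  empty word control paths that start after a right factor.\<close>

lemma crosses_shift: "crosses (\<lambda>h. T (h @ g)) u h = crosses T u (h @ g)"
  by (induction u) (auto simp: letter_edge_def)

lemma crosses_imp: "crosses T u g \<Longrightarrow> \<exists>v x w. u = v @ x # w \<and> letter_edge T x (w @ g)"
proof (induction u)
  case (Cons y u)
  show ?case
  proof (cases "crosses T u g")
    case True
    then show ?thesis using Cons.IH by (metis append_Cons)
  next
    case False
    then show ?thesis using Cons.prems by (intro exI[of _ "[]"]) auto
  qed
qed simp

context word_congruence
begin

lemma letter_edge_cong:
  "edge_invariant E T \<Longrightarrow> E g h \<Longrightarrow> letter_edge T x g = letter_edge T x h"
  by (auto simp: letter_edge_def edge_invariant_def dest: app_Cons)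

lemma crosses_cong: "edge_invariant E T \<Longrightarrow> E g h \<Longrightarrow> crosses T u g = crosses T u h"
proof (induction u)
  case (Cons x u)
  then show ?case
    using letter_edge_cong[OF Cons.prems(1) app_left[OF Cons.prems(2)], of x u] by simp
qed simp

lemma word_congruence_even: "word_congruence (even_refinement E)"
proof
  fix u v w z x
  show "even_refinement E u u" by (simp add: even_refinement_def)
  show "even_refinement E v u" if "even_refinement E u v"
    using that sym by (simp add: even_refinement_def)
  show "even_refinement E u w" if "even_refinement E u v" "even_refinement E v w"
    using that trans by (auto simp: even_refinement_def)
  show "even_refinement E (w @ u @ z) (w @ v @ z)" if uv: "even_refinement E u v"
    unfolding even_refinement_def
  proof (intro conjI allI impI)
    show "E (w @ u @ z) (w @ v @ z)" using uv app by (simp add: even_refinement_def)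
    fix T assume T: "edge_invariant E T"
    then have "edge_invariant E (\<lambda>h. T (h @ z))"
      by (auto simp: edge_invariant_def dest: app_right)
    then have "crosses (\<lambda>h. T (h @ z)) u [] = crosses (\<lambda>h. T (h @ z)) v []"
      using uv by (simp add: even_refinement_def)
    then have "crosses T u z = crosses T v z" by (simp add: crosses_shift)
    moreover have "crosses T w (u @ z) = crosses T w (v @ z)"
      using uv T by (intro crosses_cong) (auto simp: even_refinement_def intro: app_right)
    ultimately show "crosses T (w @ u @ z) [] = crosses T (w @ v @ z) []"
      by (simp add: crosses_append)
  qed
  show "even_refinement E [x, letter_inv x] []"
    unfolding even_refinement_def
  proof (intro conjI allI impI)
    show "E [x, letter_inv x] []" by (rule cancel)
    fix T assume "edge_invariant E T"
    \<comment> \<open>The two letters traverse one geometric edge forth and back.\<close>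
    then have "T [x, letter_inv x] (fst x) = T [] (fst x)"
      using cancel by (auto simp: edge_invariant_def)
    then show "crosses T [x, letter_inv x] [] = crosses T [] []"
      by (auto simp: letter_edge_def letter_inv_def)
  qed
qed

end

lemma word_congruence_even_pow:
  "word_congruence E \<Longrightarrow> word_congruence ((even_refinement ^^ n) E)"
  by (induction n) (auto intro: word_congruence.word_congruence_even)

lemma even_refinement_pow_imp: "(even_refinement ^^ n) E u v \<Longrightarrow> E u v"
  by (induction n) (auto simp: even_refinement_def)

section \<open>Polygons\<close>

text \<open>\<open>E\<close> is so fine that the class of a word determines the end state of a run;
  runs can therefore be followed in the Cayley graph of \<open>E\<close>.\<close>

locale compatible_automaton = inverse_automaton \<delta> + E: word_congruence E
  for \<delta> :: "'a letter \<Rightarrow> 's \<Rightarrow> 's \<Rightarrow> bool" and E +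
  assumes compat: "E u v \<Longrightarrow> reads \<delta> u s t \<Longrightarrow> reads \<delta> v s t' \<Longrightarrow> t = t'"
begin

text \<open>One word \<open>r\<close> has to serve both states; it becomes the diagonal along which
  a polygon is cut.\<close>

definition covisits :: "'s \<Rightarrow> 's \<Rightarrow> 'a letter list \<Rightarrow> bool" where
  "covisits s t g \<longleftrightarrow> (\<exists>r m m'. E r g \<and> reads \<delta> r s m \<and> reads \<delta> r t m')"

definition uses_edge :: "'s \<Rightarrow> 'a letter list \<Rightarrow> 'a letter \<Rightarrow> bool" where
  "uses_edge s g x \<longleftrightarrow> (\<exists>r m. E r g \<and> reads \<delta> (x # r) s m)"

lemma covisits_cong: "E g h \<Longrightarrow> covisits s t g = covisits s t h"
  unfolding covisits_def using E.trans E.sym by blast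

lemma uses_edge_cong: "E g h \<Longrightarrow> uses_edge s g x = uses_edge s h x"
  unfolding uses_edge_def using E.trans E.sym by blast

lemma uses_edge_flip: "uses_edge s g x \<Longrightarrow> uses_edge s (x # g) (letter_inv x)"
  unfolding uses_edge_def
  by (metis E.app_Cons local.sym reads.simps(2))

lemma uses_edge_flip_iff: "uses_edge s (x # g) (letter_inv x) \<longleftrightarrow> uses_edge s g x"
  using uses_edge_flip[of s g x] uses_edge_flip[of s "x # g" "letter_inv x"]
    uses_edge_cong[OF E.cancel_Cons(2)[of x g]] by auto

text \<open>By compatibility all representatives of the class of \<open>g\<close> that are readable
  from a state lead to the same state, so the edge is also available after the common
  representative.\<close>

lemma covisits_edge:
  assumes "covisits s t g" "uses_edge s g x" "uses_edge t g x"
  shows "covisits s t (x # g)"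
proof -
  obtain r m m' where r: "E r g" "reads \<delta> r s m" "reads \<delta> r t m'"
    using assms(1) unfolding covisits_def by blast
  have step: "\<exists>k. \<delta> x l k" if q: "uses_edge q g x" "reads \<delta> r q l" for q l
  proof -
    obtain r' l' k where r': "E r' g" "reads \<delta> r' q l'" "\<delta> x l' k"
      using q(1) unfolding uses_edge_def reads.simps by blast
    have "E r' r" by (rule E.trans[OF r'(1) E.sym[OF r(1)]])
    then have "l' = l" using compat r'(2) q(2) by blast
    then show ?thesis using r'(3) by blast
  qed
  obtain k k' where "\<delta> x m k" "\<delta> x m' k'"
    using step[OF assms(2) r(2)] step[OF assms(3) r(3)] by blast
  then have "reads \<delta> (x # r) s k" "reads \<delta> (x # r) t k'" using r(2,3) by auto
  moreover have "E (x # r) (x # g)" using r(1) by (rule E.app_Cons)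
  ultimately show ?thesis unfolding covisits_def by blast
qed

lemma uses_edge_start:
  assumes "reads \<delta> (v @ x # w) s t"
  shows "uses_edge s w x"
  using assms unfolding uses_edge_def reads_append reads.simps by (metis E.refl)

text \<open>The side is read backwards from its end state. Since the polygon closes up, the backward
  run through \<open>x\<close> represents the vertex \<open>w @ g\<close>, where \<open>x\<close>
  can be read again.\<close>

lemma uses_edge_end:
  assumes "reads \<delta> (v @ x # w) s t" "E (v @ x # w @ g) []"
  shows "uses_edge t (w @ g) x"
proof -
  obtain m m' where m: "reads \<delta> w s m" "\<delta> x m m'" "reads \<delta> v m' t"
    using assms(1) by (auto simp: reads_append)
  then have r: "reads \<delta> (letter_inv x # inv_word v) t m"
    using sym[OF m(2)] reads_inv[OF m(3)] unfolding reads.simps by blast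
  have "E ((v @ [x]) @ (w @ g)) []" using assms(2) by simp
  then have "E (w @ g) (letter_inv x # inv_word v)"
    unfolding E.left_inv_iff by simp
  then have "E (letter_inv x # inv_word v) (w @ g)" by (rule E.sym)
  moreover have "reads \<delta> (x # letter_inv x # inv_word v) t m'" using r m(2) by auto
  ultimately show ?thesis unfolding uses_edge_def by blast
qed

text \<open>The set \<open>R\<close> of vertices that are reachable from the base vertex both along the first and
  along the last side is bounded by edges which lie on at most one of these sides. If \<open>R\<close> misses
  the end of the first side \<open>q\<close>, then \<open>q\<close> crosses the boundary of \<open>R\<close> an odd number of times,
  and parity provides another side that crosses it.\<close>

lemma polygon_cut:
  assumes p: "reads \<delta> p s1 t1" and q: "reads \<delta> q s2 t2"
    and E: "even_refinement E (p @ concat ms @ q) []"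
  shows "covisits s2 t1 q \<or>
         (\<exists>ms1 v w ms2. ms = ms1 @ [v @ w] @ ms2 \<and> covisits s2 t1 (w @ concat ms2 @ q))"
proof (cases "covisits s2 t1 q")
  case True
  then show ?thesis ..
next
  case False
  let ?R = "covisits s2 t1"
  \<comment> \<open>The boundary of the set \<open>covisits s2 t1\<close>, restricted to edges
    usable from the start of \<open>q\<close>. All edges of \<open>q\<close> are usable in this
    sense, so \<open>q\<close> meets \<open>T\<close> exactly where it enters or leaves the
    set.\<close>
  define T where "T h a \<longleftrightarrow> ?R h \<noteq> ?R ((a, True) # h) \<and> uses_edge s2 h (a, True)" for h a
  have inv: "edge_invariant E T"
    unfolding edge_invariant_def T_def
    using covisits_cong uses_edge_cong E.app_Cons by (smt (verit))
  have T: "letter_edge T x h \<longleftrightarrow> ?R h \<noteq> ?R (x # h) \<and> uses_edge s2 h x" for x h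
  proof (cases "snd x")
    case True
    then have "x = (fst x, True)" by (simp add: prod_eq_iff)
    then show ?thesis using True by (metis T_def letter_edge_def)
  next
    case F: False
    have x: "(fst x, True) = letter_inv x" using F by (simp add: letter_inv_def)
    have "?R (letter_inv x # x # h) = ?R h"
      by (rule covisits_cong) (rule E.cancel_Cons)
    then show ?thesis using F by (auto simp: letter_edge_def T_def x uses_edge_flip_iff)
  qed
  have q_cross: "crosses T u [] = (?R [] \<noteq> ?R u)" if "reads \<delta> u s2 m" for u m
    using that
  proof (induction u arbitrary: m)
    case (Cons x u)
    then have "uses_edge s2 u x" using uses_edge_start[of "[]" x u] by auto
    moreover have "crosses T u [] = (?R [] \<noteq> ?R u)" using Cons by auto
    ultimately show ?case by (auto simp: T)
  qed simp
  have "?R []" unfolding covisits_def by (metis E.refl reads.simps(1))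
  then have "crosses T q []" using q_cross[OF q] False by simp
  moreover have "\<not> crosses T (p @ concat ms @ q) []"
    using E inv by (auto simp: even_refinement_def)
  ultimately consider "crosses T p (concat ms @ q)" | "crosses T (concat ms) q"
    by (auto simp: crosses_append)
  then show ?thesis
  proof cases
    case 1
    \<comment> \<open>Impossible: the edge would be usable from \<open>s2\<close> and, backwards
      along \<open>p\<close>, from \<open>t1\<close>, and then both of its ends or neither lie in
      the set.\<close>
    then obtain v x w where vw: "p = v @ x # w" "letter_edge T x (w @ concat ms @ q)"
      using crosses_imp by blast
    let ?h = "w @ concat ms @ q"
    have u1: "uses_edge t1 ?h x"
      using uses_edge_end[of v x w s1 t1] p vw(1) E by (auto simp: even_refinement_def)
    have u2: "uses_edge s2 ?h x" and R: "?R ?h \<noteq> ?R (x # ?h)" using vw(2) T by auto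
    have "?R (x # ?h)" if "?R ?h" using covisits_edge that u1 u2 by blast
    moreover have "?R ?h" if "?R (x # ?h)"
    proof -
      have "?R (letter_inv x # x # ?h)"
        using covisits_edge that u1 u2 uses_edge_flip by blast
      then show ?thesis using covisits_cong[OF E.cancel_Cons(2)] by blast
    qed
    ultimately show ?thesis using R by blast
  next
    case 2
    then obtain v x w where vw: "concat ms = v @ x # w" "letter_edge T x (w @ q)"
      using crosses_imp by blast
    \<comment> \<open>A boundary edge has exactly one end in the set; the middle sides are divided
      at that end.\<close>
    obtain v' w' where v'w': "concat ms = v' @ w'" "?R (w' @ q)"
    proof (cases "?R (w @ q)")
      case True
      then show ?thesis using that[of "v @ [x]" w] vw(1) by simp
    next
      case False
      then show ?thesis using that[of v "x # w"] vw T by auto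
    qed
    have "ms \<noteq> []" using vw(1) by auto
    then obtain ms1 v2 w2 ms2 where "ms = ms1 @ (v2 @ w2) # ms2" "w' = w2 @ concat ms2"
      using concat_eq_appendD[OF v'w'(1)] by blast
    then have "ms = ms1 @ [v2 @ w2] @ ms2 \<and> ?R (w2 @ concat ms2 @ q)" using v'w'(2) by simp
    then show ?thesis by (intro disjI2 exI)
  qed
qed

end

text \<open>The diagonal \<open>r\<close> splits a polygon with \<open>n + 2\<close> sides into two
  with at most \<open>n + 1\<close> sides each. They close up only one level lower, which is why
  each further side costs a refinement.\<close>

lemma (in inverse_automaton) polygon:
  assumes "word_congruence E"
    and compat: "\<And>u v s t t'. E u v \<Longrightarrow> reads \<delta> u s t \<Longrightarrow> reads \<delta> v s t' \<Longrightarrow> t = t'"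
  shows "length sts \<le> Suc n \<Longrightarrow> list_all2 (\<lambda>p (s, t). reads \<delta> p s t) ps sts \<Longrightarrow>
    (even_refinement ^^ n) E (concat ps) [] \<Longrightarrow>
    \<exists>qs. list_all2 (\<lambda>q (s, t). reads \<delta> q s t) qs sts \<and> red (concat qs) = []"
proof (induction n arbitrary: ps sts)
  case 0
  then consider "sts = []" | s t where "sts = [(s, t)]"
    by (cases sts) auto
  then show ?case
  proof cases
    case (2 s t)
    then obtain p where "ps = [p]" "reads \<delta> p s t"
      using 0 by (auto simp: list_all2_Cons2)
    then have "t = s" using 0 compat[of p "[]" s t s] by auto
    then show ?thesis using 2 by (intro exI[of _ "[[]]"]) auto
  qed auto
next
  case (Suc n)
  let ?E = "(even_refinement ^^ n) E"
  let ?r = "\<lambda>p (s, t). reads \<delta> p s t"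
  interpret C: compatible_automaton \<delta> ?E
    using word_congruence_even_pow[OF assms(1)] compat even_refinement_pow_imp
    by (intro compatible_automaton.intro compatible_automaton_axioms.intro inverse_automaton_axioms) blast+
  have ev: "even_refinement ?E (concat ps) []" using Suc.prems by simp
  then have E: "?E (concat ps) []" by (simp add: even_refinement_def)
  show ?case
  proof (cases "length sts \<le> Suc n")
    case True
    then show ?thesis using Suc.IH Suc.prems(2) E by blast
  next
    case False
    then have len: "length sts = Suc (Suc n)" using Suc.prems by simp
    then obtain d1 rest where "sts = d1 # rest" "length rest = Suc n" by (metis length_Suc_conv)
    then have "rest \<noteq> []" by auto
    then obtain ds d2 where "rest = ds @ [d2]" by (metis rev_exhaust)
    then have "sts = d1 # ds @ [d2]" using \<open>sts = d1 # rest\<close> by simp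
    then obtain s1 t1 s2 t2 where sts: "sts = (s1, t1) # ds @ [(s2, t2)]"
      by (metis surj_pair)
    then obtain p ms q where ps: "ps = p # ms @ [q]" "reads \<delta> p s1 t1" "list_all2 ?r ms ds"
      "reads \<delta> q s2 t2"
      using Suc.prems(2) by (auto simp: list_all2_Cons2 list_all2_append2)
    have cut: "C.covisits s2 t1 q \<or>
       (\<exists>ms1 v w ms2. ms = ms1 @ [v @ w] @ ms2 \<and> C.covisits s2 t1 (w @ concat ms2 @ q))"
      using C.polygon_cut[OF ps(2,4)] ev ps(1) by simp
    \<comment> \<open>Two sides cannot be split into smaller polygons. Here compatibility makes
      \<open>r\<close> itself a replacement for \<open>q\<close>, and \<open>inv_word r\<close> one
      for \<open>p\<close>.\<close>
    have two: ?thesis if q: "C.covisits s2 t1 q" and ms: "ms = []"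
    proof -
      obtain r m m' where r: "?E r q" "reads \<delta> r s2 m" "reads \<delta> r t1 m'"
        using q unfolding C.covisits_def by blast
      have m: "m = t2" using C.compat r ps(4) by blast
      have "?E (p @ q) []" using E ps(1) ms by simp
      then have "?E q (inv_word p)" using C.E.left_inv_iff[of p q "[]"] by simp
      then have "m' = s1"
        using C.compat[of r "inv_word p" t1 m' s1] r reads_inv[OF ps(2)] C.E.trans by blast
      then have "reads \<delta> (inv_word r) s1 t1" using r(3) reads_inv by blast
      moreover have "ds = []" using ps(3) ms by simp
      ultimately show ?thesis
        using r m sts by (intro exI[of _ "[inv_word r, r]"]) simp
    qed
    have many: ?thesis
      if split: "ms = ms1 @ [v @ w] @ ms2" and R: "C.covisits s2 t1 (w @ concat ms2 @ q)"
      for ms1 v w ms2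
    proof -
      obtain r m m' where r: "?E r (w @ concat ms2 @ q)" "reads \<delta> r s2 m" "reads \<delta> r t1 m'"
        using R unfolding C.covisits_def by blast
      obtain ds1 s t ds2 where ds: "ds = ds1 @ [(s, t)] @ ds2" "list_all2 ?r ms1 ds1"
        "reads \<delta> (v @ w) s t" "list_all2 ?r ms2 ds2"
        using ps(3) unfolding split by (auto simp: list_all2_append1 list_all2_Cons1)
      obtain k where k: "reads \<delta> w s k" "reads \<delta> v k t"
        using ds(3) by (auto simp: reads_append)
      have qr: "reads \<delta> (q @ inv_word r) m t2"
        using reads_inv[OF r(2)] ps(4) by (auto simp: reads_append)
      have rp: "reads \<delta> (r @ p) s1 m'"
        using r(3) ps(2) by (auto simp: reads_append)
      have "?E ((w @ concat ms2 @ q) @ inv_word r) []"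
        using C.E.app_right[OF C.E.sym[OF r(1)]] C.E.inv_right C.E.trans by blast
      moreover have "list_all2 ?r (w # ms2 @ [q @ inv_word r]) ((s, k) # ds2 @ [(m, t2)])"
        using k ds qr by (simp add: list_all2_appendI)
      moreover have "length ((s, k) # ds2 @ [(m, t2)]) \<le> Suc n"
        using len sts ds(1) by simp
      ultimately obtain qs1 where qs1: "list_all2 ?r qs1 ((s, k) # ds2 @ [(m, t2)])"
        "red (concat qs1) = []"
        using Suc.IH[of "(s, k) # ds2 @ [(m, t2)]" "w # ms2 @ [q @ inv_word r]"] by auto
      then obtain b bs c where b: "qs1 = b # bs @ [c]" "reads \<delta> b s k" "list_all2 ?r bs ds2"
        "reads \<delta> c m t2"
        by (auto simp: list_all2_Cons2 list_all2_append2)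
      have "?E ((p @ concat ms1 @ v) @ (w @ concat ms2 @ q)) []"
        using E unfolding ps(1) split by simp
      then have "?E ((p @ concat ms1 @ v) @ r) []"
        using C.E.app_left[OF r(1)] C.E.trans by blast
      then have "?E (r @ (p @ concat ms1 @ v)) []" by (rule C.E.rotate)
      moreover have "list_all2 ?r ((r @ p) # ms1 @ [v]) ((s1, m') # ds1 @ [(k, t)])"
        using k ds rp by (simp add: list_all2_appendI)
      moreover have "length ((s1, m') # ds1 @ [(k, t)]) \<le> Suc n"
        using len sts ds(1) by simp
      ultimately obtain qs2 where qs2: "list_all2 ?r qs2 ((s1, m') # ds1 @ [(k, t)])"
        "red (concat qs2) = []"
        using Suc.IH[of "(s1, m') # ds1 @ [(k, t)]" "(r @ p) # ms1 @ [v]"] by auto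
      then obtain e es f where e: "qs2 = e # es @ [f]" "reads \<delta> e s1 m'" "list_all2 ?r es ds1"
        "reads \<delta> f k t"
        by (auto simp: list_all2_Cons2 list_all2_append2)
      \<comment> \<open>The parts \<open>f\<close> and \<open>b\<close> rejoin to a replacement of
        the divided side. The diagonal survives only as a conjugation of the two trivial
        products.\<close>
      let ?qs = "(inv_word r @ e) # es @ [f @ b] @ bs @ [c @ r]"
      have "reads \<delta> (inv_word r @ e) s1 t1" "reads \<delta> (f @ b) s t" "reads \<delta> (c @ r) s2 t2"
        using reads_inv[OF r(3)] e b r(2) by (auto simp: reads_append)
      then have "list_all2 ?r ?qs sts"
        unfolding sts ds(1) using e(3) b(3) by (simp add: list_all2_appendI)
      moreover have "red (concat ?qs) = red (inv_word r @ red (concat qs2) @ red (concat qs1) @ r)"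
        unfolding b e
        by (metis (no_types, lifting) append.assoc concat.simps(1,2) concat_append append_Nil2 red_red_append)
      ultimately show ?thesis using qs1 qs2 by (intro exI[of _ ?qs]) simp
    qed
    show ?thesis
    proof (cases "C.covisits s2 t1 q")
      case q: True
      show ?thesis
      proof (cases ms rule: rev_cases)
        case Nil
        then show ?thesis using two q by blast
      next
        case (snoc ms1 m)
        \<comment> \<open>The cut is at the corner between \<open>q\<close> and the neighbouring
          side, whose part \<open>w\<close> is empty.\<close>
        then show ?thesis using many[of ms1 m "[]" "[]"] q by simp
      qed
    next
      case False
      then show ?thesis using cut many by blast
    qed
  qed
qed

section \<open>Congruences of finite index\<close>

definition congruence_class ::
    "('a letter list \<Rightarrow> 'a letter list \<Rightarrow> bool) \<Rightarrow> 'a letter list \<Rightarrow> 'a letter list set" where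
  "congruence_class E u = {v. E u v}"

definition finite_index ::
    "'a set \<Rightarrow> ('a letter list \<Rightarrow> 'a letter list \<Rightarrow> bool) \<Rightarrow> bool" where
  "finite_index A E \<longleftrightarrow> finite (congruence_class E ` lists (letters A))"

lemma (in word_congruence) congruence_class_eq_iff:
  "congruence_class E u = congruence_class E v \<longleftrightarrow> E u v"
proof
  assume "congruence_class E u = congruence_class E v"
  then have "u \<in> congruence_class E v" by (auto simp: congruence_class_def)
  then show "E u v" by (auto simp: congruence_class_def intro: sym)
next
  assume uv: "E u v"
  have "E u w \<longleftrightarrow> E v w" for w
    using trans[OF uv] trans[OF sym[OF uv]] by metis
  then show "congruence_class E u = congruence_class E v"
    by (simp add: congruence_class_def)
qed

lemma (in word_congruence) finite_indexI:
  assumes fin: "finite (\<kappa> ` lists (letters A))"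
    and \<kappa>: "\<And>u v. u \<in> lists (letters A) \<Longrightarrow> v \<in> lists (letters A) \<Longrightarrow> \<kappa> u = \<kappa> v \<Longrightarrow> E u v"
  shows "finite_index A E"
proof -
  let ?L = "lists (letters A)"
  have "congruence_class E u = congruence_class E (inv_into ?L \<kappa> (\<kappa> u))" if "u \<in> ?L" for u
  proof -
    have "inv_into ?L \<kappa> (\<kappa> u) \<in> ?L" "\<kappa> (inv_into ?L \<kappa> (\<kappa> u)) = \<kappa> u"
      using inv_into_into[of "\<kappa> u" \<kappa> ?L] f_inv_into_f[of "\<kappa> u" \<kappa> ?L] that by blast+
    then show ?thesis unfolding congruence_class_eq_iff using \<kappa> that by metis
  qed
  then have "congruence_class E ` ?L \<subseteq> (\<lambda>k. congruence_class E (inv_into ?L \<kappa> k)) ` \<kappa> ` ?L"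
    by blast
  then show ?thesis unfolding finite_index_def using fin by (meson finite_imageI finite_subset)
qed

text \<open>On words over the finite set \<open>A\<close> an edge set matters only through its trace
  \<open>\<tau> T\<close> on the finite Cayley graph, so there are finitely many parity
  conditions.\<close>

lemma (in word_congruence) finite_index_even_refinement:
  assumes A: "finite A" and fin: "finite_index A E"
  shows "finite_index A (even_refinement E)"
proof -
  let ?L = "lists (letters A)" and ?c = "congruence_class E"
  define \<tau> where "\<tau> T = {(?c h, a) |h a. h \<in> ?L \<and> a \<in> A \<and> T h a}" for T
  define \<kappa> where "\<kappa> u = (?c u, {\<tau> T |T. edge_invariant E T \<and> crosses T u []})" for u
  have mem: "(?c h, a) \<in> \<tau> T \<longleftrightarrow> T h a" if "edge_invariant E T" "h \<in> ?L" "a \<in> A" for T h a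
  proof
    assume "(?c h, a) \<in> \<tau> T"
    then obtain h' where "?c h = ?c h'" "T h' a" unfolding \<tau>_def by blast
    then show "T h a" using that(1) unfolding congruence_class_eq_iff edge_invariant_def by blast
  qed (use that \<tau>_def in blast)
  have edge: "letter_edge T x u = letter_edge T' x u"
    if "edge_invariant E T" "edge_invariant E T'" "\<tau> T = \<tau> T'" "x # u \<in> ?L" for T T' x u
  proof -
    have "fst x \<in> A" "u \<in> ?L" using that(4) by (auto simp: letters_def)
    then show ?thesis
      unfolding letter_edge_def using mem that by metis
  qed
  have cross: "crosses T u [] = crosses T' u []"
    if "edge_invariant E T" "edge_invariant E T'" "\<tau> T = \<tau> T'" "u \<in> ?L" for T T' u
    using that(4)
  proof (induction u)
    case (Cons x u)
    then show ?case using edge[OF that(1-3), of x u] by simp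
  qed simp
  interpret even: word_congruence "even_refinement E" by (rule word_congruence_even)
  show ?thesis
  proof (rule even.finite_indexI)
    have "\<kappa> ` ?L \<subseteq> ?c ` ?L \<times> Pow (Pow (?c ` ?L \<times> A))"
      unfolding \<kappa>_def \<tau>_def by blast
    moreover have "finite (?c ` ?L \<times> Pow (Pow (?c ` ?L \<times> A)))"
      using A fin unfolding finite_index_def by simp
    ultimately show "finite (\<kappa> ` ?L)" by (rule finite_subset)
    fix u v assume uv: "u \<in> ?L" "v \<in> ?L" "\<kappa> u = \<kappa> v"
    have "crosses T w []"
      if "edge_invariant E T" "crosses T w' []" "\<kappa> w' = \<kappa> w" "w \<in> ?L" for T w w'
    proof -
      have "\<tau> T \<in> snd (\<kappa> w)" using that unfolding \<kappa>_def by (metis (mono_tags, lifting) mem_Collect_eq snd_conv)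
      then obtain T' where "edge_invariant E T'" "crosses T' w []" "\<tau> T = \<tau> T'"
        unfolding \<kappa>_def by auto
      then show ?thesis using cross that by blast
    qed
    moreover have "E u v" using uv(3) unfolding \<kappa>_def by (simp add: congruence_class_eq_iff)
    ultimately show "even_refinement E u v"
      unfolding even_refinement_def using uv by metis
  qed
qed

lemma finite_index_even_pow:
  assumes "word_congruence E" "finite A" "finite_index A E"
  shows "finite_index A ((even_refinement ^^ n) E)"
  using assms
  by (induction n)
    (auto intro: word_congruence.finite_index_even_refinement word_congruence_even_pow)

section \<open>Permutation actions and the completion of partial injections\<close>

definition letter_act :: "('a \<Rightarrow> 's \<Rightarrow> 's) \<Rightarrow> 'a letter \<Rightarrow> 's \<Rightarrow> 's" where
  "letter_act \<pi> x = (if snd x then \<pi> (fst x) else inv' (\<pi> (fst x)))"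

lemma letter_act_inv:
  "bij (\<pi> (fst x)) \<Longrightarrow> letter_act \<pi> x (letter_act \<pi> (letter_inv x) y) = y"
  by (auto simp: letter_act_def letter_inv_def bij_is_inj bij_is_surj surj_f_inv_f)

lemma word_congruence_action:
  assumes "\<And>a. bij (\<pi> a)"
  shows "word_congruence (\<lambda>u v. \<forall>y. foldr (letter_act \<pi>) u y = foldr (letter_act \<pi>) v y)"
  by standard (auto simp: letter_act_inv assms)

text \<open>Domain and image have equally large complements in \<open>V\<close>, and any bijection
  between these completes the map. This is the completion step in Marshall Hall's theorem.\<close>

lemma extend_partial_injection:
  assumes "finite V" "inj_on f D" "D \<subseteq> V" "f ` D \<subseteq> V"
  shows "\<exists>\<pi>. \<pi> permutes V \<and> (\<forall>s\<in>D. \<pi> s = f s)"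
proof -
  have "finite D" using assms finite_subset by blast
  then have "card (V - D) = card (V - f ` D)"
    using assms by (simp add: card_Diff_subset card_image)
  then obtain g where g: "bij_betw g (V - D) (V - f ` D)"
    using assms(1) finite_same_card_bij[of "V - D" "V - f ` D"] by auto
  define \<pi> where "\<pi> s = (if s \<in> D then f s else if s \<in> V then g s else s)" for s
  have "bij_betw \<pi> D (f ` D)"
    using assms(2) by (intro bij_betw_imageI) (auto simp: \<pi>_def inj_on_def)
  moreover have "bij_betw \<pi> (V - D) (V - f ` D)"
    using g by (rule bij_betw_cong[THEN iffD2, rotated]) (auto simp: \<pi>_def)
  ultimately have "bij_betw \<pi> (D \<union> (V - D)) (f ` D \<union> (V - f ` D))"
    by (rule bij_betw_combine) blast
  moreover have "D \<union> (V - D) = V" "f ` D \<union> (V - f ` D) = V" using assms by blast+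
  ultimately have "\<pi> permutes V"
    using assms(3) by (intro bij_imp_permutes) (auto simp: \<pi>_def)
  then show ?thesis by (intro exI[of _ \<pi>]) (auto simp: \<pi>_def)
qed

context inverse_automaton
begin

text \<open>Completing each letter to a permutation of \<open>V\<close> embeds the automaton into a
  finite action, whose kernel determines end states.\<close>

lemma compatible_congruence:
  assumes V: "finite V" "\<And>x s t. \<delta> x s t \<Longrightarrow> s \<in> V \<and> t \<in> V"
  shows "\<exists>E. word_congruence E \<and> finite_index A E \<and>
           (\<forall>u v s t t'. E u v \<longrightarrow> reads \<delta> u s t \<longrightarrow> reads \<delta> v s t' \<longrightarrow> t = t')"
proof -
  have "\<exists>\<pi>. \<pi> permutes V \<and> (\<forall>s t. \<delta> (a, True) s t \<longrightarrow> \<pi> s = t)" for a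
  proof -
    let ?D = "{s. \<exists>t. \<delta> (a, True) s t}"
    define f where "f s = (THE t. \<delta> (a, True) s t)" for s
    have f: "f s = t" if "\<delta> (a, True) s t" for s t
      unfolding f_def using that det by blast
    have "inj_on f ?D"
    proof (rule inj_onI)
      fix s s' assume "s \<in> ?D" "s' \<in> ?D" "f s = f s'"
      then obtain t where "\<delta> (a, True) s t" "\<delta> (a, True) s' t" using f by auto
      then show "s = s'" using sym det by blast
    qed
    moreover have "?D \<subseteq> V" "f ` ?D \<subseteq> V" using V(2) f by auto
    ultimately obtain \<pi> where "\<pi> permutes V" "\<forall>s\<in>?D. \<pi> s = f s"
      using extend_partial_injection[OF V(1)] by blast
    then show ?thesis using f by blast
  qed
  then have "\<forall>a. \<exists>\<pi>. \<pi> permutes V \<and> (\<forall>s t. \<delta> (a, True) s t \<longrightarrow> \<pi> s = t)" ..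
  from choice[OF this] obtain \<pi>
    where "\<forall>a. \<pi> a permutes V \<and> (\<forall>s t. \<delta> (a, True) s t \<longrightarrow> \<pi> a s = t)" ..
  then have \<pi>: "\<And>a. \<pi> a permutes V" "\<And>a s t. \<delta> (a, True) s t \<Longrightarrow> \<pi> a s = t"
    by blast+
  have act: "letter_act \<pi> x s = t" if "\<delta> x s t" for x s t
  proof (cases "snd x")
    case True
    then have "(fst x, True) = x" by (simp add: prod_eq_iff)
    then show ?thesis using True \<pi>(2)[of "fst x" s t] that by (simp add: letter_act_def)
  next
    case False
    then have "\<delta> (fst x, True) t s" using sym[OF that] by (simp add: letter_inv_def)
    then have "s = \<pi> (fst x) t \<Longrightarrow> ?thesis"
      using False permutes_inverses(2)[OF \<pi>(1)] by (simp add: letter_act_def)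
    then show ?thesis using \<pi>(2) \<open>\<delta> (fst x, True) t s\<close> by blast
  qed
  have word: "foldr (letter_act \<pi>) u s = t" if "reads \<delta> u s t" for u s t
    using that by (induction u arbitrary: t) (auto simp: act)
  let ?E = "\<lambda>u v. \<forall>y. foldr (letter_act \<pi>) u y = foldr (letter_act \<pi>) v y"
  have "word_congruence ?E" using \<pi>(1) permutes_bij by (intro word_congruence_action) blast
  moreover have "finite_index A ?E"
  proof (rule word_congruence.finite_indexI[OF calculation])
    have "letter_act \<pi> x permutes V" for x
      using \<pi>(1) permutes_inv by (auto simp: letter_act_def)
    then have "foldr (letter_act \<pi>) u permutes V" for u
      by (induction u) (simp_all only: foldr.simps permutes_id permutes_compose)
    then have "range (foldr (letter_act \<pi>)) \<subseteq> {p. p permutes V}" by blast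
    then show "finite (foldr (letter_act \<pi>) ` lists (letters A))"
      using finite_permutations[OF V(1)] by (meson finite_subset image_mono subset_UNIV)
  qed simp
  moreover have "\<forall>u v s t t'. ?E u v \<longrightarrow> reads \<delta> u s t \<longrightarrow> reads \<delta> v s t' \<longrightarrow> t = t'"
    using word by metis
  ultimately show ?thesis by blast
qed

lemma separating_congruence:
  assumes "finite V" "\<And>x s t. \<delta> x s t \<Longrightarrow> s \<in> V \<and> t \<in> V" "finite A"
  shows "\<exists>E. word_congruence E \<and> finite_index A E \<and>
           (\<forall>ps sts. length sts \<le> n \<longrightarrow> list_all2 (\<lambda>p (s, t). reads \<delta> p s t) ps sts \<longrightarrow>
              E (concat ps) [] \<longrightarrow>
              (\<exists>qs. list_all2 (\<lambda>q (s, t). reads \<delta> q s t) qs sts \<and> red (concat qs) = []))"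
proof -
  obtain E where E: "word_congruence E" "finite_index A E"
    "\<And>u v s t t'. E u v \<Longrightarrow> reads \<delta> u s t \<Longrightarrow> reads \<delta> v s t' \<Longrightarrow> t = t'"
    using compatible_congruence[where V = V and A = A] assms(1,2) by metis
  have "\<exists>qs. list_all2 (\<lambda>q (s, t). reads \<delta> q s t) qs sts \<and> red (concat qs) = []"
    if "length sts \<le> n" "list_all2 (\<lambda>p (s, t). reads \<delta> p s t) ps sts"
      "(even_refinement ^^ n) E (concat ps) []" for ps sts
    using polygon[OF E(1,3) le_SucI[OF that(1)] that(2,3)] .
  then show ?thesis
    using word_congruence_even_pow[OF E(1)] finite_index_even_pow[OF E(1) assms(3) E(2)] by blast
qed

end

section \<open>Coset automata\<close>

text \<open>An induced piece of a Schreier graph. States are arbitrary sets of words, so left cosets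
  of different subgroups, and singletons as cosets of the trivial one, live in one
  automaton.\<close>

definition coset_step ::
    "'a letter list set set \<Rightarrow> 'a letter \<Rightarrow> 'a letter list set \<Rightarrow> 'a letter list set \<Rightarrow> bool" where
  "coset_step V x C D \<longleftrightarrow> C \<in> V \<and> D \<in> V \<and> D = push_letter x ` C"

definition translate :: "'a letter list \<Rightarrow> 'a letter list set \<Rightarrow> 'a letter list set" where
  "translate u C = foldr push_letter u ` C"

lemma translate_Nil [simp]: "translate [] C = C"
  by (simp add: translate_def)

lemma translate_append: "translate (u @ v) C = translate u (translate v C)"
  by (simp add: translate_def image_image)

lemma translate_Cons: "translate (x # u) C = push_letter x ` translate u C"
  by (simp add: translate_def image_image)

lemma translate_red:
  assumes "C \<subseteq> Collect reduced_word" shows "translate (red u) C = translate u C"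
  unfolding translate_def
proof (rule image_cong)
  fix w assume "w \<in> C"
  then have "red w = w" using assms red_reduced by blast
  then show "foldr push_letter (red u) w = foldr push_letter u w"
    by (metis foldr_push_red red_red_append(1))
qed simp

lemma translate_reduced: "C \<subseteq> Collect reduced_word \<Longrightarrow> translate u C \<subseteq> Collect reduced_word"
  by (auto simp: translate_def reduced_foldr_push)

lemma inverse_automaton_coset_step:
  assumes "\<Union>V \<subseteq> Collect reduced_word"
  shows "inverse_automaton (coset_step V)"
proof
  fix x C D Z
  show "D = Z" if "coset_step V x C D" "coset_step V x C Z"
    using that by (simp add: coset_step_def)
  show "coset_step V (letter_inv x) D C" if "coset_step V x C D"
  proof -
    have "C \<subseteq> Collect reduced_word" using that assms by (auto simp: coset_step_def)
    then have "(\<lambda>w. push_letter (letter_inv x) (push_letter x w)) ` C = id ` C"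
      using push_push[of _ "letter_inv x"] by (intro image_cong) auto
    then have "push_letter (letter_inv x) ` push_letter x ` C = C" by (simp add: image_image)
    then show ?thesis using that unfolding coset_step_def by metis
  qed
qed

lemma reads_coset_step_imp:
  "reads (coset_step V) u C D \<Longrightarrow> D = translate u C \<and> (C = D \<or> C \<in> V \<and> D \<in> V)"
proof (induction u arbitrary: D)
  case (Cons x u)
  then obtain m where "reads (coset_step V) u C m" "coset_step V x m D" by auto
  with Cons.IH[of m] show ?case unfolding translate_Cons coset_step_def by metis
qed simp

lemma reads_coset_step:
  "(\<And>v w. u = v @ w \<Longrightarrow> translate w C \<in> V) \<Longrightarrow> reads (coset_step V) u C (translate u C)"
proof (induction u)
  case (Cons x u)
  have "reads (coset_step V) u C (translate u C)"
    using Cons.prems[of "x # v" w for v w] by (intro Cons.IH) simp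
  moreover have "translate u C \<in> V" "translate (x # u) C \<in> V"
    using Cons.prems[of "[x]" u] Cons.prems[of "[]" "x # u"] by simp_all
  then have "coset_step V x (translate u C) (translate (x # u) C)"
    by (simp add: coset_step_def translate_Cons)
  ultimately show ?case by auto
qed simp

lemma reads_coset_step_mono:
  "V \<subseteq> W \<Longrightarrow> reads (coset_step V) u C D \<Longrightarrow> reads (coset_step W) u C D"
proof (induction u arbitrary: D)
  case (Cons x u)
  then obtain m where "reads (coset_step V) u C m" "coset_step V x m D" by auto
  then have "reads (coset_step W) u C m" "coset_step W x m D"
    using Cons.IH[of m] Cons.prems(1) unfolding coset_step_def by blast+
  then show ?case by auto
qed simp

lemma translate_eq_l_coset:
  "translate u H = u <#\<^bsub>free_group A\<^esub> H"
  by (auto simp: translate_def l_coset_def free_group_simps)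

lemma reduced_append:
  "reduced_word (u @ v) \<longleftrightarrow>
     reduced_word u \<and> reduced_word v \<and> (u = [] \<or> v = [] \<or> hd v \<noteq> letter_inv (last u))"
  by (auto simp: reduced_word_def successively_append_iff)

lemma reduced_replicate: "reduced_word (replicate k c)"
  by (induction k) (auto simp: reduced_Cons)

text \<open>A finitely generated subgroup consists of the labels of loops in a finite part of its
  Schreier graph.\<close>

lemma finitely_generated_imp_coset_automaton:
  assumes "finitely_generated_subgroup (free_group A) H"
  shows "\<exists>V. finite V \<and> H \<in> V \<and> V \<subseteq> (\<lambda>u. translate u H) ` lists (letters A) \<and>
           (\<forall>h\<in>H. reads (coset_step V) h H H)"
proof -
  let ?F = "free_group A"
  interpret group ?F by (rule group_free_group)
  obtain S where S: "finite S" "S \<subseteq> carrier ?F" "H = generate ?F S"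
    using assms unfolding finitely_generated_subgroup_def by blast
  have H: "subgroup H ?F" using S generate_is_subgroup by simp
  then have Hred: "H \<subseteq> Collect reduced_word"
    using subgroup.subset by (fastforce simp: carrier_free_group)
  define P where "P = (\<Union>g\<in>S. {w. \<exists>v. g = v @ w})"
  have "finite {w. \<exists>v. g = v @ w}" for g :: "'a letter list"
  proof (rule finite_subset)
    show "{w. \<exists>v. g = v @ w} \<subseteq> (\<lambda>n. drop n g) ` {..length g}"
    proof clarify
      fix v w
      have "w = drop (length v) (v @ w)" by simp
      then show "w \<in> (\<lambda>n. drop n (v @ w)) ` {..length (v @ w)}" by (rule image_eqI) simp
    qed
  qed simp
  \<comment> \<open>Words are consumed from the right, so the cosets met while reading a generator
    are the translates by its suffixes, collected in \<open>P\<close>.\<close>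
  then have P: "finite P" unfolding P_def using S(1) by blast
  define V where "V = insert H ((\<lambda>u. translate u H) ` P)"
  have stable: "translate h H = H" if "h \<in> H" for h
    unfolding translate_eq_l_coset[of h H A] using H that coset_join3 subgroup.mem_carrier by metis
  have "\<Union>V \<subseteq> Collect reduced_word"
    unfolding V_def using Hred translate_reduced by blast
  then interpret inverse_automaton "coset_step V" by (rule inverse_automaton_coset_step)
  have gen: "reads (coset_step V) g H H" if "g \<in> S" for g
  proof -
    have "reads (coset_step V) g H (translate g H)"
      using that by (intro reads_coset_step) (auto simp: V_def P_def)
    then show ?thesis using stable[of g] that S generate.incl by metis
  qed
  have "reads (coset_step V) h H H" if "h \<in> generate ?F S" for h
    using that
  proof induction
    case (inv g)
    then have "reads (coset_step V) (inv_word g) H H" using gen reads_inv by blast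
    moreover have "inv\<^bsub>?F\<^esub> g = red (inv_word g)" using inv S(2) by (intro inv_free_group) blast
    ultimately show ?case using reads_red by simp
  next
    case (eng g h)
    have "reduced_word h" using eng(2) Hred S(3) by blast
    then have "g \<otimes>\<^bsub>?F\<^esub> h = red (g @ h)" by (rule mult_free_group)
    moreover have "reads (coset_step V) (g @ h) H H" using eng.IH reads_append by blast
    ultimately show ?case using reads_red by simp
  qed (use gen in \<open>simp_all add: free_group_simps\<close>)
  moreover have "P \<subseteq> lists (letters A)"
    using S(2) by (fastforce simp: P_def carrier_free_group)
  then have "V \<subseteq> (\<lambda>u. translate u H) ` lists (letters A)"
    unfolding V_def by (auto intro: image_eqI[of _ _ "[]"])
  ultimately show ?thesis using P S(3) by (intro exI[of _ V]) (auto simp: V_def)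
qed

section \<open>Elements that avoid products of subgroups of infinite index\<close>

definition readable :: "'a letter list set set \<Rightarrow> 'a letter list \<Rightarrow> bool" where
  "readable V u \<longleftrightarrow> (\<exists>C\<in>V. \<exists>D. reads (coset_step V) u C D)"

text \<open>The form in which infinite index is used: every state can be led out of
  \<open>V\<close>.\<close>

definition escapable :: "'a set \<Rightarrow> 'a letter list set set \<Rightarrow> bool" where
  "escapable A V \<longleftrightarrow> (\<forall>C\<in>V. \<exists>u\<in>lists (letters A). translate u C \<notin> V)"

text \<open>Once a letter of \<open>u\<close> survives, the reducedness of \<open>u\<close> protects
  all letters before it, so cancellation stays at the junction.\<close>

lemma red_append_overlap:
  assumes "reduced_word u" "reduced_word v"
  shows "\<exists>u1 m n v2. u = u1 @ m \<and> v = n @ v2 \<and> red (u @ v) = u1 @ v2"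
  using assms(1)
proof (induction u)
  case Nil
  then show ?case using assms(2) red_reduced[OF assms(2)]
    by (intro exI[of _ "[]"] exI[of _ v]) simp
next
  case (Cons x u)
  then obtain u1 m n v2 where uv: "u = u1 @ m" "v = n @ v2" "red (u @ v) = u1 @ v2"
    by (auto simp: reduced_Cons)
  have red: "red ((x # u) @ v) = push_letter x (u1 @ v2)"
    using uv(3) by (simp add: red_def)
  consider "push_letter x (u1 @ v2) = (x # u1) @ v2"
    | y where "u1 @ v2 = y # push_letter x (u1 @ v2)" "y = letter_inv x"
  proof (cases "\<exists>ys. u1 @ v2 = letter_inv x # ys")
    case True
    then obtain ys where ys: "u1 @ v2 = letter_inv x # ys" by blast
    then have "push_letter x (u1 @ v2) = ys" by (simp add: push_letter_def)
    then show ?thesis using that(2)[of "letter_inv x"] ys by simp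
  next
    case False
    then have "push_letter x (u1 @ v2) = x # u1 @ v2"
      by (cases "u1 @ v2") (simp_all add: push_letter_def)
    then show ?thesis using that(1) by simp
  qed
  then show ?case
  proof cases
    case 1
    then show ?thesis using uv red by (metis append_Cons)
  next
    case (2 y)
    have "u1 = []"
    proof (rule ccontr)
      assume "u1 \<noteq> []"
      then obtain z zs where "u1 = z # zs" by (cases u1) auto
      then have "hd u = letter_inv x" "u \<noteq> []" using 2 uv(1) by auto
      then show False using Cons.prems by (simp add: reduced_Cons)
    qed
    then have "v = (n @ [y]) @ push_letter x (u1 @ v2)" using 2(1) uv(2) by simp
    then have "x # u = [] @ (x # u) \<and> v = (n @ [y]) @ push_letter x (u1 @ v2) \<and>
        red ((x # u) @ v) = [] @ push_letter x (u1 @ v2)"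
      using red by (metis append_Nil)
    then show ?thesis by blast
  qed
qed

locale coset_automaton =
  fixes V :: "'a letter list set set" and A :: "'a set"
  assumes finite_V: "finite V" and V_reduced: "\<Union>V \<subseteq> Collect reduced_word"
    and V_escapable: "escapable A V"
begin

sublocale inverse_automaton "coset_step V"
  using V_reduced by (rule inverse_automaton_coset_step)

lemma readable_Nil: "V \<noteq> {} \<Longrightarrow> readable V []"
  unfolding readable_def by auto

lemma readable_append: "readable V (u @ v) \<Longrightarrow> readable V u \<and> readable V v"
proof -
  assume "readable V (u @ v)"
  then obtain C D E where C: "C \<in> V" "reads (coset_step V) v C D" "reads (coset_step V) u D E"
    unfolding readable_def reads_append by blast
  then have "D \<in> V" using reads_coset_step_imp by metis
  then show ?thesis unfolding readable_def using C by blast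
qed

lemma readable_red: "readable V u \<Longrightarrow> readable V (red u)"
  unfolding readable_def using reads_red by blast

text \<open>An escape word may cancel against \<open>v\<close>. Then powers of another generator
  \<open>c\<close> serve as a buffer: either one of them is already unreadable from
  \<open>C\<close>, or by finiteness some power is a loop at \<open>C\<close> and can be read before
  the escape word.\<close>

lemma unreadable_extension:
  assumes A: "card A \<ge> 2" and v: "reduced_word v" and C: "C \<in> V"
  shows "\<exists>u\<in>lists (letters A). reduced_word (u @ v) \<and> (\<forall>D. \<not> reads (coset_step V) u C D)"
proof -
  obtain p where p: "p \<in> lists (letters A)" "translate p C \<notin> V"
    using V_escapable C unfolding escapable_def by blast
  have "C \<subseteq> Collect reduced_word" using C V_reduced by blast
  then have "translate (red p) C \<notin> V" using p(2) translate_red by metis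
  then have no: "\<not> reads (coset_step V) (red p) C D" for D
    using reads_coset_step_imp C by metis
  have ne: "red p \<noteq> []" using no[of C] by auto
  have pA: "red p \<in> lists (letters A)" using p(1) by (rule red_in_lists)
  show ?thesis
  proof (cases "v = [] \<or> hd v \<noteq> letter_inv (last (red p))")
    case True
    then have "reduced_word (red p @ v)" using v by (auto simp: reduced_append)
    then show ?thesis using pA no by blast
  next
    case False
    obtain c where c: "c \<in> A" "c \<noteq> fst (hd v)"
    proof -
      have "A \<noteq> {fst (hd v)}" "A \<noteq> {}" using A by auto
      then show ?thesis using that by blast
    qed
    let ?c = "(c, True)"
    have red_c: "reduced_word (replicate k ?c @ v)" for k
    proof -
      have "hd v \<noteq> letter_inv ?c" using c(2) by (auto simp: letter_inv_def)
      then show ?thesis using v reduced_replicate[of k ?c] by (auto simp: reduced_append)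
    qed
    have cA: "replicate k ?c \<in> lists (letters A)" for k
      using c(1) by (auto simp: letters_def)
    show ?thesis
    proof (cases "\<forall>k. \<exists>D. reads (coset_step V) (replicate k ?c) C D")
      case True
      then obtain D where D: "\<And>k. reads (coset_step V) (replicate k ?c) C (D k)" by metis
      have "D k \<in> V" for k using D[of k] C reads_coset_step_imp by metis
      then have "\<not> inj_on D UNIV" using finite_V by (metis finite_imageD finite_subset image_subsetI infinite_UNIV_nat)
      then obtain i j where ij: "D i = D j" "i < j"
        unfolding inj_on_def by (metis linorder_neqE_nat)
      have "reads (coset_step V) (replicate i ?c @ replicate (j - i) ?c) C (D i)"
        using D[of j] ij by (simp flip: replicate_add)
      then obtain m where m: "reads (coset_step V) (replicate (j - i) ?c) C m"
        "reads (coset_step V) (replicate i ?c) m (D i)"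
        unfolding reads_append by blast
      have "m = C"
        using reads_inv[OF m(2)] reads_inv[OF D[of i]] reads_det by blast
      then have loop: "reads (coset_step V) (replicate (j - i) ?c) C C" using m by simp
      let ?u = "red p @ replicate (j - i) ?c"
      have "last (red p) = letter_inv (hd v)" using False by simp
      then have "?c \<noteq> letter_inv (last (red p))" using c(2) by (metis fst_conv letter_inv_letter_inv)
      then have "reduced_word (red p @ (replicate (j - i) ?c @ v))"
        using red_c[of "j - i"] ij(2) by (subst reduced_append) (auto simp: hd_append)
      moreover have "\<not> reads (coset_step V) ?u C D" for D
        using no loop reads_det unfolding reads_append by blast
      moreover have "?u \<in> lists (letters A)" using pA cA by (metis append_in_lists_conv)
      ultimately show ?thesis by (metis append_assoc)
    next
      case False
      then show ?thesis using red_c cA by blast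
    qed
  qed
qed

text \<open>The start states that still read the word are eliminated one after another, as in the
  construction of a synchronizing word.\<close>

lemma killing_extension:
  assumes A: "card A \<ge> 2"
  shows "reduced_word (w @ v) \<Longrightarrow> w \<in> lists (letters A) \<Longrightarrow>
    \<exists>u\<in>lists (letters A). reduced_word (u @ v) \<and> \<not> readable V u"
proof (induction "card {C\<in>V. \<exists>D. reads (coset_step V) w C D}" arbitrary: w rule: less_induct)
  case less
  let ?S = "\<lambda>w. {C\<in>V. \<exists>D. reads (coset_step V) w C D}"
  show ?case
  proof (cases "?S w = {}")
    case True
    then show ?thesis using less.prems unfolding readable_def by blast
  next
    case False
    then obtain C D where C: "C \<in> V" "reads (coset_step V) w C D" by blast
    then have "D \<in> V" using reads_coset_step_imp by metis
    then obtain u where u: "u \<in> lists (letters A)" "reduced_word (u @ w @ v)"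
      "\<forall>E. \<not> reads (coset_step V) u D E"
      using unreadable_extension[OF A less.prems(1)] by blast
    have "C \<notin> ?S (u @ w)"
      using u(3) C(2) reads_det unfolding reads_append by blast
    moreover have "?S (u @ w) \<subseteq> ?S w" unfolding reads_append by blast
    ultimately have "?S (u @ w) \<subset> ?S w" using C by blast
    then have "card (?S (u @ w)) < card (?S w)"
      using finite_V by (intro psubset_card_mono) auto
    then show ?thesis
      using less.hyps[of "u @ w"] u(1,2) less.prems(2) by (simp del: in_lists_conv_set)
  qed
qed

lemma unreadable_sequence:
  assumes "card A \<ge> 2"
  shows "\<exists>zs. length zs = k \<and> (\<forall>z\<in>set zs. \<not> readable V z) \<and> concat zs \<in> lists (letters A) \<and>
           reduced_word (concat zs)"
proof (induction k)
  case (Suc k)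
  then obtain zs where zs: "length zs = k" "\<forall>z\<in>set zs. \<not> readable V z"
    "concat zs \<in> lists (letters A)" "reduced_word (concat zs)" by blast
  obtain u where u: "u \<in> lists (letters A)" "reduced_word (u @ concat zs)" "\<not> readable V u"
    using killing_extension[OF assms, of "[]" "concat zs"] zs(4) by auto
  have "length (u # zs) = Suc k" "\<forall>z\<in>set (u # zs). \<not> readable V z"
    "concat (u # zs) \<in> lists (letters A)" "reduced_word (concat (u # zs))"
    using zs u by (simp_all del: in_lists_conv_set)
  then show ?case by blast
qed simp

text \<open>A readable factor contains no unreadable block, so each block straddles a factor
  boundary of its own; there are fewer boundaries than blocks.\<close>

lemma concat_unreadable_neq:
  assumes "\<forall>c\<in>set cs. readable V c" "\<forall>z\<in>set zs. \<not> readable V z" "length cs < length zs"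
    and "V \<noteq> {}"
  shows "concat cs \<noteq> w @ concat zs"
  using assms(1-3)
proof (induction cs arbitrary: w zs)
  case Nil
  then obtain z zs' where zs: "zs = z # zs'" by (cases zs) auto
  then have "z \<noteq> []" using Nil readable_Nil[OF assms(4)] by auto
  then show ?case using zs by simp
next
  case (Cons c cs)
  show ?case
  proof
    assume eq: "concat (c # cs) = w @ concat zs"
    obtain z zs' where zs: "zs = z # zs'" using Cons.prems by (cases zs) auto
    have IH: "concat cs \<noteq> w' @ concat zs" "concat cs \<noteq> w' @ concat zs'" for w'
      using Cons.IH[of zs w'] Cons.IH[of zs' w'] Cons.prems zs by auto
    from eq consider c' where "c = w @ c'" "c' @ concat cs = z @ concat zs'"
      | w' where "concat cs = w' @ concat zs"
      using zs by (auto simp: append_eq_append_conv2)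
    then show False
    proof cases
      case (1 c')
      from 1(2) consider r where "c' = z @ r" | r where "concat cs = r @ concat zs'"
        by (auto simp: append_eq_append_conv2)
      then show False
      proof cases
        case (1 r)
        then show False
          using \<open>c = w @ c'\<close> Cons.prems zs readable_append[of w "z @ r"] readable_append[of z r] by simp
      qed (use IH in blast)
    qed (use IH in blast)
  qed
qed

text \<open>Cancellation only truncates factors, and parts of readable words are readable. Exhausted
  factors remain as empty words, which keeps the count.\<close>

lemma red_concat_readable:
  assumes "\<forall>g\<in>set gs. readable V g" and ne: "V \<noteq> {}"
  shows "\<exists>cs. length cs = length gs \<and> (\<forall>c\<in>set cs. readable V c) \<and> red (concat gs) = concat cs"
  using assms(1)
proof (induction gs)
  case (Cons g gs)
  then obtain cs where cs: "length cs = length gs" "\<forall>c\<in>set cs. readable V c"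
    "red (concat gs) = concat cs" by auto
  obtain u1 m n v2 where o: "red g = u1 @ m" "red (concat gs) = n @ v2"
    "red (red g @ red (concat gs)) = u1 @ v2"
    using red_append_overlap[OF reduced_red reduced_red, of g "concat gs"] by blast
  have u1: "readable V u1" using readable_red[of g] Cons.prems o(1) readable_append[of u1 m] by simp
  obtain ds where ds: "length ds = length cs" "\<forall>d\<in>set ds. readable V d" "v2 = concat ds"
  proof (cases "cs = []")
    case True
    then show ?thesis using that[of "[]"] o(2) cs(3) by simp
  next
    case False
    then obtain cs1 c c' cs2 where c: "cs = cs1 @ (c @ c') # cs2" "v2 = c' @ concat cs2"
      using concat_eq_appendD[of cs n v2] o(2) cs(3) by auto
    show ?thesis
    proof (rule that)
      show "length (replicate (length cs1) [] @ c' # cs2) = length cs" using c by simp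
      show "\<forall>d\<in>set (replicate (length cs1) [] @ c' # cs2). readable V d"
        using c cs(2) readable_append[of c c'] readable_Nil[OF ne] by auto
      show "v2 = concat (replicate (length cs1) [] @ c' # cs2)" using c by simp
    qed
  qed
  have "red (concat (g # gs)) = concat (u1 # ds)" using o(3) ds(3) by simp
  then show ?case using u1 ds cs(1) by (intro exI[of _ "u1 # ds"]) auto
qed simp

theorem avoiding_element:
  assumes "card A \<ge> 2" "V \<noteq> {}"
  shows "\<exists>x\<in>carrier (free_group A). m < length x \<and>
    (\<forall>gs. length gs \<le> n \<longrightarrow> (\<forall>g\<in>set gs. readable V g) \<longrightarrow> red (concat gs) \<noteq> x)"
proof -
  \<comment> \<open>More than \<open>n\<close> blocks defeat \<open>n\<close> factors; being
    nonempty, more than \<open>m\<close> blocks also give a word longer than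
    \<open>m\<close>.\<close>
  obtain zs where zs: "length zs = Suc (m + n)" "\<forall>z\<in>set zs. \<not> readable V z"
    "concat zs \<in> lists (letters A)" "reduced_word (concat zs)"
    using unreadable_sequence[OF assms(1)] by blast
  have "length zs \<le> length (concat zs)"
  proof -
    have "\<forall>z\<in>set zs. 1 \<le> length z"
      using zs(2) readable_Nil[OF assms(2)] by (metis One_nat_def Suc_leI length_greater_0_conv)
    then have "length zs \<le> sum_list (map length zs)" by (induction zs) auto
    then show ?thesis by (simp add: length_concat)
  qed
  moreover have "red (concat gs) \<noteq> concat zs"
    if "length gs \<le> n" "\<forall>g\<in>set gs. readable V g" for gs
    using red_concat_readable[OF that(2) assms(2)] concat_unreadable_neq[of _ zs "[]"] that(1) zs assms(2)
    by fastforce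
  ultimately show ?thesis
    using zs by (intro bexI[of _ "concat zs"]) (auto simp: carrier_free_group simp del: in_lists_conv_set)
qed

end

section \<open>Generating alternating groups\<close>

abbreviation cyc3 :: "'s \<Rightarrow> 's \<Rightarrow> 's \<Rightarrow> 's \<Rightarrow> 's" where
  "cyc3 x y z \<equiv> cycle_of_list [x, y, z]"

lemma cyc3_rotate: "distinct [x, y, z] \<Longrightarrow> cyc3 y z x = cyc3 x y z"
  by (auto simp: fun_eq_iff Transposition.transpose_def)

lemma cyc3_inverse: "distinct [x, y, z] \<Longrightarrow> inv' (cyc3 x y z) = cyc3 z y x"
  by (rule inv_unique_comp) (auto simp: fun_eq_iff Transposition.transpose_def)

text \<open>The supports meet at most in \<open>x\<close>, so \<open>f \<circ> g\<close> and
  \<open>g \<circ> f\<close> differ only at few points; they are compared pointwise before any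
  inverse is taken.\<close>

lemma commutator_cyc3:
  assumes "bij f" "bij g" "\<And>z. z \<notin> P \<Longrightarrow> f z = z" "\<And>z. z \<notin> Q \<Longrightarrow> g z = z"
    and PQ: "P \<inter> Q \<subseteq> {x}" and x: "f x \<noteq> x" "g x \<noteq> x"
  shows "f \<circ> g \<circ> inv' f \<circ> inv' g = cyc3 x (f x) (g x)"
proof -
  have [simp]: "f u = f v \<longleftrightarrow> u = v" "g u = g v \<longleftrightarrow> u = v" for u v
    using assms(1,2) by (auto dest: bij_is_inj injD)
  have P: "f z \<in> P" if "f z \<noteq> z" for z using assms(3)[of "f z"] that by auto
  have Q: "g z \<in> Q" if "g z \<noteq> z" for z using assms(4)[of "g z"] that by auto
  have fx: "g (f x) = f x" using P[OF x(1)] PQ x assms(4) by blast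
  have gx: "f (g x) = g x" using Q[OF x(2)] PQ x assms(3) by blast
  have dist: "f x \<noteq> g x" using P[OF x(1)] Q[OF x(2)] PQ x by auto
  have "(f \<circ> g) y = (cyc3 x (f x) (g x) \<circ> (g \<circ> f)) y" for y
  proof (cases "f y = y")
    case True
    then have "y \<noteq> x" using x by auto
    show ?thesis
    proof (cases "g y = y")
      case True
      then show ?thesis using \<open>f y = y\<close> \<open>y \<noteq> x\<close> fx gx x by (auto simp: Transposition.transpose_def)
    next
      case g: False
      then have "y \<in> Q" "g y \<in> Q" using assms(4) Q by auto
      have "f (g y) = g y \<or> g y = x" using \<open>g y \<in> Q\<close> PQ assms(3) by blast
      then show ?thesis
        using \<open>f y = y\<close> \<open>y \<noteq> x\<close> fx gx x dist g by (auto simp: Transposition.transpose_def)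
    qed
  next
    case False
    then have "y \<in> P" "f y \<in> P" using assms(3) P by auto
    then have "g y = y \<or> y = x" "g (f y) = f y \<or> f y = x" using PQ assms(4) by blast+
    then show ?thesis using False fx gx x dist by (auto simp: Transposition.transpose_def)
  qed
  then have "f \<circ> g = cyc3 x (f x) (g x) \<circ> (g \<circ> f)" by blast
  then have "f \<circ> g \<circ> inv' f \<circ> inv' g = cyc3 x (f x) (g x) \<circ> (g \<circ> (f \<circ> inv' f) \<circ> inv' g)"
    by (simp add: o_assoc)
  also have "f \<circ> inv' f = id" using assms(1) by (meson bij_is_surj surj_iff)
  also have "g \<circ> id \<circ> inv' g = id" using assms(2) by (metis comp_id bij_is_surj surj_iff)
  finally show ?thesis by (simp only: comp_id)
qed

locale permutation_group =
  fixes G :: "('s \<Rightarrow> 's) set" and S :: "'s set"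
  assumes permutes: "g \<in> G \<Longrightarrow> g permutes S"
    and id_in: "id \<in> G"
    and comp_in: "g \<in> G \<Longrightarrow> h \<in> G \<Longrightarrow> g \<circ> h \<in> G"
    and inv_in: "g \<in> G \<Longrightarrow> inv' g \<in> G"
begin

text \<open>Jordan's argument: lying on a common 3-cycle of \<open>G\<close> is an equivalence
  relation that \<open>G\<close> preserves.\<close>

definition linked :: "'s \<Rightarrow> 's \<Rightarrow> bool" where
  "linked y z \<longleftrightarrow> y = z \<or> (\<exists>w. distinct [y, z, w] \<and> cyc3 y z w \<in> G)"

lemma conj_cyc3:
  assumes "g \<in> G" "distinct [x, y, z]" "cyc3 x y z \<in> G"
  shows "cyc3 (g x) (g y) (g z) \<in> G" "distinct [g x, g y, g z]"
proof -
  have g: "bij g" using permutes[OF assms(1)] by (rule permutes_bij)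
  have "g \<circ> cyc3 x y z \<circ> inv' g = cyc3 (g x) (g y) (g z)"
    using conjugation_of_cycle[OF assms(2) g] by simp
  then show "cyc3 (g x) (g y) (g z) \<in> G" using assms comp_in inv_in by metis
  show "distinct [g x, g y, g z]"
    using assms(2) bij_is_inj[OF g] by (auto dest: injD)
qed

lemma linked_sym: "linked y z \<Longrightarrow> linked z y"
proof (unfold linked_def, elim disjE exE conjE)
  fix w assume w: "distinct [y, z, w]" "cyc3 y z w \<in> G"
  then have "inv' (cyc3 y z w) = cyc3 z y w"
    using cyc3_inverse[OF w(1)] cyc3_rotate[of w z y] by auto
  then show "z = y \<or> (\<exists>w. distinct [z, y, w] \<and> cyc3 z y w \<in> G)"
    using w inv_in[OF w(2)] by (intro disjI2 exI[of _ w]) auto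
qed simp

lemma linked_conj: "g \<in> G \<Longrightarrow> linked y z \<Longrightarrow> linked (g y) (g z)"
  unfolding linked_def using conj_cyc3 by blast

text \<open>Conjugation by the 3-cycle that sends \<open>y\<close> to \<open>z\<close> fixes
  \<open>x\<close>, unless \<open>x\<close> lies on it, and so turns a 3-cycle through
  \<open>x\<close> and \<open>y\<close> into one through \<open>x\<close> and
  \<open>z\<close>.\<close>

lemma linked_trans:
  assumes "linked x y" "linked y z" shows "linked x z"
proof (cases "x = y \<or> y = z \<or> x = z")
  case False
  then obtain u v where u: "distinct [x, y, u]" "cyc3 x y u \<in> G"
    and v: "distinct [y, z, v]" "cyc3 y z v \<in> G"
    using assms unfolding linked_def by blast
  show ?thesis
  proof (cases "u = z \<or> x = v")
    case True
    then have d: "distinct [x, y, z]" and "cyc3 x y z \<in> G"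
      using u v cyc3_rotate[of x y z] by auto
    then have "cyc3 z y x \<in> G" using inv_in cyc3_inverse by metis
    moreover have "cyc3 x z y = cyc3 z y x" using cyc3_rotate[of x z y] d by auto
    ultimately show ?thesis unfolding linked_def using d by auto
  next
    case no: False
    let ?g = "cyc3 y z v"
    have "?g x = x" "?g y = z" using no False u v by (auto simp: Transposition.transpose_def)
    then show ?thesis
      using conj_cyc3[OF v(2) u] unfolding linked_def by metis
  qed
qed (use assms linked_def in auto)

text \<open>Conjugation by a 3-cycle \<open>(w z v)\<close> replaces the third point of
  \<open>(x y w)\<close> by \<open>z\<close>. If \<open>v\<close> is \<open>x\<close> or
  \<open>y\<close>, the two cycles exchange their roles.\<close>

lemma all_linked_imp_cyc3:
  assumes "\<And>y z. y \<in> S \<Longrightarrow> z \<in> S \<Longrightarrow> linked y z"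
    and S: "x \<in> S" "y \<in> S" "z \<in> S" and d: "distinct [x, y, z]"
  shows "cyc3 x y z \<in> G"
proof -
  obtain w where w: "distinct [x, y, w]" "cyc3 x y w \<in> G"
    using assms(1)[OF S(1,2)] d unfolding linked_def by auto
  show ?thesis
  proof (cases "w = z")
    case False
    have "w \<in> S"
    proof (rule ccontr)
      assume "w \<notin> S"
      then have "cyc3 x y w w = w" using permutes_not_in[OF permutes[OF w(2)]] by blast
      moreover have "cyc3 x y w w = x" using w(1) by (auto simp: Transposition.transpose_def)
      ultimately show False using w(1) by simp
    qed
    then obtain v where v: "distinct [w, z, v]" "cyc3 w z v \<in> G"
      using assms(1)[of w z] S False unfolding linked_def by auto
    consider "v = x" | "v = y" | "v \<notin> {x, y}" by blast
    then show ?thesis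
    proof cases
      case 1
      have "cyc3 x y w w = x" "cyc3 x y w z = z" "cyc3 x y w x = y"
        using w(1) d v(1) by (auto simp: Transposition.transpose_def)
      then have "cyc3 x z y \<in> G" using conj_cyc3[OF w(2) v] 1 by simp
      moreover have "distinct [x, z, y]" using d by auto
      ultimately have "cyc3 y z x \<in> G" using inv_in cyc3_inverse by metis
      then show ?thesis using cyc3_rotate[OF d] by simp
    next
      case 2
      have inv: "inv' (cyc3 x y w) = cyc3 w y x" using w(1) by (rule cyc3_inverse)
      have "cyc3 w y x w = y" "cyc3 w y x z = z" "cyc3 w y x y = x"
        using w(1) d v(1) by (auto simp: Transposition.transpose_def)
      then have "cyc3 y z x \<in> G" using conj_cyc3[OF inv_in[OF w(2)] v] 2 inv by simp
      then show ?thesis using cyc3_rotate[OF d] by simp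
    next
      case 3
      have "cyc3 w z v w = z" "cyc3 w z v x = x" "cyc3 w z v y = y"
        using 3 v(1) w(1) d by (auto simp: Transposition.transpose_def)
      then show ?thesis using conj_cyc3[OF v(2) w] by simp
    qed
  qed (use w in simp)
qed

end

section \<open>Groups generated by letter actions and the alternating group\<close>

lemma fst_letters: "x \<in> letters A \<Longrightarrow> fst x \<in> A"
  by (auto simp: letters_def)

lemma word_act_permutes:
  assumes "\<And>a. a \<in> A \<Longrightarrow> \<pi> a permutes S"
  shows "u \<in> lists (letters A) \<Longrightarrow> foldr (letter_act \<pi>) u permutes S"
proof (induction u)
  case (Cons x u)
  then have "fst x \<in> A" "foldr (letter_act \<pi>) u permutes S" by (auto simp: fst_letters)
  moreover from this have "letter_act \<pi> x permutes S"
    using assms permutes_inv by (auto simp: letter_act_def)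
  ultimately show ?case unfolding foldr.simps by (intro permutes_compose)
qed (simp add: permutes_id)

lemma word_act_inv:
  assumes "\<And>a. a \<in> A \<Longrightarrow> \<pi> a permutes S" "u \<in> lists (letters A)"
  shows "foldr (letter_act \<pi>) (inv_word u) (foldr (letter_act \<pi>) u y) = y"
  using assms(2)
proof (induction u)
  case (Cons x u)
  then have "fst x \<in> A" by (auto simp: fst_letters)
  then have "bij (\<pi> (fst (letter_inv x)))" using permutes_bij[OF assms(1)] by (simp add: letter_inv_def)
  then show ?case using Cons letter_act_inv[of \<pi> "letter_inv x"] by simp
qed simp

lemma permutation_group_words:
  assumes \<pi>: "\<And>a. a \<in> A \<Longrightarrow> \<pi> a permutes S"
  shows "permutation_group (foldr (letter_act \<pi>) ` lists (letters A)) S"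
proof
  let ?w = "foldr (letter_act \<pi>)" and ?L = "lists (letters A)"
  show "g permutes S" if "g \<in> ?w ` ?L" for g
    using word_act_permutes[where \<pi> = \<pi>] \<pi> that by blast
  show "id \<in> ?w ` ?L" by (rule image_eqI[of _ _ "[]"]) simp_all
  show "g \<circ> h \<in> ?w ` ?L" if gh: "g \<in> ?w ` ?L" "h \<in> ?w ` ?L" for g h
  proof -
    obtain u v where "u \<in> ?L" "v \<in> ?L" "g = ?w u" "h = ?w v" using gh by blast
    moreover have "?w u \<circ> ?w v = ?w (u @ v)" by (simp add: fun_eq_iff)
    ultimately show ?thesis by (intro image_eqI[of _ _ "u @ v"]) (simp_all del: in_lists_conv_set)
  qed
  show "inv' g \<in> ?w ` ?L" if g: "g \<in> ?w ` ?L" for g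
  proof -
    obtain u where u: "u \<in> ?L" "g = ?w u" using g by blast
    have "?w (inv_word u) \<circ> ?w u = id" "?w u \<circ> ?w (inv_word u) = id"
      using word_act_inv[where \<pi> = \<pi>, OF \<pi> u(1)]
        word_act_inv[where \<pi> = \<pi> and u = "inv_word u", OF \<pi>] u(1)
      by (auto simp: fun_eq_iff)
    then have "inv' g = ?w (inv_word u)" using u(2) by (intro inv_unique_comp) auto
    then show ?thesis using u(1) by (metis imageI inv_word_in_lists)
  qed
qed

text \<open>Each generator maps some point of the block \<open>{x, y, z}\<close> into the block and
  therefore preserves the linked class of \<open>x\<close>. Transitivity spreads this class over all
  points, so every 3-cycle is present.\<close>

lemma alternating_generation:
  fixes \<pi> :: "'a \<Rightarrow> nat \<Rightarrow> nat" and A :: "'a set"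
  defines "G \<equiv> foldr (letter_act \<pi>) ` lists (letters A)"
  assumes \<pi>: "\<And>a. a \<in> A \<Longrightarrow> \<pi> a permutes {1..n}"
    and cyc: "distinct [x, y, z]" "{x, y, z} \<subseteq> {1..n}" "cyc3 x y z \<in> G"
    and block: "\<And>a. a \<in> A \<Longrightarrow> \<exists>w\<in>{x, y, z}. \<pi> a w \<in> {x, y, z}"
    and reach: "\<And>w. w \<in> {1..n} \<Longrightarrow> \<exists>g\<in>G. g x = w"
  shows "carrier (alt_group n) \<subseteq> G"
proof -
  interpret permutation_group G "{1..n}"
    unfolding G_def using \<pi> by (rule permutation_group_words)
  have "linked x y" "linked y z" unfolding linked_def
    using cyc cyc3_rotate[of x y z] by auto
  then have B: "linked x w" if "w \<in> {x, y, z}" for w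
    using that linked_trans linked_def by blast
  have letter: "linked x (letter_act \<pi> l w)" if "l \<in> letters A" "linked x w" for l w
  proof -
    have a: "fst l \<in> A" using that(1) by (auto simp: letters_def)
    obtain v where v: "v \<in> {x, y, z}" "\<pi> (fst l) v \<in> {x, y, z}" using block[OF a] by blast
    obtain v' where v': "v' \<in> {x, y, z}" "letter_act \<pi> l v' \<in> {x, y, z}"
    proof (cases "snd l")
      case True
      then show ?thesis using that v by (auto simp: letter_act_def)
    next
      case False
      then have "letter_act \<pi> l (\<pi> (fst l) v) = v"
        using permutes_inverses(2)[OF \<pi>[OF a]] by (simp add: letter_act_def)
      then show ?thesis using that[of "\<pi> (fst l) v"] v by simp
    qed
    have "[l] \<in> lists (letters A)" using that(1) by simp
    then have "foldr (letter_act \<pi>) [l] \<in> G" unfolding G_def by (rule imageI)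
    then have "letter_act \<pi> l \<in> G" by simp
    moreover have "linked v' w" using B[OF v'(1)] that(2) linked_sym linked_trans by blast
    ultimately have "linked (letter_act \<pi> l v') (letter_act \<pi> l w)" by (rule linked_conj)
    then show ?thesis using B[OF v'(2)] linked_trans by blast
  qed
  have word: "linked x (foldr (letter_act \<pi>) u x)" if "u \<in> lists (letters A)" for u
    using that
  proof (induction u)
    case (Cons l u)
    then show ?case using letter by simp
  qed (simp add: linked_def)
  have "linked x w" if "w \<in> {1..n}" for w
    using reach[OF that] word unfolding G_def by blast
  then have "linked v w" if "v \<in> {1..n}" "w \<in> {1..n}" for v w
    using that linked_sym linked_trans by blast
  then have "three_cycles n \<subseteq> G"
    using all_linked_imp_cyc3 stupid_lemma by (smt (verit) insert_subset list.set(2) mem_Collect_eq subsetI)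
  moreover have "g \<in> G" if "g \<in> generate (alt_group n) (three_cycles n)" "three_cycles n \<subseteq> G" for g
    using that
  proof induction
    case (inv h)
    then have "h \<in> carrier (alt_group n)" using three_cycles_incl by blast
    then show ?case using inv inv_in alt_group_inv_equality by auto
  qed (use id_in comp_in in \<open>auto simp: alt_group_one alt_group_mult\<close>)
  ultimately show ?thesis unfolding alt_group_carrier_as_three_cycles by blast
qed

lemma evenperm_cycle: "distinct cs \<Longrightarrow> odd (length cs) \<Longrightarrow> evenperm (cycle_of_list cs)"
  using swapidseq_ext_imp_swapidseq[OF swapidseq_ext_of_cycles] by (subst evenperm_unique) auto

lemma cycle_of_list_nth:
  assumes "distinct cs" "j < length cs"
  shows "cycle_of_list cs (cs ! j) = cs ! (Suc j mod length cs)"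
proof -
  have "map (cycle_of_list cs) cs = rotate1 cs" using cyclic_rotation[OF assms(1), of 1] by simp
  then show ?thesis using assms nth_rotate1 nth_map by metis
qed

lemma letter_act_True [simp]: "letter_act \<pi> (a, True) = \<pi> a"
  by (simp add: fun_eq_iff letter_act_def)

lemma alternating_two_generators:
  assumes n: "n \<ge> 5" and ab: "a \<in> A" "b \<in> A" "a \<noteq> b"
  shows "\<exists>\<pi>. (\<forall>c\<in>A. \<pi> c \<in> carrier (alt_group n)) \<and>
    carrier (alt_group n) \<subseteq> foldr (letter_act \<pi>) ` lists (letters A)"
proof -
  \<comment> \<open>A cycle is even only if its length is odd, so the long cycle omits the point 1
    when \<open>n\<close> is even.\<close>
  define s where "s = (if odd n then 1 else 2 :: nat)"
  define cs where "cs = [s..<Suc n]"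
  define \<pi> where "\<pi> c = (if c = a then cyc3 1 2 3 else if c = b then cycle_of_list cs else id)" for c
  have cs: "distinct cs" "odd (length cs)" "set cs \<subseteq> {1..n}" "length cs = Suc n - s"
    using n by (auto simp: cs_def s_def)
  have alt: "\<pi> c \<in> carrier (alt_group n)" for c
  proof -
    have "cycle_of_list ds \<in> carrier (alt_group n)"
      if "distinct ds" "odd (length ds)" "set ds \<subseteq> {1..n}" for ds
      unfolding alt_group_carrier
      using permutes_subset[OF cycle_permutes that(3)] evenperm_cycle[OF that(1,2)] by blast
    from this[of cs] this[of "[1, 2, 3]"] cs n show ?thesis
      by (simp add: \<pi>_def alt_group_carrier permutes_id del: cycle_of_list.simps)
  qed
  let ?G = "foldr (letter_act \<pi>) ` lists (letters A)"
  have pow: "(\<pi> c ^^ k) \<in> ?G" if "c \<in> A" for c k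
    using that by (intro image_eqI[of _ _ "replicate k (c, True)"]) (auto simp: letters_def)
  have pa: "\<pi> a = cyc3 1 2 3" and pb: "\<pi> b = cycle_of_list cs" using ab by (auto simp: \<pi>_def)
  have step: "\<pi> b w = Suc w" if "s \<le> w" "w < n" for w
  proof -
    have "cs ! (w - s) = w" "cs ! (Suc (w - s) mod length cs) = Suc w" "w - s < length cs"
      using that cs(4) by (simp_all add: cs_def nth_append del: upt_Suc)
    then show ?thesis using cycle_of_list_nth[OF cs(1), of "w - s"] by (simp add: pb)
  qed
  have "carrier (alt_group n) \<subseteq> ?G"
  \<comment> \<open>The base point 2 lies on the long cycle for either parity, and both generators
    send it to 3; this gives the block condition.\<close>
  proof (rule alternating_generation[where x = 2 and y = 3 and z = 1])
    show "\<pi> c permutes {1..n}" for c using alt by (simp add: alt_group_carrier)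
    show "cyc3 2 3 1 \<in> ?G" using pow[OF ab(1), of 1] pa cyc3_rotate[of 1 2 "3 :: nat"] by simp
    have "s \<le> 2" by (simp add: s_def)
    then have "\<pi> b 2 = 3" using step[of 2] n by simp
    moreover have "\<pi> a 2 = 3" by (simp add: pa Transposition.transpose_def)
    ultimately show "\<exists>w\<in>{2, 3, 1}. \<pi> c w \<in> {2, 3, 1}" for c
      by (cases "c = a \<or> c = b") (auto simp: \<pi>_def)
    show "\<exists>g\<in>?G. g 2 = w" if w: "w \<in> {1..n}" for w
    proof (cases "w = 1")
      case True
      have "(\<pi> a ^^ 2) 2 = 1" by (simp add: pa numeral_2_eq_2 Transposition.transpose_def)
      then show ?thesis using pow ab True by blast
    next
      case False
      have "k \<le> n - 2 \<Longrightarrow> (\<pi> b ^^ k) 2 = 2 + k" for k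
        using step by (induction k) (auto simp: s_def)
      from this[of "w - 2"] have "(\<pi> b ^^ (w - 2)) 2 = w" using w False by auto
      then show ?thesis using pow ab by blast
    qed
  qed (use n in auto)
  then show ?thesis using alt by blast
qed

text \<open>Inserting new points \<open>P\<close> after \<open>x\<close> into the cycle of a permutation through \<open>x\<close>, such that the
  length of this cycle becomes \<open>2 * d + 1\<close> where \<open>d\<close> annihilates the old permutation: then the power
  with exponent \<open>2 * d\<close> is the inverse of the new cycle. The involution \<open>\<tau>\<close> only serves to adjust
  the sign.\<close>

lemma insertion_power:
  fixes \<sigma> \<tau> :: "'s \<Rightarrow> 's"
  assumes \<sigma>: "\<sigma> permutes S" "finite S" "\<sigma> ^^ d = id" "d > 0" and x: "x \<in> S"
    and P: "distinct P" "set P \<inter> S = {}" "length P + least_power \<sigma> x = 2 * d + 1"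
    and \<tau>: "\<tau> permutes T" "\<tau> \<circ> \<tau> = id" "T \<inter> (S \<union> set P) = {}"
  defines "\<pi> \<equiv> \<sigma> \<circ> cycle_of_list (x # P) \<circ> \<tau>"
    and "Orb \<equiv> range (\<lambda>j. (\<sigma> ^^ j) x) \<union> set P"
  shows "z \<in> Orb \<Longrightarrow> \<pi> ((\<pi> ^^ (2 * d)) z) = z"
    and "z \<notin> Orb \<Longrightarrow> (\<pi> ^^ (2 * d)) z = z"
    and "j < length P \<Longrightarrow> (\<pi> ^^ Suc j) x = P ! j"
    and "(\<pi> ^^ Suc (length P)) x = \<sigma> x"
proof -
  let ?\<zeta> = "cycle_of_list (x # P)" and ?k = "length P" and ?p = "least_power \<sigma> x"
  have perm: "permutation \<sigma>" using \<sigma> permutation_permutes by blast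
  have p: "(\<sigma> ^^ ?p) x = x" "?p > 0" using least_power_of_permutation[OF perm] by auto
  have xP: "distinct (x # P)" using P x by auto
  have pS: "\<pi> z = \<sigma> z" if "z \<in> S" "z \<noteq> x" for z
  proof -
    have "z \<notin> T" "z \<notin> set (x # P)" using that P \<tau> by auto
    then show ?thesis using permutes_not_in[OF \<tau>(1)] id_outside_supp[of z "x # P"]
      by (simp add: \<pi>_def del: cycle_of_list.simps)
  qed
  \<comment> \<open>At the last new point the index wraps around to \<open>x\<close>, so the detour
    rejoins the old cycle at \<open>\<sigma> x\<close>.\<close>
  have cyc: "\<pi> ((x # P) ! j) = \<sigma> ((x # P) ! (Suc j mod Suc ?k))" if "j \<le> ?k" for j
  proof -
    have "(x # P) ! j \<in> set (x # P)" using that by (intro nth_mem) simp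
    then have "(x # P) ! j \<notin> T" using \<tau> x by auto
    moreover have "?\<zeta> ((x # P) ! j) = (x # P) ! (Suc j mod Suc ?k)"
      using cycle_of_list_nth[OF xP, of j] that by simp
    ultimately show ?thesis using permutes_not_in[OF \<tau>(1)]
      by (simp add: \<pi>_def del: cycle_of_list.simps)
  qed
  have path: "(\<pi> ^^ j) x = (x # P) ! j" if "j \<le> ?k" for j
    using that
  proof (induction j)
    case (Suc j)
    have "P ! j \<in> set P" using Suc.prems by (intro nth_mem) simp
    then have "P ! j \<notin> S" using P(2) by blast
    then have "\<sigma> (P ! j) = P ! j" using permutes_not_in[OF \<sigma>(1)] by blast
    then show ?case using Suc cyc[of j] by (simp add: mod_less)
  qed simp
  show "(\<pi> ^^ Suc j) x = P ! j" if "j < length P"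
    using path[of "Suc j"] that by (simp del: funpow.simps)
  show last: "(\<pi> ^^ Suc ?k) x = \<sigma> x" using path[of ?k] cyc[of ?k] by simp
  have tail: "(\<pi> ^^ (j + Suc ?k)) x = (\<sigma> ^^ Suc j) x" if "j < ?p" for j
    using that
  proof (induction j)
    case (Suc j)
    have "\<not> ?p dvd Suc j" using Suc.prems by (auto dest: dvd_imp_le)
    then have "(\<sigma> ^^ Suc j) x \<noteq> x" using least_power_minimal by metis
    moreover have "(\<sigma> ^^ Suc j) x \<in> S"
      using permutes_in_image[OF permutes_funpow[OF \<sigma>(1)]] x by blast
    ultimately show ?case using Suc pS by simp
  qed (use last in simp)
  have full: "(\<pi> ^^ Suc (2 * d)) x = x"
  proof -
    have "?p - 1 + Suc ?k = Suc (2 * d)" "Suc (?p - 1) = ?p" using P(3) p(2) by auto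
    then show ?thesis using tail[of "?p - 1"] p by simp
  qed
  have Orb: "\<exists>j. z = (\<pi> ^^ j) x" if "z \<in> Orb" for z
    using that unfolding Orb_def
  proof
    assume "z \<in> range (\<lambda>j. (\<sigma> ^^ j) x)"
    then obtain i where "z = (\<sigma> ^^ (i mod ?p)) x" using funpow_mod_eq[OF p(1)] by auto
    moreover have "i mod ?p < ?p" using p(2) by simp
    ultimately show ?thesis
    proof (cases "i mod ?p")
      case 0
      then show ?thesis using \<open>z = _\<close> by (intro exI[of _ 0]) simp
    next
      case (Suc l)
      then have "l < ?p" using \<open>i mod ?p < ?p\<close> by simp
      then show ?thesis using \<open>z = _\<close> Suc tail[of l] by metis
    qed
  next
    assume "z \<in> set P"
    then obtain l where "l < ?k" "z = P ! l" by (auto simp: in_set_conv_nth)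
    then show ?thesis using path[of "Suc l"] by (intro exI[of _ "Suc l"]) simp
  qed
  show "\<pi> ((\<pi> ^^ (2 * d)) z) = z" if z: "z \<in> Orb"
  proof -
    obtain j where "z = (\<pi> ^^ j) x" using Orb[OF z] by blast
    then have "\<pi> ((\<pi> ^^ (2 * d)) z) = (\<pi> ^^ (Suc (2 * d) + j)) x"
      by (simp only: funpow_add comp_apply funpow.simps)
    also have "\<dots> = (\<pi> ^^ j) ((\<pi> ^^ Suc (2 * d)) x)"
      by (subst add.commute) (simp only: funpow_add comp_apply)
    finally show ?thesis using full \<open>z = _\<close> by simp
  qed
  show "(\<pi> ^^ (2 * d)) z = z" if z: "z \<notin> Orb"
  proof (cases "z \<in> S")
    case True
    have xOrb: "x \<in> Orb" unfolding Orb_def using rangeI[of "\<lambda>j. (\<sigma> ^^ j) x" 0] by simp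
    have inj: "inj \<sigma>" using \<sigma>(1) permutes_inj by blast
    have "(\<pi> ^^ j) z = (\<sigma> ^^ j) z \<and> (\<sigma> ^^ j) z \<notin> Orb" for j
    proof (induction j)
      case (Suc j)
      let ?y = "(\<sigma> ^^ j) z"
      have y: "?y \<in> S" "?y \<noteq> x"
        using permutes_in_image[OF permutes_funpow[OF \<sigma>(1)]] True Suc xOrb by blast+
      have "\<sigma> ?y \<notin> Orb"
      proof
        assume "\<sigma> ?y \<in> Orb"
        moreover have "\<sigma> ?y \<in> S" using y permutes_in_image[OF \<sigma>(1)] by blast
        ultimately obtain i where i: "\<sigma> ?y = (\<sigma> ^^ i) x" unfolding Orb_def using P(2) by blast
        have "\<exists>i'. \<sigma> ?y = \<sigma> ((\<sigma> ^^ i') x)"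
        proof (cases i)
          case 0
          have "Suc (d - 1) = d" using \<sigma>(4) by simp
          then have "(\<sigma> ^^ Suc (d - 1)) x = x" using \<sigma>(3) by (simp only: id_apply)
          then show ?thesis using i 0 by (intro exI[of _ "d - 1"]) simp
        next
          case (Suc i')
          then show ?thesis using i by auto
        qed
        then obtain i' where "?y = (\<sigma> ^^ i') x" using injD[OF inj] by blast
        then have "?y \<in> Orb" unfolding Orb_def by (intro UnI1 range_eqI)
        then show False using Suc by blast
      qed
      then show ?case using Suc pS[OF y] by simp
    qed (simp add: z)
    from this[of "2 * d"] show ?thesis
      by (simp add: mult_2 funpow_add \<sigma>(3))
  next
    case False
    have other: "\<pi> y = \<tau> y" if "y \<notin> S" "y \<notin> set P" for y
    proof -
      have "\<tau> y \<notin> S \<and> \<tau> y \<notin> set P"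
        using that \<tau>(3) permutes_in_image[OF \<tau>(1)] permutes_not_in[OF \<tau>(1), of y]
        by (cases "y \<in> T") auto
      moreover from this have "?\<zeta> (\<tau> y) = \<tau> y" using x by (intro id_outside_supp) auto
      ultimately show ?thesis using permutes_not_in[OF \<sigma>(1)]
        by (simp add: \<pi>_def del: cycle_of_list.simps)
    qed
    have zP: "z \<notin> set P" using z by (auto simp: Orb_def)
    have \<tau>z: "\<tau> z \<notin> S \<and> \<tau> z \<notin> set P"
      using False zP \<tau>(3) permutes_in_image[OF \<tau>(1)] permutes_not_in[OF \<tau>(1), of z]
      by (cases "z \<in> T") auto
    \<comment> \<open>Outside \<open>S\<close> and \<open>P\<close> only the involution
      \<open>\<tau>\<close> acts; the exponent is taken even for this reason.\<close>
    have "\<pi> (\<pi> z) = z"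
      using other[OF False zP] other[of "\<tau> z"] \<tau>z \<tau>(2) by (metis comp_apply id_apply)
    then have "(\<pi> ^^ (2 * j)) z = z" for j by (induction j) auto
    then show ?thesis .
  qed
qed

lemma even_correction:
  assumes "permutation (p :: 's \<Rightarrow> 's)" "u \<noteq> v"
  shows "\<exists>\<tau>. \<tau> permutes {u, v} \<and> \<tau> \<circ> \<tau> = id \<and> evenperm (p \<circ> \<tau>)"
proof (cases "evenperm p")
  case True
  then show ?thesis by (intro exI[of _ id]) (auto simp: permutes_id)
next
  case False
  have "evenperm (p \<circ> Transposition.transpose u v)"
    using False assms evenperm_comp[OF assms(1) permutation_swap_id[of u v]]
    by (simp add: evenperm_swap)
  then show ?thesis
    by (intro exI[of _ "Transposition.transpose u v"]) (auto intro: permutes_swap_id)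
qed

text \<open>By \<open>disj\<close> the two lengthened cycles meet only in \<open>x\<close>.
  Transitivity survives because each detour returns to the old image of \<open>x\<close>, and the
  new points lie on the detours.\<close>

lemma alternating_extension:
  fixes \<sigma> :: "'a \<Rightarrow> nat \<Rightarrow> nat"
  assumes \<sigma>: "\<And>c. c \<in> A \<Longrightarrow> \<sigma> c permutes {1..m}" and ab: "a \<in> A" "b \<in> A" "a \<noteq> b"
    and x: "x \<in> {1..m}"
    and trans: "\<And>y. y \<in> {1..m} \<Longrightarrow> \<exists>u\<in>lists (letters A). foldr (letter_act \<sigma>) u x = y"
    and disj: "\<And>i j. (\<sigma> a ^^ i) x = (\<sigma> b ^^ j) x \<Longrightarrow> (\<sigma> a ^^ i) x = x"
  shows "\<exists>n\<ge>N. m \<le> n \<and> (\<exists>\<pi>. (\<forall>c\<in>A. \<pi> c \<in> carrier (alt_group n)) \<and>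
    carrier (alt_group n) \<subseteq> foldr (letter_act \<pi>) ` lists (letters A) \<and>
    (\<forall>c\<in>A. \<forall>y\<in>{1..m}. y \<noteq> x \<longrightarrow> \<pi> c y = \<sigma> c y))"
proof -
  have perm: "permutation (\<sigma> c)" if "c \<in> A" for c
    using \<sigma>[OF that] permutation_permutes by blast
  obtain da where da: "\<sigma> a ^^ da = id" "da > 0"
    using permutation_is_nilpotent[OF perm[OF ab(1)]] by blast
  \<comment> \<open>An exponent above \<open>N\<close> forces the degree above \<open>N\<close>,
    since the block inserted for \<open>b\<close> is longer than \<open>db\<close>.\<close>
  obtain db where db: "\<sigma> b ^^ db = id" "db > N" "db > 0"
    using permutation_is_nilpotent'[OF perm[OF ab(2)], of N] by auto
  define k where "k = 2 * da + 1 - least_power (\<sigma> a) x"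
  define l where "l = 2 * db + 1 - least_power (\<sigma> b) x"
  have "least_power (\<sigma> a) x \<le> da" "least_power (\<sigma> b) x \<le> db"
    using da db by (auto intro!: least_power_le)
  then have k: "k + least_power (\<sigma> a) x = 2 * da + 1" "k \<ge> 2"
    and l: "l + least_power (\<sigma> b) x = 2 * db + 1" "l \<ge> 2" "l > N"
    using da db by (auto simp: k_def l_def)
  define P where "P = [m + 1..<m + 1 + k]"
  define Q where "Q = [m + 1 + k..<m + 1 + k + l]"
  define n where "n = m + k + l"
  have P: "distinct P" "set P \<inter> {1..m} = {}" "length P = k" "set P \<subseteq> {1..n}"
    and Q: "distinct Q" "set Q \<inter> {1..m} = {}" "length Q = l" "set Q \<subseteq> {1..n}"
    and PQ: "set P \<inter> set Q = {}"
    by (auto simp: P_def Q_def n_def simp del: upt_Suc)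
  have n: "n \<ge> N" "m \<le> n" "{1..m} \<subseteq> {1..n}" "x \<in> {1..n}" using l(3) x by (auto simp: n_def)
  have cover: "{1..n} = {1..m} \<union> set P \<union> set Q" by (auto simp: n_def P_def Q_def simp del: upt_Suc)
  define \<rho> where "\<rho> c = (if c = a then \<sigma> a \<circ> cycle_of_list (x # P)
    else if c = b then \<sigma> b \<circ> cycle_of_list (x # Q) else \<sigma> c)" for c
  \<comment> \<open>Signs are corrected on new points where the generator is otherwise idle: in
    \<open>P\<close> for \<open>b\<close>, in \<open>Q\<close> for all others. So generators other
    than \<open>a\<close> and \<open>b\<close> fix \<open>m + 1\<close>, as the block condition
    requires.\<close>
  define T where "T c = (if c = b then {m + 1, m + 2} else {m + 1 + k, m + 2 + k})" for c
  have P01: "P ! 0 = m + 1" "P ! 1 = m + 2" and Q01: "Q ! 0 = m + 1 + k" "Q ! 1 = m + 2 + k"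
    using k l by (simp_all add: P_def Q_def nth_append del: upt_Suc)
  have T: "T c \<subseteq> {1..n}" "T c \<inter> {1..m} = {}" "c \<noteq> b \<Longrightarrow> T c \<inter> set P = {}" "T b \<inter> set Q = {}" for c
    using k l by (auto simp: T_def P_def Q_def n_def simp del: upt_Suc)
  have \<rho>: "\<rho> c permutes {1..n}" if "c \<in> A" for c
  proof -
    have "\<sigma> c permutes {1..n}" using \<sigma>[OF that] n(3) by (rule permutes_subset)
    moreover have "cycle_of_list (x # P) permutes {1..n}" "cycle_of_list (x # Q) permutes {1..n}"
      using n(4) P(4) Q(4) by (intro permutes_subset[OF cycle_permutes]; simp)+
    ultimately show ?thesis unfolding \<rho>_def by (auto intro: permutes_compose)
  qed
  have "\<exists>\<tau>. \<tau> permutes T c \<and> \<tau> \<circ> \<tau> = id \<and> evenperm (\<rho> c \<circ> \<tau>)" if "c \<in> A" for c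
  proof -
    have "permutation (\<rho> c)" using \<rho>[OF that] permutation_permutes by blast
    from even_correction[OF this, of "m + 1" "m + 2"] even_correction[OF this, of "m + 1 + k" "m + 2 + k"]
    show ?thesis by (cases "c = b") (simp_all add: T_def)
  qed
  then obtain \<tau> where \<tau>: "\<And>c. c \<in> A \<Longrightarrow> \<tau> c permutes T c" "\<And>c. c \<in> A \<Longrightarrow> \<tau> c \<circ> \<tau> c = id"
    "\<And>c. c \<in> A \<Longrightarrow> evenperm (\<rho> c \<circ> \<tau> c)"
    by metis
  define \<pi> where "\<pi> c = \<rho> c \<circ> \<tau> c" for c
  have alt: "\<pi> c \<in> carrier (alt_group n)" if "c \<in> A" for c
    unfolding \<pi>_def alt_group_carrier
    using permutes_compose[OF permutes_subset[OF \<tau>(1)[OF that] T(1)] \<rho>[OF that]] \<tau>(3)[OF that]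
    by blast
  then have perm_\<pi>: "\<pi> c permutes {1..n}" if "c \<in> A" for c
    using that by (simp add: alt_group_carrier)
  have agree: "\<pi> c y = \<sigma> c y" if "c \<in> A" "y \<in> {1..m}" "y \<noteq> x \<or> c \<notin> {a, b}" for c y
  proof -
    have "\<tau> c y = y" using permutes_not_in[OF \<tau>(1)[OF that(1)]] T(2) that(2) by blast
    moreover have "cycle_of_list (x # P) y = y" "cycle_of_list (x # Q) y = y" if "y \<noteq> x"
      using that \<open>y \<in> {1..m}\<close> P(2) Q(2) by (intro id_outside_supp; auto)+
    ultimately show ?thesis using that(3) by (auto simp: \<pi>_def \<rho>_def simp del: cycle_of_list.simps)
  qed
  define OA where "OA = range (\<lambda>j. (\<sigma> a ^^ j) x) \<union> set P"
  define OB where "OB = range (\<lambda>j. (\<sigma> b ^^ j) x) \<union> set Q"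
  have \<pi>a: "\<pi> a = \<sigma> a \<circ> cycle_of_list (x # P) \<circ> \<tau> a"
    and \<pi>b: "\<pi> b = \<sigma> b \<circ> cycle_of_list (x # Q) \<circ> \<tau> b"
    using ab(3) by (simp_all add: \<pi>_def \<rho>_def)
  note A = insertion_power[OF \<sigma>[OF ab(1)] finite_atLeastAtMost da x P(1,2) _ \<tau>(1,2)[OF ab(1)],
      folded \<pi>a OA_def, unfolded P(3), OF k(1)]
  note B = insertion_power[OF \<sigma>[OF ab(2)] finite_atLeastAtMost db(1,3) x Q(1,2) _ \<tau>(1,2)[OF ab(2)],
      folded \<pi>b OB_def, unfolded Q(3), OF l(1)]
  have TA: "T a \<inter> ({1..m} \<union> set P) = {}" and TB: "T b \<inter> ({1..m} \<union> set Q) = {}"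
    using T(2-4) ab(3) by blast+
  let ?G = "foldr (letter_act \<pi>) ` lists (letters A)"
  interpret permutation_group ?G "{1..n}" using perm_\<pi> by (rule permutation_group_words)
  have pow: "\<pi> c ^^ j \<in> ?G" if "c \<in> A" for c j
    using that by (intro image_eqI[of _ _ "replicate j (c, True)"]) (auto simp: letters_def)
  \<comment> \<open>The exponent is one short of the period on the lengthened cycle and annihilates
    everything else, so \<open>f\<close> is just the cycle of \<open>\<pi> a\<close> through
    \<open>x\<close>.\<close>
  define f where "f = inv' (\<pi> a ^^ (2 * da))"
  define g where "g = inv' (\<pi> b ^^ (2 * db))"
  have f: "f \<in> ?G" "bij f" and g: "g \<in> ?G" "bij g"
    unfolding f_def g_def using pow ab inv_in permutes permutes_bij by blast+
  have f_eq: "f z = y" if "(\<pi> a ^^ (2 * da)) y = z" for y z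
    unfolding f_def using that permutes_inverses(2)[OF permutes[OF pow[OF ab(1)]]] by metis
  have g_eq: "g z = y" if "(\<pi> b ^^ (2 * db)) y = z" for y z
    unfolding g_def using that permutes_inverses(2)[OF permutes[OF pow[OF ab(2)]]] by metis
  have f_out: "f z = z" if "z \<notin> OA" for z using A(2)[OF TA that] f_eq by blast
  have g_out: "g z = z" if "z \<notin> OB" for z using B(2)[OF TB that] g_eq by blast
  have xO: "x \<in> OA" "x \<in> OB"
    unfolding OA_def OB_def using rangeI[of "\<lambda>j. (\<sigma> a ^^ j) x" 0] rangeI[of "\<lambda>j. (\<sigma> b ^^ j) x" 0]
    by auto
  have f_x: "f x = \<pi> a x"
  proof -
    let ?y = "f x"
    have y: "(\<pi> a ^^ (2 * da)) ?y = x"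
      unfolding f_def by (rule permutes_inverses(1)[OF permutes[OF pow[OF ab(1)]]])
    then have "?y \<in> OA" using A(2)[OF TA, of ?y] xO by metis
    then show ?thesis using A(1)[OF TA, of ?y] y by simp
  qed
  have g_x: "g x = \<pi> b x"
  proof -
    let ?y = "g x"
    have y: "(\<pi> b ^^ (2 * db)) ?y = x"
      unfolding g_def by (rule permutes_inverses(1)[OF permutes[OF pow[OF ab(2)]]])
    then have "?y \<in> OB" using B(2)[OF TB, of ?y] xO by metis
    then show ?thesis using B(1)[OF TB, of ?y] y by simp
  qed
  have ax: "\<pi> a x = m + 1" using A(3)[OF TA, of 0] k P01 by simp
  have bx: "\<pi> b x = m + 1 + k" using B(3)[OF TB, of 0] l Q01 by simp
  have "OA \<inter> OB \<subseteq> {x}"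
  proof
    fix z assume "z \<in> OA \<inter> OB"
    moreover have "(\<sigma> c ^^ j) x \<in> {1..m}" if "c \<in> A" for c j
      using permutes_in_image[OF permutes_funpow[OF \<sigma>[OF that]]] x by blast
    ultimately show "z \<in> {x}" unfolding OA_def OB_def using P(2) Q(2) PQ ab disj by blast
  qed
  then have comm: "f \<circ> g \<circ> inv' f \<circ> inv' g = cyc3 x (m + 1) (m + 1 + k)"
    using commutator_cyc3[OF f(2) g(2) f_out g_out] f_x g_x ax bx x by auto
  have "carrier (alt_group n) \<subseteq> ?G"
  proof (rule alternating_generation[where x = x and y = "m + 1" and z = "m + 1 + k"])
    show "distinct [x, m + 1, m + 1 + k]" using x k(2) by auto
    show "{x, m + 1, m + 1 + k} \<subseteq> {1..n}" using x k(2) l(2) by (auto simp: n_def)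
    show "cyc3 x (m + 1) (m + 1 + k) \<in> ?G"
      unfolding comm[symmetric] by (intro comp_in inv_in f(1) g(1))
    show "\<exists>w\<in>{x, m + 1, m + 1 + k}. \<pi> c w \<in> {x, m + 1, m + 1 + k}" if c: "c \<in> A" for c
    proof (cases "c \<in> {a, b}")
      case True
      then show ?thesis using ax bx by auto
    next
      case False
      have "m + 1 \<notin> T c" using False k l by (auto simp: T_def)
      then have "\<pi> c (m + 1) = m + 1"
        using False permutes_not_in[OF \<tau>(1)[OF c]] permutes_not_in[OF \<sigma>[OF c]]
        by (simp add: \<pi>_def \<rho>_def)
      then show ?thesis by auto
    qed
    have GI: "\<exists>g\<in>?G. g x = h z" if "\<exists>g\<in>?G. g x = z" "h \<in> ?G" for h z
      using that(1)
    proof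
      fix g' assume "g' \<in> ?G" "g' x = z"
      then show ?thesis using comp_in[OF that(2), of g'] by (intro bexI[of _ "h \<circ> g'"]) simp_all
    qed
    have Gx: "\<exists>g\<in>?G. g x = h x" if "h \<in> ?G" for h using that by blast
    have old: "\<exists>g\<in>?G. g x = \<sigma> c z" if "c \<in> A" "z \<in> {1..m}" "\<exists>g\<in>?G. g x = z" for c z
    proof (cases "z \<noteq> x \<or> c \<notin> {a, b}")
      case True
      then show ?thesis using agree[OF that(1,2) True] GI[OF that(3) pow[OF that(1), of 1]] by simp
    next
      case False
      \<comment> \<open>The altered transition at \<open>x\<close> is simulated by running through
        the whole inserted block.\<close>
      then have "\<sigma> c z = (\<pi> a ^^ Suc k) x \<or> \<sigma> c z = (\<pi> b ^^ Suc l) x"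
        using A(4)[OF TA] B(4)[OF TB] by auto
      then show ?thesis using Gx pow ab by metis
    qed
    have old_pow: "\<exists>g\<in>?G. g x = (\<sigma> c ^^ j) z" if "c \<in> A" "z \<in> {1..m}" "\<exists>g\<in>?G. g x = z" for c z j
    proof (induction j)
      case (Suc j)
      have "(\<sigma> c ^^ j) z \<in> {1..m}"
        using permutes_in_image[OF permutes_funpow[OF \<sigma>[OF that(1)]]] that(2) by blast
      then show ?case using old[OF that(1) _ Suc] by simp
    qed (use that in simp)
    have old_inv: "\<exists>g\<in>?G. g x = inv' (\<sigma> c) z"
      if c: "c \<in> A" "z \<in> {1..m}" "\<exists>g\<in>?G. g x = z" for c z
    proof -
      obtain e where e: "\<sigma> c ^^ e = id" "e > 0"
        using permutation_is_nilpotent[OF perm[OF c(1)]] by blast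
      then have "\<sigma> c ((\<sigma> c ^^ (e - 1)) z) = z"
        by (metis Suc_diff_1 comp_apply funpow.simps(2) id_apply)
      then have "inv' (\<sigma> c) z = (\<sigma> c ^^ (e - 1)) z"
        using permutes_inverses(2)[OF \<sigma>[OF c(1)]] by metis
      then show ?thesis using old_pow[OF c] by simp
    qed
    have word: "foldr (letter_act \<sigma>) u x \<in> {1..m} \<and> (\<exists>g\<in>?G. g x = foldr (letter_act \<sigma>) u x)"
      if "u \<in> lists (letters A)" for u
      using that
    proof (induction u)
      case (Cons y u)
      then have c: "fst y \<in> A" and IH: "foldr (letter_act \<sigma>) u x \<in> {1..m}"
        "\<exists>g\<in>?G. g x = foldr (letter_act \<sigma>) u x"
        by (auto simp: fst_letters)
      have "letter_act \<sigma> y permutes {1..m}"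
        using \<sigma>[OF c] permutes_inv by (auto simp: letter_act_def)
      then have "letter_act \<sigma> y (foldr (letter_act \<sigma>) u x) \<in> {1..m}"
        using IH(1) permutes_in_image by metis
      moreover have "\<exists>g\<in>?G. g x = letter_act \<sigma> y (foldr (letter_act \<sigma>) u x)"
        using old[OF c IH] old_inv[OF c IH] by (simp add: letter_act_def)
      ultimately show ?case by simp
    next
      case Nil
      have "\<exists>g\<in>?G. g x = x" by (rule bexI[OF _ id_in]) simp
      then show ?case using x by simp
    qed
    show "\<exists>g\<in>?G. g x = w" if w: "w \<in> {1..n}" for w
    proof -
      consider "w \<in> {1..m}" | "w \<in> set P" | "w \<in> set Q" using w cover by blast
      then show ?thesis
      proof cases
        case 1
        then show ?thesis using trans word by metis
      next
        case 2
        then obtain j where "j < k" "w = P ! j" using P(3) by (auto simp: in_set_conv_nth)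
        then show ?thesis using A(3)[OF TA] Gx pow[OF ab(1)] by metis
      next
        case 3
        then obtain j where "j < l" "w = Q ! j" using Q(3) by (auto simp: in_set_conv_nth)
        then show ?thesis using B(3)[OF TB] Gx pow[OF ab(2)] by metis
      qed
    qed
  qed (use perm_\<pi> in auto)
  then show ?thesis using n(1,2) alt agree by blast
qed

section \<open>Separation by alternating quotients\<close>

lemma product_set_iff:
  assumes "\<forall>H\<in>set Hs. H \<subseteq> Collect reduced_word"
  shows "g \<in> product_set (free_group A) Hs \<longleftrightarrow>
    (\<exists>hs. list_all2 (\<in>) hs Hs \<and> g = red (concat hs))"
  using assms
proof (induction Hs arbitrary: g)
  case Nil
  then show ?case by (simp add: product_set_def free_group_simps)
next
  case (Cons H Hs)
  let ?P = "product_set (free_group A) Hs"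
  have "g \<in> product_set (free_group A) (H # Hs) \<longleftrightarrow>
      (\<exists>h\<in>H. \<exists>r\<in>?P. g = h \<otimes>\<^bsub>free_group A\<^esub> r)"
    by (simp add: product_set_def set_mult_def)
  also have "\<dots> \<longleftrightarrow> (\<exists>h\<in>H. \<exists>hs. list_all2 (\<in>) hs Hs \<and> g = red (h @ concat hs))"
  proof -
    have m: "h \<otimes>\<^bsub>free_group A\<^esub> red (concat hs) = red (h @ concat hs)" for h hs
      by (simp add: mult_free_group)
    have IH: "r \<in> ?P \<longleftrightarrow> (\<exists>hs. list_all2 (\<in>) hs Hs \<and> r = red (concat hs))" for r
      using Cons by simp
    have "(\<exists>r\<in>?P. g = h \<otimes>\<^bsub>free_group A\<^esub> r) \<longleftrightarrow>
        (\<exists>hs. list_all2 (\<in>) hs Hs \<and> g = red (h @ concat hs))" for h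
      unfolding Bex_def IH using m by metis
    then show ?thesis by simp
  qed
  also have "\<dots> \<longleftrightarrow> (\<exists>hs. list_all2 (\<in>) hs (H # Hs) \<and> g = red (concat hs))"
  proof
    assume "\<exists>h\<in>H. \<exists>hs. list_all2 (\<in>) hs Hs \<and> g = red (h @ concat hs)"
    then obtain h hs where "h \<in> H" "list_all2 (\<in>) hs Hs" "g = red (h @ concat hs)" by blast
    then show "\<exists>hs. list_all2 (\<in>) hs (H # Hs) \<and> g = red (concat hs)"
      by (intro exI[of _ "h # hs"]) simp
  next
    assume "\<exists>hs. list_all2 (\<in>) hs (H # Hs) \<and> g = red (concat hs)"
    then obtain h hs where "h \<in> H" "list_all2 (\<in>) hs Hs" "g = red (concat (h # hs))"
      by (auto simp: list_all2_Cons2)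
    then show "\<exists>h\<in>H. \<exists>hs. list_all2 (\<in>) hs Hs \<and> g = red (h @ concat hs)"
      unfolding concat.simps by blast
  qed
  finally show ?case .
qed

definition infinite_index :: "'a set \<Rightarrow> 'a letter list set \<Rightarrow> bool" where
  "infinite_index A H \<longleftrightarrow> infinite ((\<lambda>u. translate u H) ` lists (letters A))"

text \<open>Translates of \<open>H\<close> can be moved to one another, and infinitely many of them
  do not fit into the finite set \<open>V\<close>.\<close>

lemma escapableI:
  assumes "finite V"
    and "\<And>C. C \<in> V \<Longrightarrow> \<exists>u\<in>lists (letters A). \<exists>H\<subseteq>Collect reduced_word.
      C = translate u H \<and> infinite_index A H"
  shows "escapable A V"
  unfolding escapable_def
proof
  fix C assume "C \<in> V"
  then obtain u H where u: "u \<in> lists (letters A)" and H: "H \<subseteq> Collect reduced_word"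
    and C: "C = translate u H" and inf: "infinite_index A H"
    using assms(2) by blast
  have "\<not> (\<lambda>v. translate v H) ` lists (letters A) \<subseteq> V"
    using inf assms(1) finite_subset unfolding infinite_index_def by blast
  then obtain v where v: "v \<in> lists (letters A)" "translate v H \<notin> V" by blast
  have "translate (v @ inv_word u) C = translate (red (v @ inv_word u @ u)) H"
    unfolding C using translate_red[OF H] by (simp flip: translate_append)
  also have "red (v @ inv_word u @ u) = red v"
    by (metis append_Nil2 red_inv_left red_red_append(2))
  finally have "translate (v @ inv_word u) C \<notin> V" using v(2) translate_red[OF H] by simp
  moreover have "v @ inv_word u \<in> lists (letters A)" using u v(1) by (simp del: in_lists_conv_set)
  ultimately show "\<exists>u\<in>lists (letters A). translate u C \<notin> V" by blast
qed

text \<open>Lets the states on the path of a single word count as cosets of a subgroup of infinite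
  index.\<close>

lemma infinite_index_trivial:
  assumes "a \<in> A" shows "infinite_index A {[]}"
proof -
  have tr: "translate (replicate k (a, True)) {[]} = {replicate k (a, True)}" for k
    using red_reduced[OF reduced_replicate, of k "(a, True)"] by (simp add: translate_def red_def)
  have "inj (\<lambda>k. translate (replicate k (a, True)) {[]})"
    unfolding tr inj_def by (simp add: replicate_eq_replicate)
  then have "infinite (range (\<lambda>k. translate (replicate k (a, True)) {[]}))"
    by (rule range_inj_infinite)
  moreover have "range (\<lambda>k. translate (replicate k (a, True)) {[]}) \<subseteq>
      (\<lambda>u. translate u {[]}) ` lists (letters A)"
    using assms by (auto simp: letters_def)
  ultimately show ?thesis unfolding infinite_index_def using finite_subset by blast
qed

text \<open>The tag keeps the states of two coset automata apart.\<close>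

definition tagged_step where
  "tagged_step V x s t \<longleftrightarrow> fst s = fst t \<and> coset_step (V (fst s)) x (snd s) (snd t)"

lemma reads_tagged_step:
  "reads (tagged_step V) u s t \<longleftrightarrow> fst s = fst t \<and> reads (coset_step (V (fst s))) u (snd s) (snd t)"
proof (induction u arbitrary: t)
  case Nil
  then show ?case by (auto simp: prod_eq_iff)
next
  case (Cons x u)
  show ?case
  proof
    assume "reads (tagged_step V) (x # u) s t"
    then show "fst s = fst t \<and> reads (coset_step (V (fst s))) (x # u) (snd s) (snd t)"
      using Cons.IH by (auto simp: tagged_step_def)
  next
    assume R: "fst s = fst t \<and> reads (coset_step (V (fst s))) (x # u) (snd s) (snd t)"
    then obtain m where "reads (coset_step (V (fst s))) u (snd s) m"
      "coset_step (V (fst s)) x m (snd t)" by auto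
    then have "reads (tagged_step V) u s (fst s, m)" using Cons.IH[of "(fst s, m)"] by simp
    moreover have "tagged_step V x (fst s, m) t"
      using \<open>coset_step _ x m _\<close> R by (simp add: tagged_step_def)
    ultimately show "reads (tagged_step V) (x # u) s t" by auto
  qed
qed

lemma inverse_automaton_tagged_step:
  assumes "\<And>b. inverse_automaton (coset_step (V b))"
  shows "inverse_automaton (tagged_step V)"
proof
  fix x s t t'
  assume st: "tagged_step V x s t"
  show "tagged_step V (letter_inv x) t s"
    using st inverse_automaton.sym[OF assms] unfolding tagged_step_def by metis
  assume "tagged_step V x s t'"
  then show "t = t'"
    using st inverse_automaton.det[OF assms, of "fst s" x "snd s" "snd t" "snd t'"]
    unfolding tagged_step_def by (metis prod_eqI)
qed

text \<open>The vertices on the path that reads \<open>w\<close> from the identity, as cosets of the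
  trivial subgroup.\<close>

definition suffix_states :: "'a letter list \<Rightarrow> 'a letter list set set" where
  "suffix_states w = (\<lambda>n. {drop n w}) ` {..length w}"

lemma reads_suffix_states:
  assumes "reduced_word w" "suffix_states w \<subseteq> V"
  shows "reads (coset_step V) w {[]} {w}"
proof -
  have "translate v {[]} \<in> V" if "w = u @ v" for u v
  proof -
    have "v = drop (length u) w" "length u \<le> length w" using that by simp_all
    then have "{v} \<in> suffix_states w" unfolding suffix_states_def by blast
    moreover have "reduced_word v" using assms(1) that by (simp add: reduced_append)
    ultimately show ?thesis using assms(2) by (auto simp: translate_def red_reduced simp flip: red_def)
  qed
  then have "reads (coset_step V) w {[]} (translate w {[]})" by (rule reads_coset_step)
  moreover have "translate w {[]} = {w}"
    using red_reduced[OF assms(1)] by (simp add: translate_def red_def)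
  ultimately show ?thesis by simp
qed

text \<open>A power of \<open>b\<close> crosses no \<open>a\<close>-edge, so the equivalent power of
  \<open>a\<close> crosses every set of \<open>a\<close>-edges evenly. For the
  \<open>a\<close>-edges on the boundary of the class of the empty word this yields triviality
  already for \<open>E\<close>. Hence \<open>a\<close>-cycles and \<open>b\<close>-cycles of the
  refined graph share at most one vertex.\<close>

lemma even_refinement_cyclic:
  assumes "word_congruence E" "a \<noteq> b"
    and ev: "even_refinement E (replicate i (a, True)) (replicate j (b, True))"
  shows "even_refinement E (replicate i (a, True)) []"
proof -
  interpret word_congruence E by fact
  have only: "\<not> crosses T (replicate i (a, True)) []"
    if "edge_invariant E T" "\<And>h c. T h c \<Longrightarrow> c = a" for T
  proof -
    have "\<not> crosses T (replicate j (b, True)) []" for j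
      using that(2) assms(2) by (induction j) (auto simp: letter_edge_def)
    then show ?thesis using ev that(1) by (auto simp: even_refinement_def)
  qed
  have "\<not> crosses T (replicate i (a, True)) []" if T: "edge_invariant E T" for T
  proof -
    let ?T = "\<lambda>h c. T h c \<and> c = a"
    have "crosses ?T (replicate k (a, True)) [] = crosses T (replicate k (a, True)) []" for k
      by (induction k) (auto simp: letter_edge_def)
    moreover have "\<not> crosses ?T (replicate i (a, True)) []"
      using T by (intro only) (auto simp: edge_invariant_def)
    ultimately show ?thesis by simp
  qed
  moreover have "E (replicate i (a, True)) []"
  proof -
    let ?R = "\<lambda>h. E h []"
    let ?T = "\<lambda>h c. ?R h \<noteq> ?R ((a, True) # h) \<and> c = a"
    have R: "?R g = ?R h" if "E g h" for g h using that sym trans by metis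
    have "?T g c = ?T h c" if "E g h" for g h c
      using R[OF that] R[OF app_Cons[OF that], of "(a, True)"] by simp
    then have "edge_invariant E ?T" unfolding edge_invariant_def by blast
    then have "\<not> crosses ?T (replicate i (a, True)) []" by (rule only) simp
    moreover have "crosses ?T (replicate k (a, True)) [] = (?R [] \<noteq> ?R (replicate k (a, True)))" for k
      by (induction k) (auto simp: letter_edge_def)
    ultimately show ?thesis by simp
  qed
  ultimately show ?thesis by (simp add: even_refinement_def)
qed

lemma alternating_hom:
  assumes \<pi>: "\<And>c. c \<in> A \<Longrightarrow> \<pi> c \<in> carrier (alt_group n)"
    and gen: "carrier (alt_group n) \<subseteq> foldr (letter_act \<pi>) ` lists (letters A)"
  shows "\<exists>\<phi>\<in>hom (free_group A) (alt_group n). \<phi> ` carrier (free_group A) = carrier (alt_group n) \<and>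
    (\<forall>u\<in>lists (letters A). \<phi> (red u) = foldr (letter_act \<pi>) u)"
proof -
  let ?L = "lists (letters A)"
  \<comment> \<open>Letters outside \<open>A\<close> act as the identity, so that every word acts by
    an even permutation.\<close>
  define \<rho> where "\<rho> c = (if c \<in> A then \<pi> c else id)" for c
  define \<phi> where "\<phi> u = foldr (letter_act \<rho>) u" for u
  have \<rho>: "\<rho> c \<in> carrier (alt_group n)" for c
    using \<pi> by (simp add: \<rho>_def alt_group_carrier permutes_id)
  then have "\<rho> c permutes {1..n}" for c by (simp add: alt_group_carrier)
  then have "bij (\<rho> c)" for c using permutes_bij by blast
  then interpret word_congruence "\<lambda>u v. \<forall>y. \<phi> u y = \<phi> v y"
    unfolding \<phi>_def by (rule word_congruence_action)
  have red: "\<phi> (red u) = \<phi> u" for u using E_red by blast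
  have app: "\<phi> (u @ v) = \<phi> u \<circ> \<phi> v" for u v by (simp add: \<phi>_def fun_eq_iff)
  have \<phi>: "\<phi> u = foldr (letter_act \<pi>) u" if "u \<in> ?L" for u
    unfolding \<phi>_def using that
  proof (induction u)
    case (Cons x u)
    then have "fst x \<in> A" by (auto simp: fst_letters)
    then have "letter_act \<rho> x = letter_act \<pi> x" by (simp add: fun_eq_iff letter_act_def \<rho>_def)
    then show ?case using Cons by simp
  qed simp
  interpret alt: group "alt_group n" by (rule alt_group_is_group)
  have "letter_act \<rho> x \<in> carrier (alt_group n)" for x
    using \<rho> alt_group_inv_closed by (simp add: letter_act_def)
  note letter = this
  have car: "\<phi> u \<in> carrier (alt_group n)" for u
  proof (induction u)
    case Nil
    then show ?case using alt.one_closed by (simp add: \<phi>_def alt_group_one id_def)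
  next
    case (Cons x u)
    have "\<phi> (x # u) = letter_act \<rho> x \<otimes>\<^bsub>alt_group n\<^esub> \<phi> u"
      by (simp only: \<phi>_def foldr.simps alt_group_mult)
    then show ?case using alt.m_closed[OF letter Cons] by metis
  qed
  have "\<phi> \<in> hom (free_group A) (alt_group n)"
  proof (rule homI)
    fix u v assume "v \<in> carrier (free_group A)"
    then show "\<phi> (u \<otimes>\<^bsub>free_group A\<^esub> v) = \<phi> u \<otimes>\<^bsub>alt_group n\<^esub> \<phi> v"
      by (simp add: carrier_free_group mult_free_group red app alt_group_mult)
  qed (rule car)
  moreover have "\<phi> ` carrier (free_group A) = carrier (alt_group n)"
  proof
    show "\<phi> ` carrier (free_group A) \<subseteq> carrier (alt_group n)" using car by blast
    show "carrier (alt_group n) \<subseteq> \<phi> ` carrier (free_group A)"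
    proof
      fix g assume "g \<in> carrier (alt_group n)"
      then obtain u where u: "u \<in> ?L" "g = foldr (letter_act \<pi>) u" using gen by blast
      then have "g = \<phi> (red u)" using \<phi> red by simp
      moreover have "red u \<in> carrier (free_group A)"
        using red_in_lists[OF u(1)] by (simp add: carrier_free_group)
      ultimately show "g \<in> \<phi> ` carrier (free_group A)" by blast
    qed
  qed
  ultimately show ?thesis using \<phi> red by metis
qed

text \<open>The Cayley graph of \<open>F/E\<close> is enlarged at the vertex \<open>x\<close> to a transitive action that generates
  an alternating group; the paths that avoid \<open>x\<close> are not affected.\<close>

lemma alternating_quotient:
  fixes E :: "'a letter list \<Rightarrow> 'a letter list \<Rightarrow> bool"
  assumes A: "finite A" "card A \<ge> 2" and E0: "word_congruence E" "finite_index A E"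
    and x: "x \<in> lists (letters A)"
  defines "E' \<equiv> even_refinement E"
  shows "\<exists>n\<ge>N. \<exists>\<phi>\<in>hom (free_group A) (alt_group n).
    \<phi> ` carrier (free_group A) = carrier (alt_group n) \<and>
    (\<forall>u v. u \<in> lists (letters A) \<longrightarrow> v \<in> lists (letters A) \<longrightarrow>
       (\<forall>r s. u = r @ s \<or> v = r @ s \<longrightarrow> \<not> E' s x) \<longrightarrow>
       \<phi> (red u) = \<phi> (red v) \<longrightarrow> E' u v)"
proof -
  note [simp del] = in_lists_conv_set
  let ?L = "lists (letters A)"
  interpret word_congruence E'
    unfolding E'_def by (rule word_congruence.word_congruence_even[OF E0(1)])
  define m where "m = card (congruence_class E' ` ?L)"
  have "finite (congruence_class E' ` ?L)"
    using word_congruence.finite_index_even_refinement[OF E0(1) A(1) E0(2)]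
    unfolding E'_def finite_index_def .
  moreover have "card (congruence_class E' ` ?L) = card {1..m}" unfolding m_def by simp
  ultimately have "\<exists>\<beta>. bij_betw \<beta> (congruence_class E' ` ?L) {1..m}"
    using finite_same_card_bij finite_atLeastAtMost by blast
  then obtain \<beta> where \<beta>: "bij_betw \<beta> (congruence_class E' ` ?L) {1..m}" ..
  define num where "num u = \<beta> (congruence_class E' u)" for u
  have num_eq: "num u = num v \<longleftrightarrow> E' u v" if "u \<in> ?L" "v \<in> ?L" for u v
    unfolding num_def
    using inj_on_eq_iff[OF bij_betw_imp_inj_on[OF \<beta>] imageI imageI, OF that]
    by (simp only: congruence_class_eq_iff)
  have num_img: "num ` ?L = {1..m}"
    using bij_betw_imp_surj_on[OF \<beta>] unfolding num_def by (simp only: image_image)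
  define rep where "rep y = inv_into ?L num y" for y
  have rep: "rep y \<in> ?L" "num (rep y) = y" if "y \<in> {1..m}" for y
    using inv_into_into[of y num ?L] f_inv_into_f[of y num ?L] that num_img
    unfolding rep_def by blast+
  \<comment> \<open>Left multiplication by a generator on the numbered classes.\<close>
  define \<sigma> where "\<sigma> c y = (if y \<in> {1..m} then num ((c, True) # rep y) else y)" for c y
  have cons: "(c, b) # u \<in> ?L" if "c \<in> A" "u \<in> ?L" for c b u
    using that by (simp add: letters_def)
  have num_mem: "num u \<in> {1..m}" if "u \<in> ?L" for u using that num_img by blast
  have \<sigma>_num: "\<sigma> c (num u) = num ((c, True) # u)" if "c \<in> A" "u \<in> ?L" for c u
  proof -
    have "E' (rep (num u)) u" using rep[OF num_mem[OF that(2)]] num_eq that(2) by blast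
    then have "E' ((c, True) # rep (num u)) ((c, True) # u)" by (rule app_Cons)
    then show ?thesis
      using num_mem[OF that(2)] num_eq cons that rep(1) by (simp add: \<sigma>_def)
  qed
  have \<sigma>: "\<sigma> c permutes {1..m}" if c: "c \<in> A" for c
  proof (rule bij_imp_permutes)
    have "\<sigma> c ` {1..m} \<subseteq> {1..m}"
      proof -
      have "\<sigma> c (num u) \<in> num ` ?L" if "u \<in> ?L" for u
        using \<sigma>_num[OF c that] cons[OF c that] by (metis imageI)
      then show ?thesis unfolding num_img[symmetric] by blast
    qed
    moreover have "inj_on (\<sigma> c) {1..m}"
      unfolding num_img[symmetric]
    proof (rule inj_onI, elim imageE)
      fix y z u v assume "\<sigma> c y = \<sigma> c z" "y = num u" "z = num v" "u \<in> ?L" "v \<in> ?L"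
      then have "E' ((c, True) # u) ((c, True) # v)"
        using \<sigma>_num[OF c] num_eq cons[OF c] by metis
      then have "E' (letter_inv (c, True) # (c, True) # u) (letter_inv (c, True) # (c, True) # v)"
        by (rule app_Cons)
      then have "E' u v" by (rule trans[OF sym[OF cancel_Cons(2)] trans[OF _ cancel_Cons(2)]])
      then show "y = z" using \<open>y = num u\<close> \<open>z = num v\<close> \<open>u \<in> ?L\<close> \<open>v \<in> ?L\<close> num_eq by blast
    qed
    ultimately show "bij_betw (\<sigma> c) {1..m} {1..m}"
      by (simp add: bij_betw_def endo_inj_surj[OF finite_atLeastAtMost])
  qed (auto simp: \<sigma>_def)
  have act: "letter_act \<sigma> l (num u) = num (l # u)" if "l \<in> letters A" "u \<in> ?L" for l u
  proof (cases "snd l")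
    case True
    then have "l = (fst l, True)" by (simp add: prod_eq_iff)
    then show ?thesis using True \<sigma>_num[OF fst_letters[OF that(1)] that(2)] by (simp add: letter_act_def)
  next
    case False
    then have l: "letter_inv l = (fst l, True)" by (simp add: letter_inv_def)
    have lu: "l # u \<in> ?L" using that by simp
    have "\<sigma> (fst l) (num (l # u)) = num (letter_inv l # l # u)"
      using \<sigma>_num[OF fst_letters[OF that(1)] lu] l by simp
    also have "\<dots> = num u" using num_eq lu that cancel_Cons(2) by simp
    finally show ?thesis
      using False permutes_inverses(2)[OF \<sigma>[OF fst_letters[OF that(1)]]]
      by (metis letter_act_def)
  qed
  have word: "foldr (letter_act \<sigma>) u (num v) = num (u @ v)" if "u \<in> ?L" "v \<in> ?L" for u v
    using that by (induction u) (simp_all add: act)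
  obtain a b where ab: "a \<in> A" "b \<in> A" "a \<noteq> b"
    using A by (metis card_le_Suc0_iff_eq not_less_eq_eq numeral_2_eq_2)
  have pow: "(\<sigma> c ^^ i) (num x) = num (replicate i (c, True) @ x)" if "c \<in> A" for c i
  proof -
    have "replicate i (c, True) \<in> ?L" using that by (auto simp: letters_def in_lists_conv_set)
    from word[OF this x] show ?thesis by simp
  qed
  have "\<exists>u\<in>?L. foldr (letter_act \<sigma>) u (num x) = y" if "y \<in> {1..m}" for y
  proof -
    have "E' ((rep y @ inv_word x) @ x) (rep y)"
      using app_left[OF inv_left[of x], of "rep y"] by simp
    moreover have L: "rep y @ inv_word x \<in> ?L" using rep[OF that] x by simp
    moreover from this have "(rep y @ inv_word x) @ x \<in> ?L" using x by simp
    ultimately have "num ((rep y @ inv_word x) @ x) = y" using num_eq rep[OF that] by metis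
    then show ?thesis using word[OF L x] L by metis
  qed
  \<comment> \<open>The disjointness needed for the insertion; it holds because \<open>E'\<close> is
    a parity refinement.\<close>
  moreover have "(\<sigma> a ^^ i) (num x) = num x" if "(\<sigma> a ^^ i) (num x) = (\<sigma> b ^^ j) (num x)" for i j
  proof -
    let ?a = "replicate i (a, True)" and ?b = "replicate j (b, True)"
    have L: "?a \<in> ?L" "?b \<in> ?L" using ab by (auto simp: letters_def in_lists_conv_set)
    have "E' (?a @ x) (?b @ x)"
      using that pow ab num_eq L x by (metis append_in_lists_conv)
    then have "E' ?a ((?b @ x) @ inv_word x)" by (simp add: right_inv_iff)
    then have "E' ?a ?b" using app_left[OF inv_right[of x], of ?b] trans by fastforce
    then have "E' ?a []"
      unfolding E'_def by (rule even_refinement_cyclic[OF E0(1) ab(3)])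
    then have "E' (?a @ x) x" using app_right by fastforce
    then show ?thesis using pow[OF ab(1)] num_eq L x by (metis append_in_lists_conv)
  qed
  ultimately obtain n \<pi> where n: "n \<ge> N" "m \<le> n" and \<pi>: "\<And>c. c \<in> A \<Longrightarrow> \<pi> c \<in> carrier (alt_group n)"
    "carrier (alt_group n) \<subseteq> foldr (letter_act \<pi>) ` ?L"
    "\<And>c y. c \<in> A \<Longrightarrow> y \<in> {1..m} \<Longrightarrow> y \<noteq> num x \<Longrightarrow> \<pi> c y = \<sigma> c y"
    using alternating_extension[where \<sigma> = \<sigma> and m = m and x = "num x" and N = N, OF \<sigma> ab num_mem[OF x]]
    by metis
  obtain \<phi> where \<phi>: "\<phi> \<in> hom (free_group A) (alt_group n)"
    "\<phi> ` carrier (free_group A) = carrier (alt_group n)"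
    "\<And>u. u \<in> ?L \<Longrightarrow> \<phi> (red u) = foldr (letter_act \<pi>) u"
    using alternating_hom[OF \<pi>(1,2)] by blast
  \<comment> \<open>Reading \<open>u\<close> visits its suffixes, none of which is \<open>x\<close>.
    Both ends of every edge matter, since an inverse letter uses the transition at its
    endpoint.\<close>
  have path: "foldr (letter_act \<pi>) u (num []) = num u"
    if "u \<in> ?L" "\<And>r s. u = r @ s \<Longrightarrow> \<not> E' s x" for u
    using that
  proof (induction u)
    case (Cons l u)
    then have l: "l \<in> letters A" and u: "u \<in> ?L" and lu: "l # u \<in> ?L" by auto
    have IH: "foldr (letter_act \<pi>) u (num []) = num u"
      using Cons.prems(1)[of "l # r" s for r s] by (intro Cons.IH) simp
    have ne: "num u \<noteq> num x" "num (l # u) \<noteq> num x"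
      using Cons.prems(1)[of "[l]" u] Cons.prems(1)[of "[]" "l # u"] num_eq u lu x by auto
    have "letter_act \<pi> l (num u) = num (l # u)"
    proof (cases "snd l")
      case True
      then show ?thesis
        using \<pi>(3)[OF fst_letters[OF l] num_mem[OF u] ne(1)] act[OF l u] by (simp add: letter_act_def)
    next
      case False
      have "\<sigma> (fst l) (num (l # u)) = num u"
        using act[OF l u] False permutes_inverses(1)[OF \<sigma>[OF fst_letters[OF l]]]
        by (metis letter_act_def)
      then have "\<pi> (fst l) (num (l # u)) = num u"
        using \<pi>(3)[OF fst_letters[OF l] num_mem[OF lu] ne(2)] by simp
      moreover have "\<pi> (fst l) permutes {1..n}"
        using \<pi>(1)[OF fst_letters[OF l]] by (simp add: alt_group_carrier)
      ultimately show ?thesis using False permutes_inverses(2) by (metis letter_act_def)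
    qed
    then show ?case using IH by simp
  qed simp
  have "E' u v" if "u \<in> ?L" "v \<in> ?L" "\<forall>r s. u = r @ s \<or> v = r @ s \<longrightarrow> \<not> E' s x"
    "\<phi> (red u) = \<phi> (red v)" for u v
    using path[OF that(1)] path[OF that(2)] that(3,4) \<phi>(3)[OF that(1)] \<phi>(3)[OF that(2)]
      num_eq[OF that(1,2)] by metis
  then show ?thesis using n(1) \<phi>(1,2) by blast
qed

lemma finitely_generated_imp_subgroup:
  assumes "finitely_generated_subgroup (free_group A) H"
  shows "subgroup H (free_group A)" "H \<subseteq> lists (letters A)" "H \<subseteq> Collect reduced_word" "[] \<in> H"
proof -
  show H: "subgroup H (free_group A)"
    using assms group.generate_is_subgroup[OF group_free_group]
    unfolding finitely_generated_subgroup_def by blast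
  show "H \<subseteq> lists (letters A)" "H \<subseteq> Collect reduced_word"
    using subgroup.subset[OF H] carrier_free_group by blast+
  show "[] \<in> H" using subgroup.one_closed[OF H] by (simp add: free_group_simps)
qed

lemma translate_singleton: "translate u {v} = {foldr push_letter u v}"
  by (simp add: translate_def)

lemma list_all2_snoc_split:
  "list_all2 P qs (sts @ [st]) \<Longrightarrow> \<exists>qs' q. qs = qs' @ [q] \<and> list_all2 P qs' sts \<and> P q st"
  by (auto simp: list_all2_append2 list_all2_Cons2)

text \<open>The vertex \<open>x\<close> has to be missed by the path of \<open>w\<close> and by
  those of all factorisations of elements of the product, infinitely many at once. The polygon
  property reduces this to the choice of a single element of the free group.\<close>

theorem alternating_separation:
  assumes A: "finite A" "card A \<ge> 2"
    and Hs: "\<And>H. H \<in> set Hs \<Longrightarrow> finitely_generated_subgroup (free_group A) H \<and> infinite_index A H"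
    and w: "w \<in> carrier (free_group A)" "w \<notin> product_set (free_group A) Hs"
  shows "\<exists>n\<ge>N. \<exists>\<phi>\<in>hom (free_group A) (alt_group n).
    \<phi> ` carrier (free_group A) = carrier (alt_group n) \<and> \<phi> w \<notin> \<phi> ` product_set (free_group A) Hs"
proof -
  note [simp del] = in_lists_conv_set
  let ?F = "free_group A" and ?L = "lists (letters A)"
  have fg: "H \<subseteq> ?L" "H \<subseteq> Collect reduced_word" "[] \<in> H" if "H \<in> set Hs" for H
    using finitely_generated_imp_subgroup Hs[OF that] by blast+
  have wL: "w \<in> ?L" and wr: "reduced_word w" using w(1) by (simp_all add: carrier_free_group)
  have "\<forall>H\<in>set Hs. \<exists>V. finite V \<and> H \<in> V \<and> V \<subseteq> (\<lambda>u. translate u H) ` ?L \<and>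
      (\<forall>h\<in>H. reads (coset_step V) h H H)"
    using finitely_generated_imp_coset_automaton Hs by blast
  from bchoice[OF this] obtain VH where VH: "\<forall>H\<in>set Hs. finite (VH H) \<and> H \<in> VH H \<and>
      VH H \<subseteq> (\<lambda>u. translate u H) ` ?L \<and> (\<forall>h\<in>H. reads (coset_step (VH H)) h H H)" ..
  define V where "V = (\<Union>H\<in>set Hs. VH H) \<union> suffix_states w"
  have suffix: "\<exists>u\<in>?L. C = translate u {[]} \<and> reduced_word u"
    if "C \<in> suffix_states v" "v \<in> ?L" "reduced_word v" for C v
  proof -
    obtain n where n: "C = {drop n v}" using \<open>C \<in> suffix_states v\<close> unfolding suffix_states_def by blast
    have "reduced_word (drop n v)" "drop n v \<in> ?L"
      using that(2,3) append_take_drop_id[of n v] by (metis reduced_append, metis append_in_lists_conv)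
    then show ?thesis
      using n by (intro bexI[of _ "drop n v"]) (simp_all add: translate_singleton foldr_push_Nil)
  qed
  obtain a where a: "a \<in> A" using A(2) by fastforce
  have triv: "{[]} \<subseteq> Collect reduced_word" by simp
  have V_tr: "\<exists>u\<in>?L. \<exists>H\<subseteq>Collect reduced_word. C = translate u H \<and> infinite_index A H" if "C \<in> V" for C
    using that unfolding V_def
  proof
    assume "C \<in> (\<Union>H\<in>set Hs. VH H)"
    then obtain H where H: "H \<in> set Hs" "C \<in> VH H" by blast
    then obtain u where "u \<in> ?L" "C = translate u H" using VH by blast
    then show ?thesis using fg(2)[OF H(1)] Hs[OF H(1)] by blast
  next
    assume "C \<in> suffix_states w"
    from suffix[OF this wL wr] obtain u where "u \<in> ?L" "C = translate u {[]}" by blast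
    then show ?thesis using infinite_index_trivial[OF a] triv by blast
  qed
  interpret V: coset_automaton V A
  proof
    show fin: "finite V" using VH by (simp add: V_def suffix_states_def)
    show "\<Union>V \<subseteq> Collect reduced_word" using V_tr translate_reduced by blast
    show "escapable A V" using fin V_tr by (rule escapableI)
  qed
  have nil_V: "{[]} \<in> V" unfolding V_def suffix_states_def by force
  then have "V \<noteq> {}" by blast
  then obtain x where x: "x \<in> carrier ?F" "length w < length x"
    "\<And>gs. length gs \<le> Suc (length Hs) \<Longrightarrow> \<forall>g\<in>set gs. readable V g \<Longrightarrow> red (concat gs) \<noteq> x"
    using V.avoiding_element[OF A(2), of "length w" "Suc (length Hs)"] by blast
  have xL: "x \<in> ?L" and xr: "reduced_word x" using x(1) by (simp_all add: carrier_free_group)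
  \<comment> \<open>The path of \<open>x\<close> gets states of its own, so that replacements of the
    other sides remain readable in \<open>V\<close>.\<close>
  define W where "W b = (if b then suffix_states x else V)" for b
  have W_reduced: "\<Union>(W b) \<subseteq> Collect reduced_word" for b
    using V.V_reduced suffix[OF _ xL xr] translate_reduced[OF triv] unfolding W_def by (cases b) force+
  interpret T: inverse_automaton "tagged_step W"
    using W_reduced by (intro inverse_automaton_tagged_step inverse_automaton_coset_step)
  let ?r = "\<lambda>q (s, t). reads (tagged_step W) q s t"
  have "finite (UNIV \<times> (V \<union> suffix_states x) :: (bool \<times> 'a letter list set) set)"
    using V.finite_V by (simp add: suffix_states_def)
  moreover have "s \<in> UNIV \<times> (V \<union> suffix_states x) \<and> t \<in> UNIV \<times> (V \<union> suffix_states x)"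
    if "tagged_step W l s t" for l s t
    using that by (auto simp: tagged_step_def coset_step_def W_def mem_Times_iff split: if_splits)
  \<comment> \<open>At most \<open>length Hs + 1\<close> sides for a path that is to avoid
    \<open>x\<close>, and one side for \<open>x\<close> itself.\<close>
  ultimately obtain E where E: "word_congruence E" "finite_index A E"
    "\<And>ps sts. length sts \<le> length Hs + 2 \<Longrightarrow> list_all2 ?r ps sts \<Longrightarrow> E (concat ps) [] \<Longrightarrow>
       \<exists>qs. list_all2 ?r qs sts \<and> red (concat qs) = []"
    using T.separating_congruence[OF _ _ A(1), of _ "length Hs + 2"] by (smt (verit))
  interpret E: word_congruence E by (rule E(1))
  have inv: "red u = v" if "red (u @ q) = []" "foldr push_letter q v = []" "reduced_word v" for u q v
  proof -
    have "red (q @ v) = []" using that(2,3) by (metis foldr_push_red red_reduced)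
    then have "red u = red (u @ red (q @ v))" by simp
    also have "\<dots> = red (red (u @ q) @ v)" by simp
    finally show ?thesis using that(1,3) by (simp add: red_reduced)
  qed
  \<comment> \<open>A path that meets \<open>x\<close> closes up with the inverse of
    \<open>x\<close>. The latter side can be replaced only by words with the same value in the free
    group, so \<open>x\<close> would be a product of few readable words.\<close>
  have avoid: "\<not> E (concat ps) x"
    if ps: "list_all2 (\<lambda>p (s, t). s \<in> V \<and> reads (coset_step V) p s t) ps sts"
      and len: "length sts \<le> Suc (length Hs)" for ps sts
  proof
    assume "E (concat ps) x"
    let ?tag = "\<lambda>(s, t). ((False, s), (False, t))"
    have "reads (coset_step (W True)) x {[]} {x}"
      using xr by (intro reads_suffix_states) (simp_all add: W_def)
    then have "reads (tagged_step W) x (True, {[]}) (True, {x})" by (simp add: reads_tagged_step)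
    then have "reads (tagged_step W) (inv_word x) (True, {x}) (True, {[]})" by (rule T.reads_inv)
    moreover have "list_all2 ?r ps (map ?tag sts)"
      unfolding list_all2_map2
      by (rule list_all2_mono[OF ps]) (auto simp: reads_tagged_step W_def)
    ultimately have all2: "list_all2 ?r (ps @ [inv_word x]) (map ?tag sts @ [((True, {x}), (True, {[]}))])"
      by (simp add: list_all2_appendI)
    have "E (concat (ps @ [inv_word x])) []"
      using \<open>E (concat ps) x\<close> E.right_inv_iff[of "concat ps" "inv_word x" "[]"] by simp
    with E(3)[OF _ all2] len obtain qs where
      "list_all2 ?r qs (map ?tag sts @ [((True, {x}), (True, {[]}))])" "red (concat qs) = []"
      by auto
    from list_all2_snoc_split[OF this(1)] this(2) obtain gs q where q: "list_all2 ?r gs (map ?tag sts)"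
      "reads (tagged_step W) q (True, {x}) (True, {[]})" "red (concat gs @ q) = []"
      by auto
    have "reads (coset_step (W True)) q {x} {[]}" using q(2) by (simp add: reads_tagged_step)
    then have "{[]} = translate q {x}" using reads_coset_step_imp by blast
    then have "red (concat gs) = x" using inv[OF q(3) _ xr] by (simp add: translate_singleton)
    moreover have "length gs \<le> Suc (length Hs)" using list_all2_lengthD[OF q(1)] len by simp
    moreover have "readable V g" if g: "g \<in> set gs" for g
    proof -
      obtain i where i: "i < length gs" "g = gs ! i" using g by (auto simp: in_set_conv_nth)
      then have "i < length sts" using list_all2_lengthD[OF q(1)] by simp
      moreover obtain s t where st: "sts ! i = (s, t)" by fastforce
      ultimately have "s \<in> V" "reads (tagged_step W) g (False, s) (False, t)"
        using list_all2_nthD2[OF ps, of i] list_all2_nthD[OF q(1) i(1)] i(2) by auto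
      then show ?thesis unfolding readable_def by (auto simp: reads_tagged_step W_def)
    qed
    ultimately show False using x(3) by blast
  qed
  have rH: "reads (coset_step V) h H H" "H \<in> V" if "H \<in> set Hs" "h \<in> H" for h H
  proof -
    have VH': "H \<in> VH H" "reads (coset_step (VH H)) h H H" using VH that by blast+
    have sub: "VH H \<subseteq> V" using that(1) unfolding V_def by blast
    show "reads (coset_step V) h H H" using sub VH'(2) by (rule reads_coset_step_mono)
    show "H \<in> V" using sub VH'(1) by blast
  qed
  have rw: "reads (coset_step V) w {[]} {w}"
    using wr by (rule reads_suffix_states) (simp add: V_def)
  have avoid_w: "\<not> even_refinement E s x" if split: "w = r @ s" for r s
  proof -
    obtain C where "reads (coset_step V) s {[]} C"
      using rw split by (auto simp: V.reads_append)
    then have "\<not> E (concat [s]) x" using nil_V by (intro avoid[of _ "[({[]}, C)]"]) simp_all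
    then show ?thesis by (simp add: even_refinement_def)
  qed
  \<comment> \<open>The path stops inside one of the factors; the part of it already read is a run
    from the state \<open>H\<close>, the factors before it in reading order are loops.\<close>
  have avoid_hs: "\<not> even_refinement E s x"
    if hs: "list_all2 (\<in>) hs Hs" and "concat hs = r @ s" for hs r s
  proof (cases "hs = []")
    case True
    then have "\<not> E (concat []) x" by (intro avoid[of _ "[]"]) simp_all
    then show ?thesis using True \<open>concat hs = r @ s\<close> by (simp add: even_refinement_def)
  next
    case False
    then obtain hs1 r' s' hs2 where split: "hs = hs1 @ (r' @ s') # hs2" "s = s' @ concat hs2"
      using concat_eq_appendD[OF \<open>concat hs = r @ s\<close>] by blast
    then obtain Hs1 H Hs2 where Hs_split: "Hs = Hs1 @ H # Hs2" "r' @ s' \<in> H" "list_all2 (\<in>) hs2 Hs2"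
      using hs by (auto simp: list_all2_append1 list_all2_Cons1)
    then obtain C where C: "reads (coset_step V) s' H C" "H \<in> V"
      using rH[of H "r' @ s'"] by (auto simp: V.reads_append)
    have "list_all2 (\<lambda>p (s, t). s \<in> V \<and> reads (coset_step V) p s t) hs2 (map (\<lambda>H. (H, H)) Hs2)"
      unfolding list_all2_map2 using Hs_split rH
      by (intro list.rel_mono_strong[OF Hs_split(3)]) auto
    then have "\<not> E (concat (s' # hs2)) x"
      using C Hs_split(1) by (intro avoid[of _ "(H, C) # map (\<lambda>H. (H, H)) Hs2"]) simp_all
    then show ?thesis using split(2) by (simp add: even_refinement_def)
  qed
  obtain n \<phi> where n: "n \<ge> N" and \<phi>: "\<phi> \<in> hom ?F (alt_group n)" "\<phi> ` carrier ?F = carrier (alt_group n)"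
    "\<And>u v. u \<in> ?L \<Longrightarrow> v \<in> ?L \<Longrightarrow> (\<forall>r s. u = r @ s \<or> v = r @ s \<longrightarrow> \<not> even_refinement E s x) \<Longrightarrow>
       \<phi> (red u) = \<phi> (red v) \<Longrightarrow> even_refinement E u v"
    using alternating_quotient[OF A E(1,2) xL, of N] by blast
  have prod: "g \<in> product_set ?F Hs \<longleftrightarrow> (\<exists>hs. list_all2 (\<in>) hs Hs \<and> g = red (concat hs))" for g
    using fg(2) by (intro product_set_iff) blast
  have "\<phi> w \<notin> \<phi> ` product_set ?F Hs"
  proof
    assume "\<phi> w \<in> \<phi> ` product_set ?F Hs"
    then obtain hs where hs: "list_all2 (\<in>) hs Hs" "\<phi> (red w) = \<phi> (red (concat hs))"
      using prod red_reduced[OF wr] by auto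
    have "h \<in> ?L" if "h \<in> set hs" for h
      using hs(1) that fg(1) by (metis list_all2_nthD2 list_all2_lengthD in_set_conv_nth nth_mem subsetD)
    then have "concat hs \<in> ?L" by (auto simp: in_lists_conv_set)
    then have "even_refinement E w (concat hs)"
      using \<phi>(3)[OF wL _ _ hs(2)] avoid_w avoid_hs[OF hs(1)] by blast
    then have "E (concat hs) w" using E.sym by (simp add: even_refinement_def)
    then have "E (concat (hs @ [inv_word w])) []"
      using E.right_inv_iff[of "concat hs" "inv_word w" "[]"] by simp
    moreover have "reads (tagged_step W) (inv_word w) (False, {w}) (False, {[]})"
      using rw by (intro T.reads_inv) (simp add: reads_tagged_step W_def)
    moreover have "list_all2 ?r hs (map (\<lambda>H. ((False, H), (False, H))) Hs)"
      unfolding list_all2_map2 using rH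
      by (intro list.rel_mono_strong[OF hs(1)]) (auto simp: reads_tagged_step W_def)
    ultimately obtain qs where
      "list_all2 ?r qs (map (\<lambda>H. ((False, H), (False, H))) Hs @ [((False, {w}), (False, {[]}))])"
      "red (concat qs) = []"
      using E(3)[of "map (\<lambda>H. ((False, H), (False, H))) Hs @ [((False, {w}), (False, {[]}))]"
          "hs @ [inv_word w]"]
      by (auto simp: list_all2_appendI)
    from list_all2_snoc_split[OF this(1)] this(2) obtain gs q where
      q: "list_all2 ?r gs (map (\<lambda>H. ((False, H), (False, H))) Hs)"
      "reads (tagged_step W) q (False, {w}) (False, {[]})" "red (concat gs @ q) = []"
      by auto
    have "reads (coset_step V) q {w} {[]}" using q(2) by (simp add: reads_tagged_step W_def)
    then have "{[]} = translate q {w}" using reads_coset_step_imp by blast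
    then have w_eq: "red (concat gs) = w" using inv[OF q(3) _ wr] by (simp add: translate_singleton)
    \<comment> \<open>\<open>H\<close> contains the empty word, so a loop at the state
      \<open>H\<close> reduces to an element of \<open>H\<close>.\<close>
    have gH: "red g \<in> H" if "reads (coset_step V) g H H" "H \<in> set Hs" for g H
    proof -
      have "H = translate g H" using reads_coset_step_imp that(1) by blast
      moreover have "foldr push_letter g [] \<in> translate g H"
        using fg(3)[OF that(2)] unfolding translate_def by (rule imageI)
      ultimately show ?thesis by (simp add: red_def)
    qed
    have "list_all2 (\<in>) (map red gs) Hs"
      using q(1) unfolding list_all2_map2 list_all2_map1
      by (rule list.rel_mono_strong) (auto simp: reads_tagged_step W_def intro: gH)
    moreover have "red (concat (map red gs)) = red (concat gs)"
    proof (induction gs)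
      case (Cons g gs)
      then show ?case by (metis concat.simps(2) list.simps(9) red_append red_red_append(1))
    qed simp
    ultimately show False using w(2) prod w_eq by metis
  qed
  then show ?thesis using n \<phi>(1,2) by blast
qed

section \<open>The sequence of normal subgroups and the product theorem\<close>

lemma concat_in_lists:
  "list_all2 (\<in>) hs Hs \<Longrightarrow> \<forall>H\<in>set Hs. H \<subseteq> lists B \<Longrightarrow> concat hs \<in> lists B"
proof (induction rule: list_all2_induct)
  case (Cons h hs H Hs)
  then have "h \<in> lists B" "concat hs \<in> lists B" by (auto simp del: in_lists_conv_set)
  then show ?case unfolding concat.simps append_in_lists_conv ..
qed simp

lemma surjective_hom_quotient:
  assumes "group G" "group K" "\<phi> \<in> hom G K" "\<phi> ` carrier G = carrier K"
  shows "kernel G K \<phi> \<lhd> G" "G Mod kernel G K \<phi> \<cong> K"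
proof -
  interpret group_hom G K \<phi> using assms by (simp add: group_hom_def group_hom_axioms_def)
  show "kernel G K \<phi> \<lhd> G" by (rule normal_kernel)
  show "G Mod kernel G K \<phi> \<cong> K" using assms(4) by (rule FactGroup_iso)
qed

text \<open>Supplies the degrees that no separation task claims.\<close>

lemma alternating_quotient_exists:
  assumes "card A \<ge> 2" "n \<ge> 5"
  shows "\<exists>M. M \<lhd> free_group A \<and> free_group A Mod M \<cong> alt_group n"
proof -
  obtain a b where ab: "a \<in> A" "b \<in> A" "a \<noteq> b"
    using assms(1) by (metis card.infinite card_le_Suc0_iff_eq not_less_eq_eq numeral_2_eq_2 zero_le)
  obtain \<pi> where \<pi>: "\<forall>c\<in>A. \<pi> c \<in> carrier (alt_group n)"
    "carrier (alt_group n) \<subseteq> foldr (letter_act \<pi>) ` lists (letters A)"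
    using alternating_two_generators[OF assms(2) ab] by blast
  obtain \<phi> where "\<phi> \<in> hom (free_group A) (alt_group n)"
    "\<phi> ` carrier (free_group A) = carrier (alt_group n)"
    using alternating_hom[OF bspec[OF \<pi>(1)] \<pi>(2)] by blast
  then show ?thesis
    using surjective_hom_quotient[OF group_free_group alt_group_is_group] by blast
qed

text \<open>A single \<open>N i\<close> settles each pair \<open>(Hs, w)\<close>; intersections come
  in only with factors of finite index.\<close>

definition separating_sequence :: "'a set \<Rightarrow> (nat \<Rightarrow> 'a letter list set) \<Rightarrow> bool" where
  "separating_sequence A N \<longleftrightarrow>
     (\<forall>i\<ge>5. N i \<lhd> free_group A \<and> free_group A Mod N i \<cong> alt_group i) \<and>
     (\<forall>Hs w. (\<forall>H\<in>set Hs. finitely_generated_subgroup (free_group A) H \<and> infinite_index A H) \<longrightarrow>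
        w \<in> carrier (free_group A) \<longrightarrow> w \<notin> product_set (free_group A) Hs \<longrightarrow>
        (\<exists>i\<ge>5. (N i #>\<^bsub>free_group A\<^esub> w) \<inter> product_set (free_group A) Hs = {}))"

text \<open>There are only countably many pairs \<open>(Hs, w)\<close>, so each of them can be handled by an
  alternating group of its own degree.\<close>

lemma separating_sequence_exists:
  assumes A: "finite A" "card A \<ge> 2"
  shows "\<exists>N. separating_sequence A N"
proof -
  let ?F = "free_group A"
  define \<H> where "\<H> = {H. finitely_generated_subgroup ?F H \<and> infinite_index A H}"
  define Q where "Q = {(Hs, w). Hs \<in> lists \<H> \<and> w \<in> carrier ?F \<and> w \<notin> product_set ?F Hs}"
  have "countable (letters A)" unfolding letters_def using A(1) by (simp add: countable_finite)
  then have "countable (lists (letters A))" by (rule countable_lists)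
  moreover have "carrier ?F \<subseteq> lists (letters A)" using carrier_free_group by blast
  ultimately have cF: "countable (carrier ?F)" using countable_subset by blast
  have "\<H> \<subseteq> generate ?F ` {S. finite S \<and> S \<subseteq> carrier ?F}"
    unfolding \<H>_def finitely_generated_subgroup_def by blast
  then have "countable \<H>"
    using countable_Collect_finite_subset[OF cF] by (meson countable_image countable_subset)
  moreover have "Q \<subseteq> lists \<H> \<times> carrier ?F" unfolding Q_def by blast
  ultimately have Q: "countable Q"
    using cF by (meson countable_SIGMA countable_lists countable_subset)
  \<comment> \<open>A candidate \<open>p\<close> consists of a degree and a normal subgroup. The
    guard covers an empty \<open>Q\<close>, for which \<open>from_nat_into\<close> yields arbitrary
    values.\<close>
  define good where "good k p \<longleftrightarrow> 5 \<le> fst p \<and> snd p \<lhd> ?F \<and> ?F Mod snd p \<cong> alt_group (fst p) \<and>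
      (from_nat_into Q k \<in> Q \<longrightarrow>
        (snd p #>\<^bsub>?F\<^esub> snd (from_nat_into Q k)) \<inter> product_set ?F (fst (from_nat_into Q k)) = {})"
    for k :: nat and p
  have good: "\<exists>p. good k p \<and> d < fst p" for k d
  proof (cases "from_nat_into Q k \<in> Q")
    case False
    obtain M where "M \<lhd> ?F" "?F Mod M \<cong> alt_group (d + 5)"
      using alternating_quotient_exists[OF A(2), of "d + 5"] by auto
    then show ?thesis using False by (intro exI[of _ "(d + 5, M)"]) (simp add: good_def)
  next
    case True
    obtain Hs w where Hw: "from_nat_into Q k = (Hs, w)" by fastforce
    then have Hs: "\<And>H. H \<in> set Hs \<Longrightarrow> finitely_generated_subgroup ?F H \<and> infinite_index A H"
      and w: "w \<in> carrier ?F" "w \<notin> product_set ?F Hs"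
      using True unfolding Q_def \<H>_def by (auto simp: in_lists_conv_set)
    obtain n \<phi> where n: "n \<ge> d + 5" and \<phi>: "\<phi> \<in> hom ?F (alt_group n)"
      "\<phi> ` carrier ?F = carrier (alt_group n)" "\<phi> w \<notin> \<phi> ` product_set ?F Hs"
      using alternating_separation[OF A Hs w, of "d + 5"] by blast
    let ?M = "kernel ?F (alt_group n) \<phi>"
    have "(?M #>\<^bsub>?F\<^esub> w) \<inter> product_set ?F Hs = {}"
    proof -
      have "\<phi> (m \<otimes>\<^bsub>?F\<^esub> w) = \<phi> w" if "m \<in> ?M" for m
      proof -
        have "\<phi> w \<in> carrier (alt_group n)" using \<phi>(2) w(1) by blast
        then show ?thesis
          using that \<phi>(1) w(1) group.is_monoid[OF alt_group_is_group] monoid.l_one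
          by (simp add: kernel_def hom_mult)
      qed
      moreover have "\<phi> w \<noteq> \<phi> g" if "g \<in> product_set ?F Hs" for g using \<phi>(3) that by auto
      ultimately show ?thesis unfolding r_coset_def by fastforce
    qed
    then have "good k (n, ?M)"
      using surjective_hom_quotient[OF group_free_group alt_group_is_group \<phi>(1,2)] n Hw
      by (simp add: good_def)
    then show ?thesis using n by (intro exI[of _ "(n, ?M)"]) simp
  qed
  have "\<exists>f. \<forall>k. good k (f k) \<and> fst (f k) < fst (f (Suc k))"
  proof (rule dependent_nat_choice)
    show "\<exists>p. good 0 p" using good by blast
    show "\<exists>q. good (Suc k) q \<and> fst p < fst q" for p k using good by blast
  qed
  then obtain f where f: "\<And>k. good k (f k)" "\<And>k. fst (f k) < fst (f (Suc k))" by blast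
  \<comment> \<open>Increasing degrees keep the tasks apart, so that each one can prescribe the
    subgroup of its degree.\<close>
  have "strict_mono (\<lambda>k. fst (f k))" using f(2) by (simp add: strict_mono_Suc_iff)
  then have inj: "inj (\<lambda>k. fst (f k))" by (rule strict_mono_imp_inj_on)
  define N where "N i = (if \<exists>k. fst (f k) = i then snd (f (SOME k. fst (f k) = i))
      else SOME M. M \<lhd> ?F \<and> ?F Mod M \<cong> alt_group i)" for i
  have Nf: "N (fst (f k)) = snd (f k)" for k
  proof -
    have "(SOME l. fst (f l) = fst (f k)) = k" using injD[OF inj] by (intro some_equality) auto
    then show ?thesis unfolding N_def by auto
  qed
  have "N i \<lhd> ?F \<and> ?F Mod N i \<cong> alt_group i" if i: "i \<ge> 5" for i
  proof (cases "\<exists>k. fst (f k) = i")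
    case True
    then obtain k where "fst (f k) = i" by blast
    then show ?thesis using f(1)[of k] Nf[of k] unfolding good_def by auto
  next
    case False
    then show ?thesis
      unfolding N_def using someI_ex[OF alternating_quotient_exists[OF A(2) i]] by simp
  qed
  moreover have "\<exists>i\<ge>5. (N i #>\<^bsub>?F\<^esub> w) \<inter> product_set ?F Hs = {}"
    if "\<forall>H\<in>set Hs. finitely_generated_subgroup ?F H \<and> infinite_index A H"
      "w \<in> carrier ?F" "w \<notin> product_set ?F Hs" for Hs w
  proof -
    have "(Hs, w) \<in> Q" using that unfolding Q_def \<H>_def by (auto simp: in_lists_conv_set)
    then obtain k where "from_nat_into Q k = (Hs, w)" using from_nat_into_surj[OF Q] by blast
    then show ?thesis
      using f(1)[of k] Nf[of k] \<open>(Hs, w) \<in> Q\<close> unfolding good_def by (metis fst_conv snd_conv)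
  qed
  ultimately show ?thesis unfolding separating_sequence_def by blast
qed

section \<open>The topology defined by a separating sequence\<close>

locale separating_quotients =
  fixes A :: "'a set" and N :: "nat \<Rightarrow> 'a letter list set"
  assumes finite_A: "finite A" and card_A: "card A \<ge> 2" and sep: "separating_sequence A N"
begin

abbreviation "F \<equiv> free_group A"
abbreviation "NN \<equiv> finite_intersections F N {5..}"

sublocale F: group F by (rule group_free_group)

lemma N_in_NN: "i \<ge> 5 \<Longrightarrow> N i \<in> NN"
proof -
  assume i: "i \<ge> 5"
  then interpret normal "N i" F using sep by (simp add: separating_sequence_def)
  have "N i = carrier F \<inter> (\<Inter>j\<in>{i}. N j)" using subset by auto
  then show ?thesis using i unfolding finite_intersections_def by blast
qed

lemma carrier_in_NN: "carrier F \<in> NN"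
  unfolding finite_intersections_def by (force intro: exI[of _ "{}"])

lemma NN_Int: "M \<in> NN \<Longrightarrow> M' \<in> NN \<Longrightarrow> M \<inter> M' \<in> NN"
proof -
  assume "M \<in> NN" "M' \<in> NN"
  then obtain J J' where "finite J" "J \<subseteq> {5..}" "M = carrier F \<inter> (\<Inter>i\<in>J. N i)"
    "finite J'" "J' \<subseteq> {5..}" "M' = carrier F \<inter> (\<Inter>i\<in>J'. N i)"
    unfolding finite_intersections_def by blast
  then have "M \<inter> M' = carrier F \<inter> (\<Inter>i\<in>J \<union> J'. N i)" "finite (J \<union> J')" "J \<union> J' \<subseteq> {5..}" by auto
  then show ?thesis unfolding finite_intersections_def by blast
qed

lemma NN_normal_finite:
  assumes "M \<in> NN" shows "M \<lhd> F" "finite (rcosets\<^bsub>F\<^esub> M)"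
proof -
  obtain J where J: "finite J" "J \<subseteq> {5..}" "M = carrier F \<inter> (\<Inter>i\<in>J. N i)"
    using assms unfolding finite_intersections_def by blast
  have "carrier F \<inter> (\<Inter>i\<in>J. N i) \<lhd> F \<and> finite (rcosets\<^bsub>F\<^esub> (carrier F \<inter> (\<Inter>i\<in>J. N i)))"
    using J(1,2)
  proof (induction J)
    case empty
    have "rcosets\<^bsub>F\<^esub> (carrier F) = {carrier F}"
      using F.coset_join2[OF _ F.subgroup_self] F.one_closed unfolding RCOSETS_def by blast
    then show ?case using F.normal_inv_iff F.subgroup_self by simp
  next
    case (insert i J)
    let ?K = "carrier F \<inter> (\<Inter>j\<in>J. N j)"
    have K: "?K \<lhd> F" "finite (rcosets\<^bsub>F\<^esub> ?K)" using insert by auto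
    have i: "N i \<lhd> F" "F Mod N i \<cong> alt_group i"
      using sep insert.prems by (auto simp: separating_sequence_def)
    have "finite (carrier (alt_group i))"
      using finite_permutations[of "{1..i}"] finite_subset alt_group_carrier by (metis (no_types, lifting) finite_atLeastAtMost mem_Collect_eq subsetI)
    then have "finite (carrier (F Mod N i))"
      using i(2) unfolding is_iso_def iso_def using bij_betw_finite by blast
    then have fi: "finite (rcosets\<^bsub>F\<^esub> (N i))" by (simp add: FactGroup_def)
    interpret K: normal ?K F by fact
    interpret Ni: normal "N i" F by (rule i(1))
    have eq: "carrier F \<inter> (\<Inter>j\<in>insert i J. N j) = ?K \<inter> N i" by auto
    have sub: "subgroup (?K \<inter> N i) F"
      using K.subgroup_axioms Ni.subgroup_axioms by (rule F.subgroups_Inter_pair)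
    have "?K \<inter> N i \<lhd> F"
      unfolding F.normal_inv_iff using sub K.inv_op_closed2 Ni.inv_op_closed2 by auto
    moreover have "finite (rcosets\<^bsub>F\<^esub> (?K \<inter> N i))"
    proof (rule finite_subset)
      show "rcosets\<^bsub>F\<^esub> (?K \<inter> N i) \<subseteq>
          (\<lambda>(C, D). C \<inter> D) ` ((rcosets\<^bsub>F\<^esub> ?K) \<times> (rcosets\<^bsub>F\<^esub> (N i)))"
      proof
        fix C assume "C \<in> rcosets\<^bsub>F\<^esub> (?K \<inter> N i)"
        then obtain g where g: "g \<in> carrier F" "C = (?K \<inter> N i) #>\<^bsub>F\<^esub> g" unfolding RCOSETS_def by blast
        have "C = (?K #>\<^bsub>F\<^esub> g) \<inter> (N i #>\<^bsub>F\<^esub> g)"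
          using g F.r_cancel K.subset Ni.subset unfolding r_coset_def by auto
        moreover have "?K #>\<^bsub>F\<^esub> g \<in> rcosets\<^bsub>F\<^esub> ?K" "N i #>\<^bsub>F\<^esub> g \<in> rcosets\<^bsub>F\<^esub> (N i)"
          using g(1) unfolding RCOSETS_def by blast+
        ultimately show "C \<in> (\<lambda>(C, D). C \<inter> D) ` ((rcosets\<^bsub>F\<^esub> ?K) \<times> (rcosets\<^bsub>F\<^esub> (N i)))"
          by (force intro: image_eqI[of _ _ "(?K #>\<^bsub>F\<^esub> g, N i #>\<^bsub>F\<^esub> g)"])
      qed
      show "finite ((\<lambda>(C, D). C \<inter> D) ` ((rcosets\<^bsub>F\<^esub> ?K) \<times> (rcosets\<^bsub>F\<^esub> (N i))))"
        using K(2) fi by blast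
    qed
    ultimately show ?case unfolding eq by blast
  qed
  then show "M \<lhd> F" "finite (rcosets\<^bsub>F\<^esub> M)" using J(3) by auto
qed

lemma NN_subset: "M \<in> NN \<Longrightarrow> M \<subseteq> carrier F"
  unfolding finite_intersections_def by blast

lemma NN_Inter:
  "finite \<M> \<Longrightarrow> \<M> \<subseteq> NN \<Longrightarrow> \<exists>M\<in>NN. \<forall>M'\<in>\<M>. M \<subseteq> M'"
proof (induction rule: finite_induct)
  case empty
  then show ?case using carrier_in_NN by blast
next
  case (insert M \<M>)
  then obtain K where "K \<in> NN" "\<forall>M'\<in>\<M>. K \<subseteq> M'" by blast
  then show ?case using NN_Int[of M K] insert.prems by (intro bexI[of _ "M \<inter> K"]) auto
qed

lemma closedin_iff:
  "closedin (pro_topology F NN) S \<longleftrightarrow>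
     S \<subseteq> carrier F \<and> (\<forall>w\<in>carrier F - S. \<exists>M\<in>NN. (M #>\<^bsub>F\<^esub> w) \<inter> S = {})"
proof -
  have op: "openin (pro_topology F NN) U \<longleftrightarrow>
      U \<subseteq> carrier F \<and> (\<forall>x\<in>U. \<exists>M\<in>NN. M #>\<^bsub>F\<^esub> x \<subseteq> U)" for U
    using carrier_in_NN NN_subset NN_Int by (intro openin_pro_topology F.is_group) blast+
  have coset: "M #>\<^bsub>F\<^esub> x \<subseteq> carrier F" if "M \<in> NN" "x \<in> carrier F" for M x
    using F.r_coset_subset_G[OF NN_subset] that by blast
  have "openin (pro_topology F NN) (carrier F)"
    unfolding op using coset carrier_in_NN by blast
  then have top: "topspace (pro_topology F NN) = carrier F"
    using op openin_subset openin_topspace by (metis subset_antisym)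
  have "(M #>\<^bsub>F\<^esub> x \<subseteq> carrier F - S) = ((M #>\<^bsub>F\<^esub> x) \<inter> S = {})" if "M \<in> NN" "x \<in> carrier F" for M x
    using coset[OF that] by blast
  then have "(\<exists>M\<in>NN. M #>\<^bsub>F\<^esub> x \<subseteq> carrier F - S) = (\<exists>M\<in>NN. (M #>\<^bsub>F\<^esub> x) \<inter> S = {})"
    if "x \<in> carrier F" for x using that by (meson bex_cong)
  then show ?thesis unfolding closedin_def top op by simp
qed

text \<open>The complement of \<open>H\<close> consists of finitely many cosets. Each has a
  representative with a neighbourhood that misses \<open>H\<close>, and one \<open>M\<close> lies
  below all of these.\<close>

lemma closed_finite_index_contains:
  assumes H: "subgroup H F" and cl: "closedin (pro_topology F NN) H" and fin: "\<not> infinite_index A H"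
  shows "\<exists>M\<in>NN. M \<subseteq> H"
proof -
  interpret H: subgroup H F by fact
  let ?T = "(\<lambda>g. g <#\<^bsub>F\<^esub> H) ` (carrier F - H)"
  have "?T \<subseteq> (\<lambda>u. translate u H) ` lists (letters A)"
    using carrier_free_group translate_eq_l_coset by fastforce
  then have "finite ?T" using fin unfolding infinite_index_def by (meson finite_subset)
  moreover have "\<exists>M\<in>NN. \<exists>g. C = g <#\<^bsub>F\<^esub> H \<and> g \<in> carrier F \<and> (M #>\<^bsub>F\<^esub> g) \<inter> H = {}" if "C \<in> ?T" for C
    using that cl unfolding closedin_iff by blast
  then obtain \<mu> where \<mu>: "\<forall>C\<in>?T. \<mu> C \<in> NN \<and>
      (\<exists>g. C = g <#\<^bsub>F\<^esub> H \<and> g \<in> carrier F \<and> (\<mu> C #>\<^bsub>F\<^esub> g) \<inter> H = {})"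
    by metis
  ultimately obtain M where M: "M \<in> NN" "\<forall>M'\<in>\<mu> ` ?T. M \<subseteq> M'"
    using NN_Inter[of "\<mu> ` ?T"] by blast
  have "M \<subseteq> H"
  proof
    fix m assume m: "m \<in> M"
    show "m \<in> H"
    proof (rule ccontr)
      assume "m \<notin> H"
      have mF: "m \<in> carrier F" using m NN_subset M(1) by blast
      let ?C = "m <#\<^bsub>F\<^esub> H"
      have C: "?C \<in> ?T" using mF \<open>m \<notin> H\<close> by blast
      then obtain g where g: "?C = g <#\<^bsub>F\<^esub> H" "g \<in> carrier F" "(\<mu> ?C #>\<^bsub>F\<^esub> g) \<inter> H = {}" using \<mu> by blast
      have "m \<in> ?C" using H.one_closed mF unfolding l_coset_def by force
      then have "m \<in> g <#\<^bsub>F\<^esub> H" using g(1) by simp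
      then obtain h where h: "h \<in> H" "m = g \<otimes>\<^bsub>F\<^esub> h" unfolding l_coset_def by auto
      \<comment> \<open>A point \<open>m = g h\<close> of \<open>M\<close> outside \<open>H\<close>
        would put this element of \<open>H\<close> into the neighbourhood of \<open>g\<close> that
        misses \<open>H\<close>.\<close>
      have "inv\<^bsub>F\<^esub> m \<otimes>\<^bsub>F\<^esub> g = inv\<^bsub>F\<^esub> h"
        using h g(2) by (simp add: F.inv_mult_group F.m_assoc)
      moreover have "inv\<^bsub>F\<^esub> h \<in> H" using h(1) by simp
      moreover have "inv\<^bsub>F\<^esub> m \<in> \<mu> ?C"
      proof -
        interpret M: normal M F using NN_normal_finite(1)[OF M(1)] .
        show ?thesis using M(2) C m M.m_inv_closed by blast
      qed
      ultimately show False using g(3) unfolding r_coset_def by force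
    qed
  qed
  then show ?thesis using M(1) by blast
qed

text \<open>By normality \<open>m\<close> can be carried past the factors before \<open>H\<close>;
  its conjugate stays in \<open>M\<close> and is absorbed by \<open>H\<close>.\<close>

lemma product_saturated:
  assumes Hs: "\<forall>H\<in>set Hs. finitely_generated_subgroup F H" and H: "H \<in> set Hs" "M \<subseteq> H" and M: "M \<lhd> F"
    and g: "g \<in> product_set F Hs" "m \<in> M"
  shows "m \<otimes>\<^bsub>F\<^esub> g \<in> product_set F Hs"
proof -
  interpret M: normal M F by fact
  have red: "\<forall>H\<in>set Hs. H \<subseteq> Collect reduced_word" and car: "\<forall>H\<in>set Hs. H \<subseteq> lists (letters A)"
    using Hs finitely_generated_imp_subgroup by blast+
  obtain hs where hs: "list_all2 (\<in>) hs Hs" "g = red (concat hs)"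
    using g(1) product_set_iff[OF red] by blast
  obtain Hs1 Hs2 where Hs_split: "Hs = Hs1 @ H # Hs2" using H(1) by (meson split_list)
  then obtain hs1 h hs2 where split: "hs = hs1 @ h # hs2" "list_all2 (\<in>) hs1 Hs1" "h \<in> H"
    "list_all2 (\<in>) hs2 Hs2"
    using hs(1) by (auto simp: list_all2_append2 list_all2_Cons2)
  let ?l = "concat hs1"
  have "?l \<in> lists (letters A)" using split(2) car Hs_split by (intro concat_in_lists) auto
  then have l: "red ?l \<in> carrier F" by (simp add: carrier_free_group red_in_lists del: in_lists_conv_set)
  define m' where "m' = inv\<^bsub>F\<^esub> (red ?l) \<otimes>\<^bsub>F\<^esub> m \<otimes>\<^bsub>F\<^esub> red ?l"
  have m': "m' \<in> H" using M.inv_op_closed1[OF l g(2)] H(2) unfolding m'_def by blast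
  have mr: "reduced_word m" using g(2) M.subset carrier_free_group by blast
  have "red (inv_word (red ?l)) = red (inv_word ?l)"
    by (metis red_append red_eq_iff red_red_append(1) red_inv_right inv_word_simps(4))
  then have m'_eq: "m' = red (inv_word ?l @ m @ ?l)"
    unfolding m'_def inv_free_group[OF l] by (simp add: mult_free_group mr)
  have "subgroup H F" using Hs H(1) finitely_generated_imp_subgroup by blast
  then have "m' \<otimes>\<^bsub>F\<^esub> h \<in> H" using m' split(3) by (rule subgroup.m_closed)
  moreover have "reduced_word h" using red H(1) split(3) by blast
  ultimately have h': "red (m' @ h) \<in> H" by (simp add: mult_free_group)
  have "list_all2 (\<in>) (hs1 @ red (m' @ h) # hs2) Hs"
    unfolding Hs_split using split h' by (simp add: list_all2_appendI)
  moreover have "red (concat (hs1 @ red (m' @ h) # hs2)) = m \<otimes>\<^bsub>F\<^esub> g"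
  proof -
    have "red (concat (hs1 @ red (m' @ h) # hs2)) = red (?l @ red (m' @ h) @ concat hs2)" by simp
    also have "\<dots> = red (?l @ m' @ h @ concat hs2)"
      by (metis append_assoc red_append red_red_append)
    also have "\<dots> = red ((?l @ inv_word ?l) @ m @ ?l @ h @ concat hs2)"
      unfolding m'_eq by (metis append_assoc red_append red_red_append)
    also have "\<dots> = red (m @ ?l @ h @ concat hs2)"
      by (metis append_Nil red_inv_right red_red_append(1))
    also have "\<dots> = m \<otimes>\<^bsub>F\<^esub> g" unfolding hs(2) split(1) by (simp add: mult_free_group)
    finally show ?thesis .
  qed
  ultimately show ?thesis using product_set_iff[OF red] by metis
qed

text \<open>If some factor has finite index, the product is a union of cosets of one
  \<open>M\<close> in \<open>NN\<close>, so its complement is open. Otherwise the separating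
  sequence applies directly.\<close>

theorem Ribes_Zalesskii: "Ribes_Zalesskii F NN"
  unfolding Ribes_Zalesskii_def
proof (intro allI impI, elim conjE)
  fix Hs assume Hs: "\<forall>H\<in>set Hs. finitely_generated_subgroup F H \<and> closedin (pro_topology F NN) H"
  have red: "\<forall>H\<in>set Hs. H \<subseteq> Collect reduced_word" and car: "\<forall>H\<in>set Hs. H \<subseteq> lists (letters A)"
    using Hs finitely_generated_imp_subgroup by blast+
  have sub: "product_set F Hs \<subseteq> carrier F"
  proof
    fix g assume "g \<in> product_set F Hs"
    then obtain hs where hs: "list_all2 (\<in>) hs Hs" "g = red (concat hs)"
      using product_set_iff[OF red] by blast
    then have "concat hs \<in> lists (letters A)" using car by (intro concat_in_lists)
    then show "g \<in> carrier F"
      using hs(2) by (simp add: carrier_free_group red_in_lists del: in_lists_conv_set)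
  qed
  moreover have "\<exists>M\<in>NN. (M #>\<^bsub>F\<^esub> w) \<inter> product_set F Hs = {}"
    if w: "w \<in> carrier F - product_set F Hs" for w
  proof (cases "\<forall>H\<in>set Hs. infinite_index A H")
    case True
    then obtain i where "i \<ge> 5" "(N i #>\<^bsub>F\<^esub> w) \<inter> product_set F Hs = {}"
      using sep Hs w unfolding separating_sequence_def by blast
    then show ?thesis using N_in_NN by blast
  next
    case False
    then obtain H where H: "H \<in> set Hs" "\<not> infinite_index A H" by blast
    then have "subgroup H F" using Hs finitely_generated_imp_subgroup(1) by blast
    then obtain M where M: "M \<in> NN" "M \<subseteq> H"
      using closed_finite_index_contains Hs H by blast
    interpret M: normal M F using NN_normal_finite(1)[OF M(1)] .
    have "m \<otimes>\<^bsub>F\<^esub> w \<notin> product_set F Hs" if m: "m \<in> M" for m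
    proof
      assume "m \<otimes>\<^bsub>F\<^esub> w \<in> product_set F Hs"
      then have "inv\<^bsub>F\<^esub> m \<otimes>\<^bsub>F\<^esub> (m \<otimes>\<^bsub>F\<^esub> w) \<in> product_set F Hs"
        using product_saturated[OF _ H(1) M(2) M.normal_axioms] Hs m by simp
      moreover have "inv\<^bsub>F\<^esub> m \<otimes>\<^bsub>F\<^esub> (m \<otimes>\<^bsub>F\<^esub> w) = w"
        using m M.mem_carrier w F.inv_solve_left' by (simp add: F.m_assoc[symmetric])
      ultimately show False using w by simp
    qed
    then show ?thesis using M(1) unfolding r_coset_def by blast
  qed
  ultimately show "closedin (pro_topology F NN) (product_set F Hs)" unfolding closedin_iff by blast
qed

end

section \<open>Inverse systems of finite sets\<close>

text \<open>Vertices and edges of the levels form two such systems. By \<open>thread\<close> the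
  projections from the limit are onto.\<close>

locale inverse_system =
  fixes I :: "'b set set" and S :: "'b set \<Rightarrow> 'x set" and p :: "'b set \<Rightarrow> 'b set \<Rightarrow> 'x \<Rightarrow> 'x"
  assumes I_ne: "I \<noteq> {}" and I_Int: "M \<in> I \<Longrightarrow> M' \<in> I \<Longrightarrow> M \<inter> M' \<in> I"
    and finite_S: "M \<in> I \<Longrightarrow> finite (S M)"
    and bond: "M \<in> I \<Longrightarrow> M' \<in> I \<Longrightarrow> M' \<subseteq> M \<Longrightarrow> y \<in> S M' \<Longrightarrow> p M M' y \<in> S M"
    and bond_comp: "M \<in> I \<Longrightarrow> M' \<in> I \<Longrightarrow> M'' \<in> I \<Longrightarrow> M'' \<subseteq> M' \<Longrightarrow> M' \<subseteq> M \<Longrightarrow>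
      y \<in> S M'' \<Longrightarrow> p M M' (p M' M'' y) = p M M'' y"
    and thread: "M \<in> I \<Longrightarrow> y \<in> S M \<Longrightarrow> \<exists>z\<in>proj_limit I (\<supseteq>) S p. z M = y"
begin

abbreviation "L \<equiv> proj_limit I (\<supseteq>) S p"
abbreviation "limtop \<equiv> proj_limit_topology I (\<supseteq>) S p"

lemma limit_mem: "z \<in> L \<Longrightarrow> M \<in> I \<Longrightarrow> z M \<in> S M"
  by (auto simp: proj_limit_def)

lemma limit_bond: "z \<in> L \<Longrightarrow> M \<in> I \<Longrightarrow> M' \<in> I \<Longrightarrow> M' \<subseteq> M \<Longrightarrow> p M M' (z M') = z M"
  by (auto simp: proj_limit_def)

lemma limit_eq_mono:
  "z \<in> L \<Longrightarrow> z' \<in> L \<Longrightarrow> M \<in> I \<Longrightarrow> M' \<in> I \<Longrightarrow> M' \<subseteq> M \<Longrightarrow> z M' = z' M' \<Longrightarrow> z M = z' M"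
  by (metis limit_bond)

lemma I_lower_bound: "finite J \<Longrightarrow> J \<subseteq> I \<Longrightarrow> \<exists>M\<in>I. \<forall>M'\<in>J. M \<subseteq> M'"
proof (induction rule: finite_induct)
  case empty
  then show ?case using I_ne by blast
next
  case (insert M J)
  then obtain K where "K \<in> I" "\<forall>M'\<in>J. K \<subseteq> M'" by blast
  then show ?case using I_Int[of M K] insert.prems by (intro bexI[of _ "M \<inter> K"]) auto
qed

lemma topspace_top [simp]: "topspace limtop = L"
  by (auto simp: proj_limit_topology_def proj_limit_def)

lemma projection_continuous: "M \<in> I \<Longrightarrow> continuous_map limtop (discrete_topology (S M)) (\<lambda>z. z M)"
  unfolding proj_limit_topology_def
  by (intro continuous_map_from_subtopology continuous_map_product_projection)

lemma cylinder_closed: "M \<in> I \<Longrightarrow> closedin limtop {z \<in> L. z M \<in> B}"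
proof -
  assume M: "M \<in> I"
  have "closedin limtop {z \<in> topspace limtop. z M \<in> S M \<inter> B}"
    using projection_continuous[OF M] by (rule closedin_continuous_map_preimage) simp
  also have "{z \<in> topspace limtop. z M \<in> S M \<inter> B} = {z \<in> L. z M \<in> B}"
    using limit_mem M by auto
  finally show ?thesis .
qed

lemma cylinder_open: "M \<in> I \<Longrightarrow> openin limtop {z \<in> L. z M \<in> B}"
proof -
  assume M: "M \<in> I"
  have "closedin limtop {z \<in> L. z M \<in> - B}" using M by (rule cylinder_closed)
  then have "openin limtop (topspace limtop - {z \<in> L. z M \<in> - B})" by (rule openin_diff[OF openin_topspace])
  also have "topspace limtop - {z \<in> L. z M \<in> - B} = {z \<in> L. z M \<in> B}" by auto
  finally show ?thesis .
qed

text \<open>The limit is closed in a compact product of finite sets, since each compatibility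
  condition is a finite union of cylinders.\<close>

lemma compact_top: "compact_space limtop"
proof -
  let ?P = "product_topology (\<lambda>M. discrete_topology (S M)) I"
  have comp: "compact_space ?P"
    using finite_S by (auto simp: compact_space_product_topology compact_space_discrete_topology)
  have proj: "closedin ?P {z \<in> topspace ?P. z M \<in> B}" if "M \<in> I" "B \<subseteq> S M" for M B
    using continuous_map_product_projection[OF that(1)]
    by (rule closedin_continuous_map_preimage) (use that in simp)
  define R where "R M M' = (\<Union>b\<in>S M'. {z \<in> topspace ?P. z M' \<in> {b}} \<inter> {z \<in> topspace ?P. z M \<in> {p M M' b}})" for M M'
  have R: "closedin ?P (R M M')" if "M \<in> I" "M' \<in> I" "M' \<subseteq> M" for M M'
    unfolding R_def
  proof (rule closedin_Union)
    show "finite ((\<lambda>b. {z \<in> topspace ?P. z M' \<in> {b}} \<inter> {z \<in> topspace ?P. z M \<in> {p M M' b}}) ` S M')"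
      using finite_S[OF that(2)] by (rule finite_imageI)
    fix T assume "T \<in> (\<lambda>b. {z \<in> topspace ?P. z M' \<in> {b}} \<inter> {z \<in> topspace ?P. z M \<in> {p M M' b}}) ` S M'"
    then obtain b where b: "b \<in> S M'"
      "T = {z \<in> topspace ?P. z M' \<in> {b}} \<inter> {z \<in> topspace ?P. z M \<in> {p M M' b}}" by blast
    show "closedin ?P T" unfolding b(2)
    proof (rule closedin_Int[OF proj proj])
      show "{p M M' b} \<subseteq> S M" using bond[OF that] b(1) by blast
    qed (use that b(1) in auto)
  qed
  have R_eq: "R M M' = {z \<in> topspace ?P. p M M' (z M') = z M}" if "M \<in> I" "M' \<in> I" for M M'
    using that unfolding R_def by (auto simp: PiE_iff)
  have "L = topspace ?P \<inter> \<Inter>{R M M' |M M'. M \<in> I \<and> M' \<in> I \<and> M' \<subseteq> M}"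
  proof (intro equalityI subsetI)
    fix z assume z: "z \<in> L"
    then have "z \<in> topspace ?P" by (auto simp: proj_limit_def)
    then show "z \<in> topspace ?P \<inter> \<Inter>{R M M' |M M'. M \<in> I \<and> M' \<in> I \<and> M' \<subseteq> M}"
      using R_eq limit_bond[OF z] by auto
  next
    fix z assume z: "z \<in> topspace ?P \<inter> \<Inter>{R M M' |M M'. M \<in> I \<and> M' \<in> I \<and> M' \<subseteq> M}"
    have "p M M' (z M') = z M" if "M \<in> I" "M' \<in> I" "M' \<subseteq> M" for M M'
      using z that R_eq[OF that(1,2)] by blast
    then show "z \<in> L" using z unfolding proj_limit_def by auto
  qed
  moreover have "closedin ?P (topspace ?P \<inter> \<Inter>{R M M' |M M'. M \<in> I \<and> M' \<in> I \<and> M' \<subseteq> M})"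
  proof (rule closedin_Int[OF closedin_topspace closedin_Inter])
    show "{R M M' |M M'. M \<in> I \<and> M' \<in> I \<and> M' \<subseteq> M} \<noteq> {}" using I_ne by blast
  qed (use R in blast)
  ultimately have "closedin ?P L" by simp
  then show ?thesis
    unfolding proj_limit_topology_def using comp closedin_compact_space compact_space_subtopology by blast
qed

lemma open_basis:
  assumes "openin limtop U" "z \<in> U"
  shows "\<exists>M\<in>I. \<forall>y\<in>L. y M = z M \<longrightarrow> y \<in> U"
proof -
  let ?P = "product_topology (\<lambda>M. discrete_topology (S M)) I"
  have zL: "z \<in> L" using assms openin_subset by fastforce
  obtain T where T: "openin ?P T" "U = T \<inter> L"
    using assms(1) unfolding proj_limit_topology_def openin_subtopology by blast
  then obtain W where W: "finite {M \<in> I. W M \<noteq> topspace (discrete_topology (S M))}"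
    "z \<in> Pi\<^sub>E I W" "Pi\<^sub>E I W \<subseteq> T"
    using assms(2) unfolding openin_product_topology_alt by blast
  obtain M where M: "M \<in> I" "\<forall>M'\<in>{M \<in> I. W M \<noteq> S M}. M \<subseteq> M'"
    using I_lower_bound[of "{M \<in> I. W M \<noteq> S M}"] W(1) by auto
  have "y \<in> U" if y: "y \<in> L" "y M = z M" for y
  proof -
    have "y M' \<in> W M'" if M': "M' \<in> I" for M'
    proof (cases "W M' = S M'")
      case True
      then show ?thesis using limit_mem[OF y(1) M'] by simp
    next
      case False
      then have "y M' = z M'" using limit_eq_mono[OF y(1) zL M' M(1) _ y(2)] M(2) M' by blast
      then show ?thesis using W(2) M' by auto
    qed
    moreover have "y \<in> extensional I" using y(1) by (auto simp: proj_limit_def PiE_def)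
    ultimately have "y \<in> Pi\<^sub>E I W" by (simp add: PiE_iff)
    then show ?thesis using W(3) T(2) y(1) by blast
  qed
  then show ?thesis using M(1) by blast
qed

text \<open>A closed set is determined by its levels.\<close>

lemma closed_thread:
  assumes "closedin limtop V" "z \<in> L" "\<And>M. M \<in> I \<Longrightarrow> \<exists>v\<in>V. v M = z M"
  shows "z \<in> V"
proof (rule ccontr)
  assume "z \<notin> V"
  then have "openin limtop (L - V)" "z \<in> L - V" using assms by (auto simp: closedin_def)
  then obtain M where "M \<in> I" "\<forall>y\<in>L. y M = z M \<longrightarrow> y \<in> L - V" using open_basis by blast
  then show False using assms(3)[of M] closedin_subset[OF assms(1)] by auto
qed

lemma closed_limit: "closedin limtop {z \<in> L. \<forall>M\<in>I. z M \<in> K M}"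
proof -
  have "{z \<in> L. \<forall>M\<in>I. z M \<in> K M} = \<Inter>((\<lambda>M. {z \<in> L. z M \<in> K M}) ` I)" using I_ne by auto
  moreover have "closedin limtop \<dots>"
    using I_ne cylinder_closed by (intro closedin_Inter) auto
  ultimately show ?thesis by simp
qed

text \<open>Finitely many cylinders on which \<open>f\<close> is constant cover the compact set
  \<open>V\<close>; any common lower bound of their indices works.\<close>

lemma continuous_factor:
  assumes V: "closedin limtop V" and f: "continuous_map (subtopology limtop V) (discrete_topology D) f"
  shows "\<exists>M\<in>I. \<forall>v\<in>V. \<forall>w\<in>V. v M = w M \<longrightarrow> f v = f w"
proof -
  have VL: "V \<subseteq> L" using V closedin_subset by fastforce
  have "\<exists>M. M \<in> I \<and> (\<forall>y\<in>V. y M = v M \<longrightarrow> f y = f v)" if v: "v \<in> V" for v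
  proof -
    have "f v \<in> D" using f v VL unfolding continuous_map_def by auto
    then have "openin (discrete_topology D) {f v}" by simp
    then have "openin (subtopology limtop V) {y \<in> topspace (subtopology limtop V). f y \<in> {f v}}"
      using f openin_continuous_map_preimage by blast
    then obtain U where U: "openin limtop U" "{y \<in> topspace (subtopology limtop V). f y \<in> {f v}} = U \<inter> V"
      unfolding openin_subtopology by blast
    then have eq: "U \<inter> V = {y \<in> V. f y = f v}" using VL by auto
    then have "v \<in> U" using v by auto
    then obtain M where "M \<in> I" "\<forall>y\<in>L. y M = v M \<longrightarrow> y \<in> U" using open_basis[OF U(1)] by blast
    then show ?thesis using eq VL by blast
  qed
  then have "\<forall>v\<in>V. \<exists>M. M \<in> I \<and> (\<forall>y\<in>V. y M = v M \<longrightarrow> f y = f v)" ..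
  from bchoice[OF this] obtain m where m: "\<forall>v\<in>V. m v \<in> I \<and> (\<forall>y\<in>V. y (m v) = v (m v) \<longrightarrow> f y = f v)" ..
  let ?cyl = "\<lambda>v. {z \<in> L. z (m v) \<in> {v (m v)}}"
  have "compactin limtop V" using compact_top V by (rule closedin_compact_space)
  moreover have "\<forall>U\<in>?cyl ` V. openin limtop U" using m cylinder_open by blast
  moreover have "V \<subseteq> \<Union>(?cyl ` V)" using VL by blast
  ultimately have "\<exists>\<F>. finite \<F> \<and> \<F> \<subseteq> ?cyl ` V \<and> V \<subseteq> \<Union>\<F>"
    unfolding compactin_def by blast
  then obtain \<F> where \<F>: "finite \<F>" "\<F> \<subseteq> ?cyl ` V" "V \<subseteq> \<Union>\<F>" by blast
  obtain V0 where "V0 \<subseteq> V" "finite V0" "\<F> = ?cyl ` V0"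
    using finite_subset_image[OF \<F>(1,2)] by blast
  then have V0: "finite V0" "V0 \<subseteq> V" "V \<subseteq> \<Union>(?cyl ` V0)" using \<F>(3) by simp_all
  obtain M where M: "M \<in> I" "\<forall>M'\<in>m ` V0. M \<subseteq> M'"
    using I_lower_bound[of "m ` V0"] V0 m by blast
  have "f v = f w" if vw: "v \<in> V" "w \<in> V" "v M = w M" for v w
  proof -
    obtain v0 where v0: "v0 \<in> V0" "v (m v0) = v0 (m v0)" using V0(3) vw(1) by blast
    have "w (m v0) = v (m v0)"
    proof (rule limit_eq_mono[where M' = M])
      show "w \<in> L" "v \<in> L" "m v0 \<in> I" "M \<subseteq> m v0" using vw VL M m v0(1) V0(2) by blast+
    qed (use vw M in simp_all)
    then have "w (m v0) = v0 (m v0)" using v0(2) by simp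
    moreover have "\<forall>y\<in>V. y (m v0) = v0 (m v0) \<longrightarrow> f y = f v0" using m v0(1) V0(2) by blast
    ultimately show ?thesis using v0(2) vw(1,2) by simp
  qed
  then show ?thesis using M(1) by blast
qed

text \<open>The finite intersection property of the closed fibres: taking levels commutes with
  directed intersections.\<close>

lemma directed_fiber:
  assumes ne: "\<V> \<noteq> {}" and closed: "\<And>V. V \<in> \<V> \<Longrightarrow> closedin limtop V"
    and dir: "\<And>V W. V \<in> \<V> \<Longrightarrow> W \<in> \<V> \<Longrightarrow> \<exists>U\<in>\<V>. U \<subseteq> V \<inter> W"
    and M: "M \<in> I" and fib: "\<And>V. V \<in> \<V> \<Longrightarrow> \<exists>z\<in>V. z M = y"
  shows "\<exists>z\<in>\<Inter>\<V>. z M = y"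
proof -
  let ?C = "\<lambda>V. V \<inter> {z \<in> L. z M \<in> {y}}"
  have "\<forall>C\<in>?C ` \<V>. closedin limtop C" using closed cylinder_closed[OF M] by blast
  moreover have "\<Inter>\<F> \<noteq> {}" if F: "finite \<F>" "\<F> \<subseteq> ?C ` \<V>" for \<F>
  proof -
    obtain \<W> where W: "finite \<W>" "\<W> \<subseteq> \<V>" "\<F> = ?C ` \<W>"
      using finite_subset_image[OF F] by blast
    have "\<exists>U\<in>\<V>. \<forall>W\<in>\<W>. U \<subseteq> W" using W(1,2)
    proof (induction rule: finite_induct)
      case empty
      then show ?case using ne by blast
    next
      case (insert W \<W>)
      then obtain U where "U \<in> \<V>" "\<forall>W\<in>\<W>. U \<subseteq> W" by blast
      moreover obtain U' where "U' \<in> \<V>" "U' \<subseteq> W \<inter> U"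
        using dir[of W U] insert.prems \<open>U \<in> \<V>\<close> by auto
      ultimately show ?case by (intro bexI[of _ U']) auto
    qed
    then obtain U where U: "U \<in> \<V>" "\<forall>W\<in>\<W>. U \<subseteq> W" by blast
    obtain z where "z \<in> U" "z M = y" using fib[OF U(1)] by blast
    moreover from this have "z \<in> L" using closedin_subset[OF closed[OF U(1)]] by auto
    ultimately have "z \<in> \<Inter>\<F>" unfolding W(3) using U(2) by blast
    then show ?thesis by blast
  qed
  ultimately have "(\<forall>C\<in>?C ` \<V>. closedin limtop C) \<and> (\<forall>\<F>. finite \<F> \<and> \<F> \<subseteq> ?C ` \<V> \<longrightarrow> \<Inter>\<F> \<noteq> {})"
    by simp
  from compact_top[unfolded compact_space_fip, THEN spec, THEN mp, OF this]
  have "\<Inter>(?C ` \<V>) \<noteq> {}" .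
  then show ?thesis using ne by blast
qed

section \<open>Subsystems and their stable images\<close>

definition compatible :: "('b set \<Rightarrow> 'x set) \<Rightarrow> bool" where
  "compatible K \<longleftrightarrow> (\<forall>M\<in>I. K M \<subseteq> S M) \<and>
     (\<forall>M\<in>I. \<forall>M'\<in>I. M' \<subseteq> M \<longrightarrow> p M M' ` K M' \<subseteq> K M)"

lemma compatible_lift:
  assumes K: "compatible K" and M: "M \<in> I"
    and y: "\<And>M'. M' \<in> I \<Longrightarrow> M' \<subseteq> M \<Longrightarrow> y \<in> p M M' ` K M'"
  shows "\<exists>z\<in>L. (\<forall>M'\<in>I. z M' \<in> K M') \<and> z M = y"
proof -
  define \<V> where "\<V> = {{z \<in> L. z M' \<in> K M'} |M'. M' \<in> I \<and> M' \<subseteq> M}"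
  have down: "z M' \<in> K M'" if "z \<in> L" "z M'' \<in> K M''" "M' \<in> I" "M'' \<in> I" "M'' \<subseteq> M'" for z M' M''
    using K that limit_bond[OF that(1,3,4,5)] unfolding compatible_def by (metis image_subset_iff)
  have "\<exists>z\<in>\<Inter>\<V>. z M = y"
  proof (rule directed_fiber[OF _ _ _ M])
    show "\<V> \<noteq> {}" unfolding \<V>_def using M by blast
    show "closedin limtop V" if "V \<in> \<V>" for V using that cylinder_closed unfolding \<V>_def by blast
    show "\<exists>U\<in>\<V>. U \<subseteq> V \<inter> W" if VW: "V \<in> \<V>" "W \<in> \<V>" for V W
    proof -
      obtain M1 M2 where M12: "M1 \<in> I" "M1 \<subseteq> M" "V = {z \<in> L. z M1 \<in> K M1}"
        "M2 \<in> I" "M2 \<subseteq> M" "W = {z \<in> L. z M2 \<in> K M2}"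
        using VW unfolding \<V>_def by blast
      then have "{z \<in> L. z (M1 \<inter> M2) \<in> K (M1 \<inter> M2)} \<subseteq> V \<inter> W"
        using down I_Int by blast
      moreover have "{z \<in> L. z (M1 \<inter> M2) \<in> K (M1 \<inter> M2)} \<in> \<V>"
        unfolding \<V>_def using M12 I_Int by blast
      ultimately show ?thesis by blast
    qed
    show "\<exists>z\<in>V. z M = y" if V: "V \<in> \<V>" for V
    proof -
      obtain M' where M': "M' \<in> I" "M' \<subseteq> M" "V = {z \<in> L. z M' \<in> K M'}"
        using V unfolding \<V>_def by blast
      obtain k where k: "k \<in> K M'" "y = p M M' k" using y[OF M'(1,2)] by blast
      then obtain z where "z \<in> L" "z M' = k" using thread[OF M'(1)] K M'(1) unfolding compatible_def by blast
      then show ?thesis using M' k limit_bond[OF _ M M'(1,2)] by auto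
    qed
  qed
  then obtain z where z: "z \<in> \<Inter>\<V>" "z M = y" by blast
  have zM: "z \<in> L \<and> z M' \<in> K M'" if "M' \<in> I" "M' \<subseteq> M" for M'
    using z(1) that unfolding \<V>_def by blast
  then have zL: "z \<in> L" using M by blast
  have "z M' \<in> K M'" if "M' \<in> I" for M'
    using down[OF zL, of "M' \<inter> M" M'] zM[of "M' \<inter> M"] I_Int that M by blast
  then show ?thesis using zL z(2) by blast
qed

text \<open>The Mittag-Leffler argument for finite sets: images from ever deeper levels decrease and
  become stationary, and by compactness the stationary image is that of the limit. The maps of the
  subsystem itself need not be onto.\<close>

lemma stable_image:
  assumes K: "compatible K" and M: "M \<in> I"
  shows "\<exists>M1\<in>I. M1 \<subseteq> M \<and> (\<forall>M2\<in>I. M2 \<subseteq> M1 \<longrightarrow>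
    (\<lambda>z. z M) ` {z \<in> L. \<forall>M'\<in>I. z M' \<in> K M'} = p M M2 ` K M2)"
proof -
  have fin: "finite (p M M' ` K M')" if "M' \<in> I" for M'
    using K finite_S that unfolding compatible_def by (meson finite_imageI finite_subset)
  have mono: "p M M2 ` K M2 \<subseteq> p M M1 ` K M1"
    if "M1 \<in> I" "M2 \<in> I" "M2 \<subseteq> M1" "M1 \<subseteq> M" for M1 M2
  proof
    fix y assume "y \<in> p M M2 ` K M2"
    then obtain k where k: "k \<in> K M2" "y = p M M2 k" by blast
    have "k \<in> S M2" using K k(1) that unfolding compatible_def by blast
    then have "y = p M M1 (p M1 M2 k)" using bond_comp[OF M that(1,2,3,4)] k(2) by simp
    moreover have "p M1 M2 k \<in> K M1" using K k(1) that unfolding compatible_def by blast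
    ultimately show "y \<in> p M M1 ` K M1" by blast
  qed
  obtain M1 where M1: "M1 \<in> I" "M1 \<subseteq> M"
    "\<And>M2. M2 \<in> I \<Longrightarrow> M2 \<subseteq> M \<Longrightarrow> card (p M M1 ` K M1) \<le> card (p M M2 ` K M2)"
    using exists_least_lemma[of "\<lambda>n. \<exists>M1. M1 \<in> I \<and> M1 \<subseteq> M \<and> card (p M M1 ` K M1) = n"]
      ex_has_least_nat[of "\<lambda>M1. M1 \<in> I \<and> M1 \<subseteq> M" M "\<lambda>M1. card (p M M1 ` K M1)"] M by blast
  have stable: "p M M2 ` K M2 = p M M1 ` K M1" if "M2 \<in> I" "M2 \<subseteq> M1" for M2
    using mono[OF M1(1) that M1(2)] M1(3)[OF that(1)] that M1(2) fin[OF M1(1)]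
    by (intro card_seteq) auto
  have img: "(\<lambda>z. z M) ` {z \<in> L. \<forall>M'\<in>I. z M' \<in> K M'} = p M M1 ` K M1"
  proof (intro equalityI subsetI)
    fix y assume "y \<in> (\<lambda>z. z M) ` {z \<in> L. \<forall>M'\<in>I. z M' \<in> K M'}"
    then obtain z where "z \<in> L" "\<forall>M'\<in>I. z M' \<in> K M'" "y = z M" by blast
    then show "y \<in> p M M1 ` K M1" using limit_bond[OF _ M M1(1,2)] M1(1) by force
  next
    fix y assume y: "y \<in> p M M1 ` K M1"
    have "y \<in> p M M' ` K M'" if M': "M' \<in> I" "M' \<subseteq> M" for M'
    proof -
      have "M1 \<inter> M' \<in> I" using I_Int M1(1) M'(1) by blast
      then show ?thesis
        using y stable[of "M1 \<inter> M'"] mono[of M' "M1 \<inter> M'"] M' by blast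
    qed
    then show "y \<in> (\<lambda>z. z M) ` {z \<in> L. \<forall>M'\<in>I. z M' \<in> K M'}"
      using compatible_lift[OF K M, of y] by blast
  qed
  show ?thesis
  proof (intro bexI[OF _ M1(1)] conjI ballI impI)
    show "M1 \<subseteq> M" by (rule M1(2))
    show "(\<lambda>z. z M) ` {z \<in> L. \<forall>M'\<in>I. z M' \<in> K M'} = p M M2 ` K M2" if "M2 \<in> I" "M2 \<subseteq> M1" for M2
      unfolding stable[OF that] by (rule img)
  qed
qed

end

section \<open>Fundamental groups of finite inverse automata\<close>

lemma red_cancel:
  "red (p @ u @ inv_word u @ q) = red (p @ q)" "red (p @ inv_word u @ u @ q) = red (p @ q)"
proof -
  have "red (p @ v @ q) = red (p @ q)" if "red v = []" for v
  proof -
    have "red (p @ v @ q) = red (p @ red (red v @ q))" by simp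
    then show ?thesis using that by simp
  qed
  from this[of "u @ inv_word u"] this[of "inv_word u @ u"]
  show "red (p @ u @ inv_word u @ q) = red (p @ q)" "red (p @ inv_word u @ u @ q) = red (p @ q)"
    by simp_all
qed

context inverse_automaton
begin

definition loops :: "'a set \<Rightarrow> 's \<Rightarrow> 'a letter list set" where
  "loops A s = {h \<in> carrier (free_group A). reads \<delta> h s s}"

lemma reads_in_lists:
  assumes "\<And>x s t. \<delta> x s t \<Longrightarrow> x \<in> letters A"
  shows "reads \<delta> w s t \<Longrightarrow> w \<in> lists (letters A)"
  by (induction w arbitrary: t) (auto dest: assms)

lemma subgroup_loops: "subgroup (loops A s) (free_group A)"
proof
  interpret group "free_group A" by (rule group_free_group)
  show "loops A s \<subseteq> carrier (free_group A)" by (auto simp: loops_def)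
  show "\<one>\<^bsub>free_group A\<^esub> \<in> loops A s"
    using one_closed by (simp add: loops_def) (simp add: free_group_simps)
  show "inv\<^bsub>free_group A\<^esub> g \<in> loops A s" if "g \<in> loops A s" for g
  proof -
    have g: "g \<in> carrier (free_group A)" "reads \<delta> g s s" using that by (simp_all add: loops_def)
    have "reads \<delta> (red (inv_word g)) s s" using reads_red[OF reads_inv[OF g(2)]] .
    then show ?thesis using inv_closed[OF g(1)] inv_free_group[OF g(1)] by (simp add: loops_def)
  qed
  show "g \<otimes>\<^bsub>free_group A\<^esub> h \<in> loops A s" if "g \<in> loops A s" "h \<in> loops A s" for g h
  proof -
    have gh: "g \<in> carrier (free_group A)" "h \<in> carrier (free_group A)" "reads \<delta> (g @ h) s s"
      using that by (auto simp: loops_def reads_append)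
    then have "g \<otimes>\<^bsub>free_group A\<^esub> h = red (g @ h)"
      by (simp add: carrier_free_group mult_free_group)
    then show ?thesis using reads_red[OF gh(3)] m_closed[OF gh(1,2)] by (simp add: loops_def)
  qed
qed

text \<open>Schreier generators: a transition from \<open>s\<close> to \<open>t\<close> gives the
  loop \<open>inv_word (\<tau> t) @ x # \<tau> s\<close>, and every loop telescopes into
  these.\<close>

lemma finitely_generated_loops:
  assumes A: "finite A" and \<delta>: "\<And>x s t. \<delta> x s t \<Longrightarrow> x \<in> letters A"
    and R: "finite R" "\<And>w t. reads \<delta> w s0 t \<Longrightarrow> t \<in> R"
  shows "finitely_generated_subgroup (free_group A) (loops A s0)"
proof -
  \<comment> \<open>The empty word at \<open>s0\<close> lets the telescoping begin and end without a
    correction.\<close>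
  define \<tau> where "\<tau> s = (if s = s0 then [] else SOME w. reads \<delta> w s0 s)" for s
  have \<tau>: "reads \<delta> (\<tau> s) s0 s" if "reads \<delta> w s0 s" for w s
    unfolding \<tau>_def using someI[of "\<lambda>w. reads \<delta> w s0 s", OF that] by simp
  define gen where "gen = (\<lambda>(s, x, t). red (inv_word (\<tau> t) @ x # \<tau> s))"
  define S where "S = gen ` {(s, x, t). (\<exists>w. reads \<delta> w s0 s) \<and> \<delta> x s t}"
  have "{(s, x, t). (\<exists>w. reads \<delta> w s0 s) \<and> \<delta> x s t} \<subseteq> R \<times> letters A \<times> R"
  proof
    fix q assume "q \<in> {(s, x, t). (\<exists>w. reads \<delta> w s0 s) \<and> \<delta> x s t}"
    then obtain s x t w where q: "q = (s, x, t)" "reads \<delta> w s0 s" "\<delta> x s t" by blast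
    then have "reads \<delta> (x # w) s0 t" by auto
    then show "q \<in> R \<times> letters A \<times> R" using R(2) \<delta> q by blast
  qed
  moreover have "finite (R \<times> letters A \<times> R)" using A R(1) by (simp add: letters_def)
  ultimately have S: "finite S" unfolding S_def by (meson finite_imageI finite_subset)
  have S_loops: "S \<subseteq> loops A s0"
  proof
    fix g assume "g \<in> S"
    then obtain s x t w where g: "g = red (inv_word (\<tau> t) @ x # \<tau> s)" "reads \<delta> w s0 s" "\<delta> x s t"
      unfolding S_def gen_def by auto
    then have "reads \<delta> (x # w) s0 t" by auto
    then have "reads \<delta> (inv_word (\<tau> t)) t s0" using \<tau> reads_inv by blast
    moreover have "reads \<delta> (x # \<tau> s) s0 t" using \<tau>[OF g(2)] g(3) by auto
    ultimately have r: "reads \<delta> (inv_word (\<tau> t) @ x # \<tau> s) s0 s0" unfolding reads_append by blast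
    then have "inv_word (\<tau> t) @ x # \<tau> s \<in> lists (letters A)" using reads_in_lists \<delta> by blast
    from red_in_lists[OF this] have "g \<in> lists (letters A)" unfolding g(1) .
    then show "g \<in> loops A s0"
      unfolding loops_def carrier_free_group using reads_red[OF r] g(1) by simp
  qed
  then have carS: "S \<subseteq> carrier (free_group A)" by (auto simp: loops_def)
  interpret group "free_group A" by (rule group_free_group)
  have "red (inv_word (\<tau> s) @ u) \<in> generate (free_group A) S" if "reads \<delta> u s0 s" for u s
    using that
  proof (induction u arbitrary: s)
    case Nil
    then show ?case using generate.one[of "free_group A" S] by (simp add: \<tau>_def free_group_simps)
  next
    case (Cons x u)
    then obtain m where m: "reads \<delta> u s0 m" "\<delta> x m s" by auto
    have "gen (m, x, s) \<in> S" unfolding S_def using m by blast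
    then have "gen (m, x, s) \<in> generate (free_group A) S" by (rule generate.incl)
    then have "gen (m, x, s) \<otimes>\<^bsub>free_group A\<^esub> red (inv_word (\<tau> m) @ u) \<in> generate (free_group A) S"
      using Cons.IH[OF m(1)] by (rule generate.eng)
    moreover have "gen (m, x, s) \<otimes>\<^bsub>free_group A\<^esub> red (inv_word (\<tau> m) @ u) =
        red ((inv_word (\<tau> s) @ [x]) @ \<tau> m @ inv_word (\<tau> m) @ u)"
      by (simp add: gen_def mult_free_group)
    ultimately show ?case unfolding red_cancel by simp
  qed
  note gen_red = this[where s = s0]
  have "loops A s0 \<subseteq> generate (free_group A) S"
  proof
    fix h assume "h \<in> loops A s0"
    then have "reads \<delta> h s0 s0" "reduced_word h" by (simp_all add: loops_def carrier_free_group)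
    then show "h \<in> generate (free_group A) S" using gen_red[of h] by (simp add: \<tau>_def red_reduced)
  qed
  moreover have "generate (free_group A) S \<subseteq> loops A s0"
    using S_loops subgroup_loops by (rule generate_subgroup_incl)
  ultimately show ?thesis
    unfolding finitely_generated_subgroup_def using S carS by blast
qed

text \<open>The missing letter at \<open>y\<close> leads into a tree of the Schreier graph, where
  powers of another generator \<open>c\<close> reach infinitely many vertices. If two of the cosets
  agreed, a reduced word whose first letter to be read is \<open>x\<close> would be readable at
  \<open>y\<close>.\<close>

lemma infinite_index_loops:
  assumes A: "card A \<ge> 2" and \<delta>: "\<And>x s t. \<delta> x s t \<Longrightarrow> x \<in> letters A"
    and w: "reads \<delta> w s0 y" and x: "x \<in> letters A" "\<And>t. \<not> \<delta> x y t"
  shows "infinite_index A (loops A s0)"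
proof -
  let ?H = "loops A s0"
  obtain c where c: "c \<in> A" "c \<noteq> fst x"
  proof -
    have "A \<noteq> {fst x}" "A \<noteq> {}" using A by auto
    then show ?thesis using that by blast
  qed
  let ?c = "\<lambda>i. replicate i (c, True)"
  define f where "f i = ?c i @ x # w" for i
  have fL: "f i \<in> lists (letters A)" for i
  proof -
    have "w \<in> lists (letters A)" using reads_in_lists \<delta> w by blast
    then show ?thesis using c(1) x(1) by (auto simp: f_def letters_def)
  qed
  have H: "?H \<subseteq> Collect reduced_word" "[] \<in> ?H"
    by (auto simp: loops_def carrier_free_group)
  have "translate (f i) ?H \<noteq> translate (f j) ?H" if ij: "j < i" for i j
  proof
    assume eq: "translate (f i) ?H = translate (f j) ?H"
    have rep: "?c i = ?c j @ ?c (i - j)" using ij by (simp flip: replicate_add)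
    have "red (f i) \<in> translate (f i) ?H" unfolding translate_def red_def using H(2) by blast
    then have "red (f i) \<in> translate (f j) ?H" unfolding eq .
    then obtain h where h: "h \<in> ?H" "red (f i) = foldr push_letter (f j) h"
      unfolding translate_def by (rule imageE)
    then have "red (f i) = red (f j @ h)" using H(1) by (metis foldr_push_red mem_Collect_eq red_reduced subsetD)
    then have "red (inv_word (f j) @ f i) = red (inv_word (f j) @ f j @ h)"
      by (metis red_append)
    also have "\<dots> = red h" using red_cancel(2)[of "[]" "f j" h] by simp
    also have "\<dots> = h" using h(1) H(1) red_reduced by blast
    finally have "reads \<delta> (red (inv_word (f j) @ f i)) s0 s0" using h(1) by (simp add: loops_def)
    then have "reads \<delta> (w @ red (inv_word (f j) @ f i) @ inv_word w) y y"
      using w reads_inv[OF w] reads_append by blast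
    then have "reads \<delta> (red (w @ red (inv_word (f j) @ f i) @ inv_word w)) y y" by (rule reads_red)
    also have "red (w @ red (inv_word (f j) @ f i) @ inv_word w) =
        red (w @ (inv_word (f j) @ f i) @ inv_word w)"
      by (metis red_append red_red_append)
    also have "\<dots> = red (letter_inv x # ?c (i - j) @ [x])"
      using red_cancel(1)[of "[]" w "letter_inv x # inv_word (?c j) @ ?c j @ ?c (i - j) @ x # w @ inv_word w"]
        red_cancel(2)[of "[letter_inv x]" "?c j" "?c (i - j) @ x # w @ inv_word w"]
        red_cancel(1)[of "letter_inv x # ?c (i - j) @ [x]" w "[]"]
      by (simp add: f_def rep)
    also have "\<dots> = letter_inv x # ?c (i - j) @ [x]"
    proof (rule red_reduced)
      have k: "?c (i - j) = (c, True) # ?c (i - j - 1)" using ij by (cases "i - j") auto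
      have "x \<noteq> letter_inv (c, True)" "(c, True) \<noteq> x" using c(2) by (auto simp: letter_inv_def)
      moreover have "last (?c (i - j)) = (c, True)" using ij by simp
      moreover have "reduced_word ((?c (i - j)) @ [x])"
        using calculation reduced_replicate[of "i - j" "(c, True)"] by (auto simp: reduced_append reduced_Cons)
      ultimately show "reduced_word (letter_inv x # ?c (i - j) @ [x])"
        unfolding reduced_Cons by (subst k) simp
    qed
    finally have "reads \<delta> ((letter_inv x # ?c (i - j)) @ [x]) y y" by simp
    then show False using x(2) unfolding reads_append by auto
  qed
  then have "inj (\<lambda>i. translate (f i) ?H)" unfolding inj_def by (metis linorder_neqE_nat)
  then have "infinite (range (\<lambda>i. translate (f i) ?H))" by (rule range_inj_infinite)
  moreover have "range (\<lambda>i. translate (f i) ?H) \<subseteq> (\<lambda>u. translate u ?H) ` lists (letters A)"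
    using fL by blast
  ultimately show ?thesis unfolding infinite_index_def using finite_subset by blast
qed

end

section \<open>The finite levels of the Cayley graph\<close>

text \<open>Steps run against the edges: Cayley edges multiply on the right while
  \<open>reads\<close> consumes the last letter first, so a path from \<open>t\<close> to
  \<open>s\<close> with label \<open>w\<close> is a run from \<open>s\<close> to
  \<open>t\<close>.\<close>

definition label_step ::
    "('v \<times> 'a letter \<Rightarrow> 'v) \<Rightarrow> ('v \<times> 'a letter) set \<Rightarrow> 'a letter \<Rightarrow> 'v \<Rightarrow> 'v \<Rightarrow> bool" where
  "label_step tr E x s t \<longleftrightarrow> (t, x) \<in> E \<and> tr (t, x) = s"

definition edge_relation :: "('v \<times> 'a letter \<Rightarrow> 'v) \<Rightarrow> ('v \<times> 'a letter) set \<Rightarrow> ('v \<times> 'v) set" where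
  "edge_relation tr E = {(fst e, tr e) |e. e \<in> E}"

lemma rtrancl_edge_relation_iff:
  "(t, s) \<in> (edge_relation tr E)\<^sup>* \<longleftrightarrow> (\<exists>w. reads (label_step tr E) w s t)"
proof
  assume "(t, s) \<in> (edge_relation tr E)\<^sup>*"
  then show "\<exists>w. reads (label_step tr E) w s t"
  proof (induction rule: converse_rtrancl_induct)
    case base
    show ?case by (rule exI[of _ "[]"]) simp
  next
    case (step t m)
    obtain w where "reads (label_step tr E) w s m" using step.IH by blast
    moreover obtain x where "label_step tr E x m t"
      using step.hyps(1) unfolding edge_relation_def label_step_def by force
    ultimately show ?case by (intro exI[of _ "x # w"]) auto
  qed
next
  assume "\<exists>w. reads (label_step tr E) w s t"
  then obtain w where "reads (label_step tr E) w s t" ..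
  then show "(t, s) \<in> (edge_relation tr E)\<^sup>*"
  proof (induction w arbitrary: t)
    case (Cons x w)
    then obtain m where m: "reads (label_step tr E) w s m" "label_step tr E x m t" by auto
    then have "(t, x) \<in> E" "m = tr (t, x)" by (simp_all add: label_step_def)
    moreover from this have "(fst (t, x), tr (t, x)) \<in> edge_relation tr E"
      unfolding edge_relation_def by blast
    ultimately have "(t, m) \<in> edge_relation tr E" by simp
    then show ?case using Cons.IH[OF m(1)] by (rule converse_rtrancl_into_rtrancl)
  qed simp
qed

lemma reads_label_step_mono:
  assumes "\<And>t x. (t, x) \<in> E \<Longrightarrow> (h t, x) \<in> E' \<and> tr' (h t, x) = h (tr (t, x))"
  shows "reads (label_step tr E) w s t \<Longrightarrow> reads (label_step tr' E') w (h s) (h t)"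
proof (induction w arbitrary: t)
  case (Cons x w)
  then obtain m where m: "reads (label_step tr E) w s m" "label_step tr E x m t" by auto
  then have "label_step tr' E' x (h m) (h t)" using assms[of t x] by (auto simp: label_step_def)
  then show ?case using Cons.IH[OF m(1)] by auto
qed simp

text \<open>Traced back from its end \<open>t\<close>, a run is determined by the word and
  \<open>tr\<close> alone, so both runs use the same edges.\<close>

lemma reads_label_step_Int:
  "reads (label_step tr E) w s t \<Longrightarrow> reads (label_step tr E') w s t \<Longrightarrow>
    reads (label_step tr (E \<inter> E')) w s t"
proof (induction w arbitrary: t)
  case (Cons x w)
  then obtain m m' where m: "reads (label_step tr E) w s m" "label_step tr E x m t"
    "reads (label_step tr E') w s m'" "label_step tr E' x m' t" by auto
  then have "m' = m" "label_step tr (E \<inter> E') x m t" by (auto simp: label_step_def)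
  then show ?case using Cons.IH[of m] m by auto
qed simp

section \<open>Vertices, edges and bonding maps of the finite levels\<close>

context separating_quotients
begin

abbreviation "vert M \<equiv> verts (quotient_cayley_graph A M)"
abbreviation "edge M \<equiv> edges (quotient_cayley_graph A M)"
abbreviation "trm M \<equiv> ter (quotient_cayley_graph A M)"
abbreviation "einvm M \<equiv> einv (quotient_cayley_graph A M)"
abbreviation "pV \<equiv> \<lambda>M (M' :: 'a letter list set) C. M <#>\<^bsub>F\<^esub> C"
abbreviation "pE \<equiv> \<lambda>M (M' :: 'a letter list set) (C, x :: 'a letter). (M <#>\<^bsub>F\<^esub> C, x)"
abbreviation "\<Gamma> \<equiv> pro_cayley_graph A NN"

lemma vert_eq: "vert M = rcosets\<^bsub>F\<^esub> M"
  and edge_eq: "edge M = vert M \<times> letters A"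
  and ini_eq: "ini (quotient_cayley_graph A M) = fst"
  and trm_eq: "trm M (C, x) = C <#>\<^bsub>F\<^esub> (M #>\<^bsub>F\<^esub> [x])"
  and einvm_eq: "einvm M (C, x) = (trm M (C, x), letter_inv x)"
  and pos_eq: "pos (quotient_cayley_graph A M) = vert M \<times> {x \<in> letters A. snd x}"
  by (simp_all add: quotient_cayley_graph_def cayley_graph_def FactGroup_def)

lemma letter_carrier: "x \<in> letters A \<Longrightarrow> [x] \<in> carrier F"
  by (simp add: carrier_free_group reduced_Cons)

lemma red_carrier: "w \<in> lists (letters A) \<Longrightarrow> red w \<in> carrier F"
  using red_in_lists by (simp add: carrier_free_group)

lemma carrier_lists: "g \<in> carrier F \<Longrightarrow> g \<in> lists (letters A)"
  by (simp add: carrier_free_group)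

lemma vertE:
  assumes "C \<in> vert M" obtains g where "g \<in> carrier F" "C = M #>\<^bsub>F\<^esub> g"
  using assms unfolding vert_eq RCOSETS_def by blast

lemma coset_vert: "g \<in> carrier F \<Longrightarrow> M #>\<^bsub>F\<^esub> g \<in> vert M"
  unfolding vert_eq RCOSETS_def by blast

lemma trm_coset:
  assumes "M \<in> NN" "g \<in> carrier F" "x \<in> letters A"
  shows "trm M (M #>\<^bsub>F\<^esub> g, x) = M #>\<^bsub>F\<^esub> red (g @ [x])"
  using normal.rcos_sum[OF NN_normal_finite(1)[OF assms(1)] assms(2) letter_carrier[OF assms(3)]]
  by (simp add: trm_eq mult_free_group reduced_Cons)

lemma bond_coset:
  assumes "M \<in> NN" "M' \<in> NN" "M' \<subseteq> M" "g \<in> carrier F"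
  shows "M <#>\<^bsub>F\<^esub> (M' #>\<^bsub>F\<^esub> g) = M #>\<^bsub>F\<^esub> g"
proof -
  interpret M: normal M F using NN_normal_finite(1)[OF assms(1)] .
  interpret M': normal M' F using NN_normal_finite(1)[OF assms(2)] .
  have "M <#>\<^bsub>F\<^esub> (M' #>\<^bsub>F\<^esub> g) = (M <#>\<^bsub>F\<^esub> M') #>\<^bsub>F\<^esub> g"
    using M.subset M'.subset assms(4) F.setmult_rcos_assoc by simp
  also have "M <#>\<^bsub>F\<^esub> M' = M"
  proof
    show "M <#>\<^bsub>F\<^esub> M' \<subseteq> M" using assms(3) M.m_closed unfolding set_mult_def by blast
    show "M \<subseteq> M <#>\<^bsub>F\<^esub> M'"
    proof
      fix m assume "m \<in> M"
      then have "m = m \<otimes>\<^bsub>F\<^esub> \<one>\<^bsub>F\<^esub>" using M.mem_carrier by simp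
      then show "m \<in> M <#>\<^bsub>F\<^esub> M'" using \<open>m \<in> M\<close> M'.one_closed unfolding set_mult_def by blast
    qed
  qed
  finally show ?thesis .
qed

lemma bond_trm:
  assumes "M \<in> NN" "M' \<in> NN" "M' \<subseteq> M" "C \<in> vert M'" "x \<in> letters A"
  shows "M <#>\<^bsub>F\<^esub> trm M' (C, x) = trm M (M <#>\<^bsub>F\<^esub> C, x)"
proof -
  obtain g where g: "g \<in> carrier F" "C = M' #>\<^bsub>F\<^esub> g" using assms(4) by (rule vertE)
  have "red (g @ [x]) \<in> carrier F" using g(1) assms(5) carrier_lists by (intro red_carrier) auto
  then show ?thesis using assms g by (simp add: trm_coset bond_coset)
qed

text \<open>The image of \<open>F\<close> in its completion; it shows that every vertex of a level
  extends to a thread.\<close>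

lemma principal_vertex: "g \<in> carrier F \<Longrightarrow> (\<lambda>M\<in>NN. M #>\<^bsub>F\<^esub> g) \<in> proj_limit NN (\<supseteq>) vert pV"
  unfolding proj_limit_def using coset_vert bond_coset by (auto simp: restrict_PiE_iff)

lemma principal_edge:
  "g \<in> carrier F \<Longrightarrow> x \<in> letters A \<Longrightarrow> (\<lambda>M\<in>NN. (M #>\<^bsub>F\<^esub> g, x)) \<in> proj_limit NN (\<supseteq>) edge pE"
  unfolding proj_limit_def edge_eq using coset_vert bond_coset by (auto simp: restrict_PiE_iff)

lemma bond_vert:
  assumes "M \<in> NN" "M' \<in> NN" "M' \<subseteq> M" "C \<in> vert M'"
  shows "M <#>\<^bsub>F\<^esub> C \<in> vert M"
proof -
  obtain g where "g \<in> carrier F" "C = M' #>\<^bsub>F\<^esub> g" using assms(4) by (rule vertE)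
  then show ?thesis using assms bond_coset coset_vert by simp
qed

lemma bond_bond:
  assumes "M \<in> NN" "M' \<in> NN" "M'' \<in> NN" "M'' \<subseteq> M'" "M' \<subseteq> M" "C \<in> vert M''"
  shows "M <#>\<^bsub>F\<^esub> (M' <#>\<^bsub>F\<^esub> C) = M <#>\<^bsub>F\<^esub> C"
proof -
  obtain g where g: "g \<in> carrier F" "C = M'' #>\<^bsub>F\<^esub> g" using assms(6) by (rule vertE)
  have "M'' \<subseteq> M" using assms by blast
  then show ?thesis using assms g bond_coset by simp
qed

sublocale V: inverse_system NN vert pV
proof
  show "NN \<noteq> {}" using carrier_in_NN by blast
  show "finite (vert M)" if "M \<in> NN" for M using NN_normal_finite(2)[OF that] by (simp add: vert_eq)
  show "\<exists>z\<in>proj_limit NN (\<supseteq>) vert pV. z M = C" if M: "M \<in> NN" "C \<in> vert M" for M C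
  proof -
    obtain g where "g \<in> carrier F" "C = M #>\<^bsub>F\<^esub> g" using M(2) by (rule vertE)
    then show ?thesis using M(1) principal_vertex by (intro bexI[of _ "\<lambda>M\<in>NN. M #>\<^bsub>F\<^esub> g"]) auto
  qed
qed (fact NN_Int bond_vert bond_bond)+

sublocale E: inverse_system NN edge pE
proof
  show "NN \<noteq> {}" using carrier_in_NN by blast
  show "finite (edge M)" if "M \<in> NN" for M
    using V.finite_S[OF that] finite_A by (simp add: edge_eq letters_def)
  show "\<exists>z\<in>proj_limit NN (\<supseteq>) edge pE. z M = e" if M: "M \<in> NN" "e \<in> edge M" for M e
  proof -
    obtain C x where e: "e = (C, x)" "C \<in> vert M" "x \<in> letters A" using M(2) unfolding edge_eq by blast
    obtain g where "g \<in> carrier F" "C = M #>\<^bsub>F\<^esub> g" using e(2) by (rule vertE)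
    then show ?thesis
      using M(1) e principal_edge by (intro bexI[of _ "\<lambda>M\<in>NN. (M #>\<^bsub>F\<^esub> g, x)"]) auto
  qed
  show "pE M M' e \<in> edge M" if "M \<in> NN" "M' \<in> NN" "M' \<subseteq> M" "e \<in> edge M'" for M M' e
    using that bond_vert unfolding edge_eq by auto
  show "pE M M' (pE M' M'' e) = pE M M'' e"
    if "M \<in> NN" "M' \<in> NN" "M'' \<in> NN" "M'' \<subseteq> M'" "M' \<subseteq> M" "e \<in> edge M''" for M M' M'' e
    using that bond_bond unfolding edge_eq by auto
qed (fact NN_Int)

lemma verts_\<Gamma>: "verts \<Gamma> = V.L" and edges_\<Gamma>: "edges \<Gamma> = E.L"
  and vtop_\<Gamma>: "vtop \<Gamma> = V.limtop" and etop_\<Gamma>: "etop \<Gamma> = E.limtop"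
  and pos_\<Gamma>: "pos \<Gamma> = proj_limit NN (\<supseteq>) (\<lambda>M. pos (quotient_cayley_graph A M)) pE"
  by (simp_all add: pro_cayley_graph_def proj_limit_graph_def)

lemma ini_\<Gamma>: "M \<in> NN \<Longrightarrow> ini \<Gamma> e M = fst (e M)"
  and ter_\<Gamma>: "M \<in> NN \<Longrightarrow> ter \<Gamma> e M = trm M (e M)"
  and einv_\<Gamma>: "M \<in> NN \<Longrightarrow> einv \<Gamma> e M = einvm M (e M)"
  by (simp_all add: pro_cayley_graph_def proj_limit_graph_def ini_eq)

lemma edge_label_const:
  assumes "e \<in> E.L" "M \<in> NN" "M' \<in> NN"
  shows "snd (e M) = snd (e M')"
proof -
  have "pE M (M \<inter> M') (e (M \<inter> M')) = e M" "pE M' (M \<inter> M') (e (M \<inter> M')) = e M'"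
    using E.limit_bond[OF assms(1)] assms(2,3) NN_Int by blast+
  then show ?thesis by (metis (no_types, lifting) case_prod_unfold snd_conv)
qed

lemma pos_\<Gamma>_iff:
  assumes "e \<in> E.L" "M \<in> NN"
  shows "e \<in> pos \<Gamma> \<longleftrightarrow> e M \<in> pos (quotient_cayley_graph A M)"
proof
  assume "e \<in> pos \<Gamma>"
  then show "e M \<in> pos (quotient_cayley_graph A M)"
    using assms(2) unfolding pos_\<Gamma> proj_limit_def by auto
next
  assume pos: "e M \<in> pos (quotient_cayley_graph A M)"
  have "e M' \<in> pos (quotient_cayley_graph A M')" if "M' \<in> NN" for M'
    using E.limit_mem[OF assms(1) that] edge_label_const[OF assms that] pos
    unfolding edge_eq pos_eq by (auto simp: mem_Times_iff)
  then show "e \<in> pos \<Gamma>" using assms(1) unfolding pos_\<Gamma> proj_limit_def by (auto simp: PiE_iff)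
qed

end

section \<open>Connected subgraphs of the profinite Cayley graph\<close>

lemma (in inverse_system) level_continuous:
  assumes "M \<in> I" "V \<subseteq> L"
  shows "continuous_map (subtopology limtop V) (discrete_topology (h ` (\<lambda>v. v M) ` V)) (\<lambda>v. h (v M))"
  unfolding continuous_map_def
proof (intro conjI allI impI)
  have top: "topspace (subtopology limtop V) = V" using assms(2) by auto
  show "(\<lambda>v. h (v M)) \<in> topspace (subtopology limtop V) \<rightarrow> topspace (discrete_topology (h ` (\<lambda>v. v M) ` V))"
    unfolding top by auto
  fix U
  have "{v \<in> V. h (v M) \<in> U} = {z \<in> L. z M \<in> h -` U} \<inter> V" using assms(2) by auto
  then show "openin (subtopology limtop V) {v \<in> topspace (subtopology limtop V). h (v M) \<in> U}"
    unfolding top openin_subtopology using cylinder_open[OF assms(1)] by blast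
qed

lemma reads_label_step_Cons:
  "reads (label_step tr E) (x # w) s t \<longleftrightarrow> (t, x) \<in> E \<and> reads (label_step tr E) w s (tr (t, x))"
proof -
  have "label_step tr E x m t \<longleftrightarrow> (t, x) \<in> E \<and> tr (t, x) = m" for m by (rule label_step_def)
  then show ?thesis unfolding reads.simps by metis
qed

context separating_quotients
begin

definition level :: "'i \<Rightarrow> ('i \<Rightarrow> 'x) set \<Rightarrow> 'x set" where
  "level M Z = (\<lambda>z. z M) ` Z"

abbreviation "rel M E \<equiv> edge_relation (trm M) E"

definition level_connected where
  "level_connected M V E \<longleftrightarrow> (\<forall>s\<in>V. \<forall>t\<in>V. (s, t) \<in> (rel M E)\<^sup>*)"

lemma quotient_serre:
  assumes "M \<in> NN" "e \<in> edge M"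
  shows "fst e \<in> vert M" "trm M e \<in> vert M" "einvm M e \<in> edge M" "einvm M (einvm M e) = e"
    "fst (einvm M e) = trm M e" "trm M (einvm M e) = fst e"
    "einvm M e \<in> pos (quotient_cayley_graph A M) \<longleftrightarrow> e \<notin> pos (quotient_cayley_graph A M)"
  using serre_graph_quotient_cayley_graph[OF NN_normal_finite(1)[OF assms(1)]] assms(2)
  unfolding serre_graph_def ini_eq by blast+

lemma closed_subgraphD:
  assumes "closed_subgraph \<Gamma> V E"
  shows "V \<subseteq> V.L" "E \<subseteq> E.L" "closedin V.limtop V" "closedin E.limtop E"
    "\<And>e. e \<in> E \<Longrightarrow> ini \<Gamma> e \<in> V \<and> ter \<Gamma> e \<in> V \<and> einv \<Gamma> e \<in> E"
  using assms unfolding closed_subgraph_def verts_\<Gamma> edges_\<Gamma> vtop_\<Gamma> etop_\<Gamma> by blast+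

lemma level_subgraph:
  assumes "closed_subgraph \<Gamma> V E" "M \<in> NN"
  shows "level M V \<subseteq> vert M" "level M E \<subseteq> edge M"
    "\<And>e. e \<in> level M E \<Longrightarrow> fst e \<in> level M V \<and> trm M e \<in> level M V \<and> einvm M e \<in> level M E"
proof -
  note cs = closed_subgraphD[OF assms(1)]
  show "level M V \<subseteq> vert M" using cs(1) V.limit_mem[OF _ assms(2)] unfolding level_def by blast
  show "level M E \<subseteq> edge M" using cs(2) E.limit_mem[OF _ assms(2)] unfolding level_def by blast
  fix e assume "e \<in> level M E"
  then obtain z where z: "z \<in> E" "e = z M" unfolding level_def by blast
  then show "fst e \<in> level M V \<and> trm M e \<in> level M V \<and> einvm M e \<in> level M E"
    using cs(5)[OF z(1)] ini_\<Gamma>[OF assms(2), of z] ter_\<Gamma>[OF assms(2), of z] einv_\<Gamma>[OF assms(2), of z]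
    unfolding level_def by (metis imageI)
qed

section \<open>Profinite connectedness tested on the finite levels\<close>

lemma restrict_graph_\<Gamma>:
  "verts (restrict_graph \<Gamma> V E) = V" "edges (restrict_graph \<Gamma> V E) = E"
  "ini (restrict_graph \<Gamma> V E) = ini \<Gamma>" "ter (restrict_graph \<Gamma> V E) = ter \<Gamma>"
  "einv (restrict_graph \<Gamma> V E) = einv \<Gamma>" "pos (restrict_graph \<Gamma> V E) = pos \<Gamma> \<inter> E"
  "vtop (restrict_graph \<Gamma> V E) = subtopology V.limtop V"
  "etop (restrict_graph \<Gamma> V E) = subtopology E.limtop E"
  by (simp_all add: restrict_graph_def vtop_\<Gamma> etop_\<Gamma>)

text \<open>The vertex map of a finite quotient factors through some level \<open>M\<close>. Paths
  there are lifted edge by edge; consecutive lifts fit only up to equality at level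
  \<open>M\<close>, which the vertex map does not notice.\<close>

lemma profinite_connectedI:
  assumes cs: "closed_subgraph \<Gamma> V E"
    and conn: "\<And>M. M \<in> NN \<Longrightarrow> level_connected M (level M V) (level M E)"
  shows "profinite_connected (restrict_graph \<Gamma> V E)"
  unfolding profinite_connected_def restrict_graph_\<Gamma>
proof (intro allI impI, elim conjE)
  fix D :: "(nat, nat) sgraph" and p q
  assume mor: "graph_morphism (restrict_graph \<Gamma> V E) D p q" and pV: "p ` V = verts D"
    and cont: "continuous_map (subtopology V.limtop V) (discrete_topology (verts D)) p"
  note cs' = closed_subgraphD[OF cs]
  obtain M where M: "M \<in> NN" "\<And>v w. v \<in> V \<Longrightarrow> w \<in> V \<Longrightarrow> v M = w M \<Longrightarrow> p v = p w"
    using V.continuous_factor[OF cs'(3) cont] by blast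
  let ?R = "{(ini D e, ter D e) |e. e \<in> edges D}"
  have path: "\<exists>z\<in>V. z M = s \<and> (p v, p z) \<in> ?R\<^sup>*"
    if "(v M, s) \<in> (rel M (level M E))\<^sup>*" "v \<in> V" for v s
    using that(1)
  proof (induction rule: rtrancl_induct)
    case base
    then show ?case using that(2) by blast
  next
    case (step s s')
    then obtain z where z: "z \<in> V" "z M = s" "(p v, p z) \<in> ?R\<^sup>*" by blast
    obtain e where e: "e \<in> level M E" "s = fst e" "s' = trm M e"
      using step.hyps(2) unfolding edge_relation_def by blast
    obtain \<epsilon> where \<epsilon>: "\<epsilon> \<in> E" "e = \<epsilon> M" using e(1) unfolding level_def by blast
    note ends = cs'(5)[OF \<epsilon>(1)]
    have "ini \<Gamma> \<epsilon> M = z M" using ini_\<Gamma>[OF M(1)] e \<epsilon> z by simp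
    then have "p (ini \<Gamma> \<epsilon>) = p z" using M(2) ends z(1) by blast
    moreover have "q \<epsilon> \<in> edges D" "ini D (q \<epsilon>) = p (ini \<Gamma> \<epsilon>)" "ter D (q \<epsilon>) = p (ter \<Gamma> \<epsilon>)"
      using mor \<epsilon>(1) unfolding graph_morphism_def restrict_graph_\<Gamma> by auto
    ultimately have "(p z, p (ter \<Gamma> \<epsilon>)) \<in> ?R" by (metis (mono_tags, lifting) mem_Collect_eq)
    then have "(p v, p (ter \<Gamma> \<epsilon>)) \<in> ?R\<^sup>*" using z(3) by (rule rtrancl_into_rtrancl[rotated])
    moreover have "ter \<Gamma> \<epsilon> M = s'" using ter_\<Gamma>[OF M(1)] e \<epsilon> by simp
    ultimately show ?case using ends by blast
  qed
  show "graph_connected D"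
    unfolding graph_connected_def pV[symmetric]
  proof (intro ballI, elim imageE)
    fix a b v w assume ab: "a = p v" "v \<in> V" "b = p w" "w \<in> V"
    have "(v M, w M) \<in> (rel M (level M E))\<^sup>*"
      using conn[OF M(1)] ab unfolding level_connected_def level_def by blast
    then obtain z where "z \<in> V" "z M = w M" "(p v, p z) \<in> ?R\<^sup>*" using path ab(2) by blast
    then show "(a, b) \<in> ?R\<^sup>*" using M(2)[of z w] ab by simp
  qed
qed

text \<open>With vertices and edges numbered by naturals, the image at level \<open>M\<close> is
  itself one of the finite continuous quotients.\<close>

lemma profinite_connectedD:
  assumes cs: "closed_subgraph \<Gamma> V E" and pc: "profinite_connected (restrict_graph \<Gamma> V E)"
    and M: "M \<in> NN"
  shows "level_connected M (level M V) (level M E)"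
proof -
  note cs' = closed_subgraphD[OF cs] and lev = level_subgraph[OF cs M]
  let ?VM = "level M V" and ?EM = "level M E" and ?P = "pos (quotient_cayley_graph A M)"
  have "finite ?VM" "finite ?EM"
    using lev(1,2) V.finite_S[OF M] E.finite_S[OF M] by (blast intro: finite_subset)+
  then obtain f g :: "_ \<Rightarrow> nat" where f: "inj_on f ?VM" and g: "inj_on g ?EM"
    using finite_imp_inj_to_nat_seg by metis
  define g' where "g' = inv_into ?EM g"
  have g': "g' (g e) = e" if "e \<in> ?EM" for e unfolding g'_def using g that by (rule inv_into_f_f)
  define D where "D = \<lparr>verts = f ` ?VM, edges = g ` ?EM, ini = (\<lambda>n. f (fst (g' n))),
    ter = (\<lambda>n. f (trm M (g' n))), einv = (\<lambda>n. g (einvm M (g' n))), pos = g ` (?EM \<inter> ?P)\<rparr>"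
  have D: "verts D = f ` ?VM" "edges D = g ` ?EM" "\<And>e. e \<in> ?EM \<Longrightarrow> ini D (g e) = f (fst e)"
    "\<And>e. e \<in> ?EM \<Longrightarrow> ter D (g e) = f (trm M e)" "\<And>e. e \<in> ?EM \<Longrightarrow> einv D (g e) = g (einvm M e)"
    by (simp_all add: D_def g')
  have D_pos: "g e \<in> pos D \<longleftrightarrow> e \<in> ?P" if "e \<in> ?EM" for e
    using that inj_on_image_mem_iff[OF g, of e "?EM \<inter> ?P"] by (simp add: D_def)
  have "serre_graph D"
    unfolding serre_graph_def
  proof (intro conjI ballI)
    show "pos D \<subseteq> edges D" by (auto simp: D_def)
    fix n assume "n \<in> edges D"
    then obtain e where e: "e \<in> ?EM" "n = g e" unfolding D by blast
    have ee: "e \<in> edge M" using e(1) lev(2) by blast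
    note qs = quotient_serre[OF M ee] and l3 = lev(3)[OF e(1)]
    have inv: "einvm M e \<in> ?EM" using l3 by blast
    show "ini D n \<in> verts D" "ter D n \<in> verts D" "einv D n \<in> edges D"
      using e l3 by (simp_all add: D)
    show "einv D (einv D n) = n" "ini D (einv D n) = ter D n" "ter D (einv D n) = ini D n"
      using e inv qs by (simp_all add: D)
    show "einv D n \<in> pos D \<longleftrightarrow> n \<notin> pos D"
      using e inv qs by (simp add: D D_pos)
  qed
  moreover have "graph_morphism (restrict_graph \<Gamma> V E) D (\<lambda>v. f (v M)) (\<lambda>e. g (e M))"
    unfolding graph_morphism_def restrict_graph_\<Gamma>
  proof (intro conjI ballI)
    show "(\<lambda>v. f (v M)) \<in> V \<rightarrow> verts D" "(\<lambda>e. g (e M)) \<in> E \<rightarrow> edges D"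
      unfolding D level_def by auto
    fix e assume e: "e \<in> E"
    then have eM: "e M \<in> ?EM" unfolding level_def by blast
    show "ini D (g (e M)) = f (ini \<Gamma> e M)" "ter D (g (e M)) = f (ter \<Gamma> e M)"
      "einv D (g (e M)) = g (einv \<Gamma> e M)"
      using eM by (simp_all add: D ini_\<Gamma>[OF M] ter_\<Gamma>[OF M] einv_\<Gamma>[OF M])
    have "e \<in> E.L" using e cs'(2) by blast
    then show "g (e M) \<in> pos D \<longleftrightarrow> e \<in> pos \<Gamma> \<inter> E"
      using e eM D_pos pos_\<Gamma>_iff[OF _ M] by blast
  qed
  moreover have "(\<lambda>v. f (v M)) ` V = verts D" "(\<lambda>e. g (e M)) ` E = edges D"
    unfolding D level_def by (simp_all add: image_image)
  moreover have "continuous_map (subtopology V.limtop V) (discrete_topology (verts D)) (\<lambda>v. f (v M))"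
    "continuous_map (subtopology E.limtop E) (discrete_topology (edges D)) (\<lambda>e. g (e M))"
    unfolding D level_def
    using V.level_continuous[OF M cs'(1), of f] E.level_continuous[OF M cs'(2), of g] by simp_all
  moreover have "finite (verts D)" "finite (edges D)"
    unfolding D using \<open>finite ?VM\<close> \<open>finite ?EM\<close> by simp_all
  ultimately have conn: "graph_connected D"
    using pc unfolding profinite_connected_def restrict_graph_\<Gamma> by blast
  let ?R = "{(ini D e, ter D e) |e. e \<in> edges D}"
  have pull: "\<exists>t\<in>?VM. n = f t \<and> (s, t) \<in> (rel M ?EM)\<^sup>*" if "(f s, n) \<in> ?R\<^sup>*" "s \<in> ?VM" for s n
    using that(1)
  proof (induction rule: rtrancl_induct)
    case base
    then show ?case using that(2) by blast
  next
    case (step n n')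
    then obtain t where t: "t \<in> ?VM" "n = f t" "(s, t) \<in> (rel M ?EM)\<^sup>*" by blast
    obtain e where e: "e \<in> ?EM" "n = f (fst e)" "n' = f (trm M e)"
      using step.hyps(2) D by auto
    have "t = fst e" using inj_onD[OF f] t e lev(3)[OF e(1)] by metis
    then have "(t, trm M e) \<in> rel M ?EM" using e(1) unfolding edge_relation_def by blast
    then have "(s, trm M e) \<in> (rel M ?EM)\<^sup>*" using t(3) by (rule rtrancl_into_rtrancl[rotated])
    then show ?case using e lev(3)[OF e(1)] by blast
  qed
  show ?thesis
    unfolding level_connected_def
  proof (intro ballI)
    fix s t assume st: "s \<in> ?VM" "t \<in> ?VM"
    then have "(f s, f t) \<in> ?R\<^sup>*" using conn unfolding graph_connected_def D(1) by blast
    then obtain t' where "t' \<in> ?VM" "f t = f t'" "(s, t') \<in> (rel M ?EM)\<^sup>*" using pull st(1) by blast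
    then show "(s, t) \<in> (rel M ?EM)\<^sup>*" using inj_onD[OF f] st(2) by metis
  qed
qed

lemma inverse_automaton_level:
  assumes "M \<in> NN" "E \<subseteq> edge M" "\<And>e. e \<in> E \<Longrightarrow> einvm M e \<in> E"
  shows "inverse_automaton (label_step (trm M) E)"
proof
  have e: "einvm M (t, x) = (trm M (t, x), letter_inv x)" for t x
    by (rule einvm_eq)
  fix x s t t' assume st: "label_step (trm M) E x s t"
  then have tx: "(t, x) \<in> E" "trm M (t, x) = s" by (simp_all add: label_step_def)
  then have pull: "einvm M (s, letter_inv x) = (t, x)" "trm M (s, letter_inv x) = t"
    using quotient_serre[OF assms(1), of "(t, x)"] assms(2) e[of t x] by auto
  show "label_step (trm M) E (letter_inv x) t s"
    using assms(3)[OF tx(1)] tx(2) pull(2) e[of t x] by (simp add: label_step_def)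
  assume "label_step (trm M) E x s t'"
  then have tx': "(t', x) \<in> E" "trm M (t', x) = s" by (simp_all add: label_step_def)
  then have "einvm M (s, letter_inv x) = (t', x)"
    using quotient_serre(4)[OF assms(1), of "(t', x)"] assms(2) e[of t' x] by auto
  then show "t = t'" using pull(1) by simp
qed

lemma reads_level_coset:
  assumes "M \<in> NN" "E \<subseteq> edge M"
  shows "reads (label_step (trm M) E) w s (M #>\<^bsub>F\<^esub> g) \<Longrightarrow> g \<in> carrier F \<Longrightarrow>
    w \<in> lists (letters A) \<and> s = M #>\<^bsub>F\<^esub> red (g @ w)"
proof (induction w arbitrary: g)
  case Nil
  then show ?case by (simp add: carrier_free_group red_reduced)
next
  case (Cons x w)
  then obtain m where m: "reads (label_step (trm M) E) w s m" "(M #>\<^bsub>F\<^esub> g, x) \<in> E"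
    "trm M (M #>\<^bsub>F\<^esub> g, x) = m" unfolding reads_label_step_Cons by blast
  have x: "x \<in> letters A" using m(2) assms(2) unfolding edge_eq by blast
  have "g @ [x] \<in> lists (letters A)" using Cons.prems(2) carrier_lists x by simp
  then have "red (g @ [x]) \<in> carrier F" by (rule red_carrier)
  moreover have "m = M #>\<^bsub>F\<^esub> red (g @ [x])" using trm_coset[OF assms(1) Cons.prems(2) x] m(3) by simp
  ultimately have "w \<in> lists (letters A) \<and> s = M #>\<^bsub>F\<^esub> red (red (g @ [x]) @ w)"
    using Cons.IH m(1) by blast
  then show ?case using x by simp
qed

lemma sym_rel:
  assumes "M \<in> NN" "E \<subseteq> edge M" "\<And>e. e \<in> E \<Longrightarrow> einvm M e \<in> E"
  shows "sym ((rel M E)\<^sup>*)"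
proof (rule sym_rtrancl, rule symI)
  fix s t assume "(s, t) \<in> rel M E"
  then obtain e where e: "e \<in> E" "s = fst e" "t = trm M e" unfolding edge_relation_def by blast
  have "e \<in> edge M" using e(1) assms(2) by blast
  from quotient_serre[OF assms(1) this] have "t = fst (einvm M e)" "s = trm M (einvm M e)"
    using e by simp_all
  then show "(t, s) \<in> rel M E" using assms(3)[OF e(1)] unfolding edge_relation_def by blast
qed

lemma reads_bond:
  assumes M: "M \<in> NN" "M' \<in> NN" "M' \<subseteq> M" and E: "E' \<subseteq> edge M'" "pE M M' ` E' \<subseteq> E"
    and r: "reads (label_step (trm M') E') w s t"
  shows "reads (label_step (trm M) E) w (M <#>\<^bsub>F\<^esub> s) (M <#>\<^bsub>F\<^esub> t)"
proof (rule reads_label_step_mono[OF _ r, where h = "\<lambda>C. M <#>\<^bsub>F\<^esub> C"])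
  fix t x assume tx: "(t, x) \<in> E'"
  then have "pE M M' (t, x) \<in> E" using E(2) by blast
  moreover have "t \<in> vert M'" "x \<in> letters A" using tx E(1) unfolding edge_eq by blast+
  ultimately show "(M <#>\<^bsub>F\<^esub> t, x) \<in> E \<and> trm M (M <#>\<^bsub>F\<^esub> t, x) = M <#>\<^bsub>F\<^esub> trm M' (t, x)"
    using bond_trm[OF M] by simp
qed

lemma level_bond:
  assumes "E \<subseteq> E.L" "M \<in> NN" "M' \<in> NN" "M' \<subseteq> M"
  shows "pE M M' ` level M' E \<subseteq> level M E"
proof
  fix e assume "e \<in> pE M M' ` level M' E"
  then obtain z where z: "z \<in> E" "e = pE M M' (z M')" unfolding level_def by blast
  then have "e = z M" using E.limit_bond[OF _ assms(2-4)] assms(1) by blast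
  then show "e \<in> level M E" using z(1) unfolding level_def by blast
qed

text \<open>A subgraph that is not full at one of its vertices has a fundamental group of infinite index;
  this is the case whenever a path leaves the subgraph.\<close>

lemma loops_level:
  assumes cs: "closed_subgraph \<Gamma> V E" and M: "M \<in> NN"
    and conn: "level_connected M (level M V) (level M E)" and s: "s \<in> level M V"
    and k: "reads (label_step (trm M) E') k t s" "E' \<subseteq> edge M"
    and not: "\<not> reads (label_step (trm M) (level M E \<inter> E')) k t s"
  shows "finitely_generated_subgroup F (inverse_automaton.loops (label_step (trm M) (level M E)) A s)"
    "infinite_index A (inverse_automaton.loops (label_step (trm M) (level M E)) A s)"
proof -
  let ?E = "level M E" and ?V = "level M V"
  note lev = level_subgraph[OF cs M]
  interpret inverse_automaton "label_step (trm M) ?E"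
    using M lev by (intro inverse_automaton_level) blast+
  have lab: "x \<in> letters A" if "label_step (trm M) ?E x a b" for x a b
    using that lev(2) unfolding label_step_def edge_eq by blast
  have "b \<in> ?V" if "reads (label_step (trm M) ?E) w s b" for w b
  proof (cases w)
    case Nil
    then show ?thesis using that s by simp
  next
    case (Cons x w')
    then have "(b, x) \<in> ?E" using that reads_label_step_Cons by metis
    then show ?thesis using lev(3) by fastforce
  qed
  moreover have "finite ?V" using lev(1) V.finite_S[OF M] finite_subset by blast
  ultimately show "finitely_generated_subgroup F (loops A s)"
    using finite_A lab by (intro finitely_generated_loops) blast+
  \<comment> \<open>If no edge were missing, the path \<open>k\<close> could never leave the
    subgraph and would run in the intersection.\<close>
  have "\<exists>y\<in>?V. \<exists>x\<in>letters A. (y, x) \<notin> ?E"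
  proof (rule ccontr)
    assume full: "\<not> (\<exists>y\<in>?V. \<exists>x\<in>letters A. (y, x) \<notin> ?E)"
    have "reads (label_step (trm M) ?E) w a b"
      if "reads (label_step (trm M) E') w a b" "b \<in> ?V" for w a b
      using that
    proof (induction w arbitrary: b)
      case (Cons x w)
      then obtain m where m: "reads (label_step (trm M) E') w a m" "(b, x) \<in> E'" "trm M (b, x) = m"
        unfolding reads_label_step_Cons by blast
      then have "(b, x) \<in> ?E" using full Cons.prems(2) k(2) unfolding edge_eq by blast
      moreover from this have "m \<in> ?V" using lev(3) m(3) by blast
      ultimately show ?case using Cons.IH[OF m(1)] m(3) unfolding reads_label_step_Cons by blast
    qed simp
    from this[OF k(1) s] have "reads (label_step (trm M) ?E) k t s" .
    from reads_label_step_Int[OF this k(1)] show False using not by simp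
  qed
  then obtain y x where yx: "y \<in> ?V" "x \<in> letters A" "(y, x) \<notin> ?E" by blast
  obtain w where w: "reads (label_step (trm M) ?E) w s y"
    using conn yx(1) s rtrancl_edge_relation_iff unfolding level_connected_def by metis
  \<comment> \<open>Because steps run against edges, the missing edge \<open>(y, x)\<close> is a
    missing transition of \<open>letter_inv x\<close> at \<open>y\<close>.\<close>
  have "\<not> label_step (trm M) ?E (letter_inv x) y b" for b
  proof
    assume "label_step (trm M) ?E (letter_inv x) y b"
    from sym[OF this] show False using yx(3) by (simp add: label_step_def)
  qed
  moreover have "letter_inv x \<in> letters A" using yx(2) by simp
  ultimately show "infinite_index A (loops A s)"
    using card_A lab w infinite_index_loops[where A = A and y = y and x = "letter_inv x"] by blast
qed

text \<open>Let \<open>k1\<close> and \<open>k2\<close> label paths from \<open>u M\<close> to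
  \<open>v M\<close> in the two subgraphs. Without a common path both fundamental groups at
  \<open>u M\<close> have infinite index, so their product is closed. Paths at deeper levels show
  that \<open>k2\<close> times the inverse of \<open>k1\<close> lies in it modulo every
  \<open>N i\<close>, hence in it; a factorisation yields the common path.\<close>

lemma meet_connected:
  assumes cs: "closed_subgraph \<Gamma> V E" "closed_subgraph \<Gamma> V' E'"
    and pc: "profinite_connected (restrict_graph \<Gamma> V E)" "profinite_connected (restrict_graph \<Gamma> V' E')"
    and uv: "u \<in> V" "v \<in> V" "u \<in> V'" "v \<in> V'" and M: "M \<in> NN"
  shows "(u M, v M) \<in> (rel M (level M E \<inter> level M E'))\<^sup>*"
proof (rule ccontr)
  assume not: "(u M, v M) \<notin> (rel M (level M E \<inter> level M E'))\<^sup>*"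
  let ?E1 = "level M E" and ?E2 = "level M E'"
  let ?d1 = "label_step (trm M) ?E1" and ?d2 = "label_step (trm M) ?E2"
  have no: "\<not> reads (label_step (trm M) (?E1 \<inter> ?E2)) k (v M) (u M)" for k
    using not rtrancl_edge_relation_iff by metis
  note lev1 = level_subgraph[OF cs(1)] and lev2 = level_subgraph[OF cs(2)]
  note conn1 = profinite_connectedD[OF cs(1) pc(1)] and conn2 = profinite_connectedD[OF cs(2) pc(2)]
  have mem: "u K \<in> level K V" "v K \<in> level K V" "u K \<in> level K V'" "v K \<in> level K V'" for K
    using uv unfolding level_def by blast+
  have uvL: "u \<in> V.L" "v \<in> V.L" using uv closed_subgraphD(1)[OF cs(1)] by blast+
  interpret I1: inverse_automaton ?d1 using M lev1[OF M] by (intro inverse_automaton_level) blast+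
  interpret I2: inverse_automaton ?d2 using M lev2[OF M] by (intro inverse_automaton_level) blast+
  have path1: "\<exists>w. reads (label_step (trm K) (level K E)) w (v K) (u K)" if "K \<in> NN" for K
    using conn1[OF that] mem rtrancl_edge_relation_iff unfolding level_connected_def by metis
  have path2: "\<exists>w. reads (label_step (trm K) (level K E')) w (v K) (u K)" if "K \<in> NN" for K
    using conn2[OF that] mem rtrancl_edge_relation_iff unfolding level_connected_def by metis
  obtain k1 where k1: "reads ?d1 k1 (v M) (u M)" using path1[OF M] by blast
  obtain k2 where k2: "reads ?d2 k2 (v M) (u M)" using path2[OF M] by blast
  let ?H1 = "I1.loops A (u M)" and ?H2 = "I2.loops A (u M)"
  have H1: "finitely_generated_subgroup F ?H1" "infinite_index A ?H1"
    using loops_level[OF cs(1) M conn1[OF M] mem(1) k2 lev2(2)[OF M] no] by blast+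
  have H2: "finitely_generated_subgroup F ?H2" "infinite_index A ?H2"
    using loops_level[OF cs(2) M conn2[OF M] mem(3) k1 lev1(2)[OF M]] no by (simp_all add: Int_commute)
  have red: "\<forall>H\<in>set [?H2, ?H1]. H \<subseteq> Collect reduced_word"
    by (auto simp: I1.loops_def I2.loops_def carrier_free_group)
  have L: "w \<in> lists (letters A)" if "K \<in> NN" "E0 \<subseteq> edge K" "reads (label_step (trm K) E0) w (v K) (u K)" for K E0 w
  proof -
    have "u K \<in> vert K" using V.limit_mem[OF uvL(1) that(1)] .
    then show ?thesis using reads_level_coset[OF that(1,2)] that(3) by (metis vertE)
  qed
  have k_L: "k1 \<in> lists (letters A)" "k2 \<in> lists (letters A)"
    using L[OF M lev1(2)[OF M] k1] L[OF M lev2(2)[OF M] k2] by blast+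
  let ?w = "red (k2 @ inv_word k1)"
  have wF: "?w \<in> carrier F" using k_L by (intro red_carrier) simp
  have "?w \<in> product_set F [?H2, ?H1]"
  proof (rule ccontr)
    assume "?w \<notin> product_set F [?H2, ?H1]"
    then obtain i where i: "i \<ge> 5" "(N i #>\<^bsub>F\<^esub> ?w) \<inter> product_set F [?H2, ?H1] = {}"
      using sep H1 H2 wF unfolding separating_sequence_def by (metis empty_iff empty_set set_ConsD)
    have Ni: "N i \<in> NN" using i(1) by (rule N_in_NN)
    \<comment> \<open>Below both subgroups: the labels \<open>w1\<close> and \<open>w2\<close> of
      two paths from \<open>u K\<close> to \<open>v K\<close> agree modulo \<open>N i\<close>, while
      the paths still project into the subgraphs at level \<open>M\<close>.\<close>
    define K where "K = M \<inter> N i"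
    have K: "K \<in> NN" "K \<subseteq> M" "K \<subseteq> N i" unfolding K_def using NN_Int[OF M Ni] by auto
    obtain w1 where w1: "reads (label_step (trm K) (level K E)) w1 (v K) (u K)" using path1[OF K(1)] by blast
    obtain w2 where w2: "reads (label_step (trm K) (level K E')) w2 (v K) (u K)" using path2[OF K(1)] by blast
    have w_L: "w1 \<in> lists (letters A)" "w2 \<in> lists (letters A)"
      using L[OF K(1) lev1(2)[OF K(1)] w1] L[OF K(1) lev2(2)[OF K(1)] w2] by blast+
    have proj: "M <#>\<^bsub>F\<^esub> u K = u M" "M <#>\<^bsub>F\<^esub> v K = v M"
      using V.limit_bond[OF _ M K(1,2)] uvL by blast+
    have r1: "reads ?d1 w1 (v M) (u M)"
      using reads_bond[OF M K(1,2) lev1(2)[OF K(1)] level_bond[OF closed_subgraphD(2)[OF cs(1)] M K(1,2)] w1]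
      unfolding proj .
    have r2: "reads ?d2 w2 (v M) (u M)"
      using reads_bond[OF M K(1,2) lev2(2)[OF K(1)] level_bond[OF closed_subgraphD(2)[OF cs(2)] M K(1,2)] w2]
      unfolding proj .
    let ?h1 = "red (w1 @ inv_word k1)" and ?h2 = "red (k2 @ inv_word w2)"
    have "reads ?d1 (w1 @ inv_word k1) (u M) (u M)"
      using r1 I1.reads_inv[OF k1] unfolding I1.reads_append by blast
    then have h1: "?h1 \<in> ?H1"
      unfolding I1.loops_def using I1.reads_red red_carrier w_L k_L by simp
    have "reads ?d2 (k2 @ inv_word w2) (u M) (u M)"
      using k2 I2.reads_inv[OF r2] unfolding I2.reads_append by blast
    then have h2: "?h2 \<in> ?H2"
      unfolding I2.loops_def using I2.reads_red red_carrier w_L k_L by simp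
    let ?p = "red (?h2 @ ?h1)"
    have p: "?p \<in> product_set F [?H2, ?H1]"
      unfolding product_set_iff[OF red] using h1 h2 by (intro exI[of _ "[?h2, ?h1]"]) simp
    obtain g where g: "g \<in> carrier F" "u K = K #>\<^bsub>F\<^esub> g"
      using V.limit_mem[OF uvL(1) K(1)] by (rule vertE)
    let ?a = "red (g @ w1)" and ?b = "red (g @ w2)"
    \<comment> \<open>The vertex \<open>u K\<close> is a coset of some \<open>g\<close>, so a priori
      only \<open>g @ w1\<close> and \<open>g @ w2\<close> agree; \<open>?c\<close> removes
      \<open>g\<close> again.\<close>
    let ?c = "red (k2 @ inv_word w2 @ inv_word g)" and ?d = "red (inv_word k1)"
    have abcd: "?a \<in> carrier F" "?b \<in> carrier F" "?c \<in> carrier F" "?d \<in> carrier F"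
      using w_L k_L carrier_lists[OF g(1)] by (intro red_carrier; simp del: in_lists_conv_set)+
    have "K #>\<^bsub>F\<^esub> ?a = K #>\<^bsub>F\<^esub> ?b"
      using reads_level_coset[OF K(1) lev1(2)[OF K(1)]] reads_level_coset[OF K(1) lev2(2)[OF K(1)]]
        w1 w2 g by metis
    then have ab: "N i #>\<^bsub>F\<^esub> ?a = N i #>\<^bsub>F\<^esub> ?b"
      using bond_coset[OF Ni K(1,3)] abcd by metis
    interpret Ni: normal "N i" F using NN_normal_finite(1)[OF Ni] .
    have "N i #>\<^bsub>F\<^esub> (?c \<otimes>\<^bsub>F\<^esub> (?a \<otimes>\<^bsub>F\<^esub> ?d)) = N i #>\<^bsub>F\<^esub> (?c \<otimes>\<^bsub>F\<^esub> (?b \<otimes>\<^bsub>F\<^esub> ?d))"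
      using ab abcd Ni.rcos_sum F.m_closed by metis
    moreover have "?c \<otimes>\<^bsub>F\<^esub> (?a \<otimes>\<^bsub>F\<^esub> ?d) = ?p"
      using red_cancel(2)[of "k2 @ inv_word w2" g "w1 @ inv_word k1"]
      by (simp add: mult_free_group)
    moreover have "?c \<otimes>\<^bsub>F\<^esub> (?b \<otimes>\<^bsub>F\<^esub> ?d) = ?w"
      using red_cancel(2)[of "k2 @ inv_word w2" g "w2 @ inv_word k1"] red_cancel(2)[of k2 w2 "inv_word k1"]
      by (simp add: mult_free_group)
    ultimately have "N i #>\<^bsub>F\<^esub> ?p = N i #>\<^bsub>F\<^esub> ?w" by simp
    moreover have "?p \<in> carrier F" using abcd w_L k_L by (intro red_carrier) (simp add: red_in_lists del: in_lists_conv_set)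
    ultimately have "?p \<in> N i #>\<^bsub>F\<^esub> ?w" using F.rcos_self Ni.subgroup_axioms by metis
    then show False using i(2) p by blast
  qed
  then obtain h1 h2 where h: "h2 \<in> ?H2" "h1 \<in> ?H1" "?w = red (h2 @ h1)"
    unfolding product_set_iff[OF red] by (auto simp: list_all2_Cons2)
  \<comment> \<open>One element of the free group that both automata read from \<open>v M\<close> to
    \<open>u M\<close>: the excluded common path.\<close>
  have "red (h1 @ k1) = red (inv_word h2 @ red (h2 @ h1) @ k1)"
    using red_cancel(2)[of "[]" h2 "h1 @ k1"] by simp (metis append_assoc red_append red_red_append)
  also have "\<dots> = red (inv_word h2 @ k2)"
    using red_cancel(2)[of "inv_word h2 @ k2" k1 "[]"] unfolding h(3)[symmetric]
    by simp (metis append_assoc red_append red_red_append)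
  finally have eq: "red (h1 @ k1) = red (inv_word h2 @ k2)" .
  have "reads ?d1 (h1 @ k1) (v M) (u M)"
    using h(2) k1 unfolding I1.loops_def I1.reads_append by blast
  moreover have "reads ?d2 (inv_word h2 @ k2) (v M) (u M)"
    using h(1) k2 I2.reads_inv unfolding I2.loops_def I2.reads_append by blast
  ultimately show False
    using I1.reads_red I2.reads_red reads_label_step_Int no eq by metis
qed

end

context separating_quotients
begin

lemma level_iff: "y \<in> level M Z \<longleftrightarrow> (\<exists>z\<in>Z. z M = y)"
  by (auto simp: level_def)

text \<open>The component of \<open>u\<close> in the intersection of two connected subgraphs, computed level by level.\<close>

lemma meet_subgraph:
  assumes uv: "u \<in> V.L" "v \<in> V.L"
    and C: "(V, E) \<in> connected_subgraphs \<Gamma> {u, v}" "(V', E') \<in> connected_subgraphs \<Gamma> {u, v}"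
  shows "\<exists>(V'', E'')\<in>connected_subgraphs \<Gamma> {u, v}. V'' \<subseteq> V \<inter> V' \<and> E'' \<subseteq> E \<inter> E'"
proof -
  have cs: "closed_subgraph \<Gamma> V E" "closed_subgraph \<Gamma> V' E'"
    and pc: "profinite_connected (restrict_graph \<Gamma> V E)" "profinite_connected (restrict_graph \<Gamma> V' E')"
    and mem: "u \<in> V" "v \<in> V" "u \<in> V'" "v \<in> V'"
    using C unfolding connected_subgraphs_def by auto
  note D1 = closed_subgraphD[OF cs(1)] and D2 = closed_subgraphD[OF cs(2)]
  define B where "B M = level M E \<inter> level M E'" for M
  define KV where "KV M = {y. (u M, y) \<in> (rel M (B M))\<^sup>*}" for M
  define KE where "KE M = {e \<in> B M. fst e \<in> KV M}" for M
  have B_edge: "B M \<subseteq> edge M" and B_inv: "\<And>e. e \<in> B M \<Longrightarrow> einvm M e \<in> B M" if "M \<in> NN" for M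
    using level_subgraph[OF cs(1) that] level_subgraph[OF cs(2) that] unfolding B_def by blast+
  have KV_level: "KV M \<subseteq> level M V \<inter> level M V'" if M: "M \<in> NN" for M
  proof
    fix y assume "y \<in> KV M"
    then have "(u M, y) \<in> (rel M (B M))\<^sup>*" unfolding KV_def by blast
    then show "y \<in> level M V \<inter> level M V'"
    proof (cases rule: rtranclE)
      case base
      then show ?thesis using mem unfolding level_def by blast
    next
      case (step z)
      then obtain e where "e \<in> B M" "y = trm M e" unfolding edge_relation_def by blast
      then show ?thesis
        using level_subgraph(3)[OF cs(1) M] level_subgraph(3)[OF cs(2) M] unfolding B_def by blast
    qed
  qed
  have KE_step: "trm M e \<in> KV M" "einvm M e \<in> KE M" if "M \<in> NN" "e \<in> KE M" for M e
  proof -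
    have e: "e \<in> B M" "(u M, fst e) \<in> (rel M (B M))\<^sup>*" using that(2) unfolding KE_def KV_def by auto
    have "(fst e, trm M e) \<in> rel M (B M)" using e(1) unfolding edge_relation_def by blast
    with e(2) show t: "trm M e \<in> KV M" unfolding KV_def by (auto intro: rtrancl_into_rtrancl)
    have "e \<in> edge M" using e(1) B_edge[OF that(1)] by blast
    then show "einvm M e \<in> KE M"
      using B_inv[OF that(1) e(1)] quotient_serre(5)[OF that(1)] t unfolding KE_def by simp
  qed
  have B_bond: "pE M M' ` B M' \<subseteq> B M" if "M \<in> NN" "M' \<in> NN" "M' \<subseteq> M" for M M'
    using level_bond[OF D1(2) that] level_bond[OF D2(2) that] unfolding B_def by blast
  have KV_bond: "M <#>\<^bsub>F\<^esub> y \<in> KV M" if "M \<in> NN" "M' \<in> NN" "M' \<subseteq> M" and y: "y \<in> KV M'" for M M' y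
  proof -
    obtain w where "reads (label_step (trm M') (B M')) w y (u M')"
      using y unfolding KV_def rtrancl_edge_relation_iff by blast
    from reads_bond[OF that(1-3) B_edge[OF that(2)] B_bond[OF that(1-3)] this]
    show ?thesis
      using V.limit_bond[OF uv(1) that(1-3)] unfolding KV_def rtrancl_edge_relation_iff by auto
  qed
  have compV: "V.compatible KV"
    unfolding V.compatible_def
    using KV_level level_subgraph(1)[OF cs(1)] KV_bond by blast
  have compE: "E.compatible KE"
    unfolding E.compatible_def
  proof (intro conjI ballI impI)
    show "KE M \<subseteq> edge M" if "M \<in> NN" for M using B_edge[OF that] unfolding KE_def by blast
    fix M M' assume M: "M \<in> NN" "M' \<in> NN" "M' \<subseteq> M"
    show "pE M M' ` KE M' \<subseteq> KE M"
    proof (rule image_subsetI)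
      fix e assume e: "e \<in> KE M'"
      then have "pE M M' e \<in> B M" using B_bond[OF M] unfolding KE_def by blast
      moreover have "fst (pE M M' e) \<in> KV M"
        using KV_bond[OF M, of "fst e"] e unfolding KE_def by (simp add: case_prod_unfold)
      ultimately show "pE M M' e \<in> KE M" unfolding KE_def by blast
    qed
  qed
  define V'' where "V'' = {z \<in> V.L. \<forall>M\<in>NN. z M \<in> KV M}"
  define E'' where "E'' = {z \<in> E.L. \<forall>M\<in>NN. z M \<in> KE M}"
  have subV: "V'' \<subseteq> V \<inter> V'"
  proof
    fix z assume z: "z \<in> V''"
    have lv: "\<exists>w\<in>V. w M = z M" "\<exists>w\<in>V'. w M = z M" if "M \<in> NN" for M
    proof -
      have "z M \<in> level M V \<inter> level M V'" using z KV_level[OF that] that unfolding V''_def by blast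
      then show "\<exists>w\<in>V. w M = z M" "\<exists>w\<in>V'. w M = z M" unfolding Int_iff level_iff by blast+
    qed
    have "z \<in> V.L" using z unfolding V''_def by blast
    then show "z \<in> V \<inter> V'"
      using V.closed_thread[OF D1(3) _ lv(1)] V.closed_thread[OF D2(3) _ lv(2)] by blast
  qed
  have subE: "E'' \<subseteq> E \<inter> E'"
  proof
    fix z assume z: "z \<in> E''"
    have lv: "\<exists>w\<in>E. w M = z M" "\<exists>w\<in>E'. w M = z M" if "M \<in> NN" for M
    proof -
      have "z M \<in> KE M" using z that unfolding E''_def by blast
      then have "z M \<in> level M E \<inter> level M E'" unfolding KE_def B_def by blast
      then show "\<exists>w\<in>E. w M = z M" "\<exists>w\<in>E'. w M = z M" unfolding Int_iff level_iff by blast+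
    qed
    have "z \<in> E.L" using z unfolding E''_def by blast
    then show "z \<in> E \<inter> E'"
      using E.closed_thread[OF D1(4) _ lv(1)] E.closed_thread[OF D2(4) _ lv(2)] by blast
  qed
  have cs'': "closed_subgraph \<Gamma> V'' E''"
    unfolding closed_subgraph_def verts_\<Gamma> edges_\<Gamma> vtop_\<Gamma> etop_\<Gamma>
  proof (intro conjI ballI)
    show "V'' \<subseteq> V.L" "E'' \<subseteq> E.L" unfolding V''_def E''_def by blast+
    show "closedin V.limtop V''" unfolding V''_def by (rule V.closed_limit)
    show "closedin E.limtop E''" unfolding E''_def by (rule E.closed_limit)
    fix e assume e: "e \<in> E''"
    then have eE: "e \<in> E" and eK: "\<And>M. M \<in> NN \<Longrightarrow> e M \<in> KE M" using subE unfolding E''_def by blast+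
    note ends = D1(5)[OF eE]
    show "ini \<Gamma> e \<in> V''"
      using ends D1(1) eK ini_\<Gamma> unfolding V''_def KE_def by auto
    show "ter \<Gamma> e \<in> V''"
      using ends D1(1) KE_step(1)[OF _ eK] ter_\<Gamma> unfolding V''_def by auto
    show "einv \<Gamma> e \<in> E''"
      using ends D1(2) KE_step(2)[OF _ eK] einv_\<Gamma> unfolding E''_def by auto
  qed
  have "level_connected M (level M V'') (level M E'')" if M: "M \<in> NN" for M
  proof -
    \<comment> \<open>Components of deeper levels need not map onto those above. The level of the
      limit is therefore compared with a component at a sufficiently deep \<open>K\<close>, whose
      connectedness passes to its image.\<close>
    obtain M1 where M1: "M1 \<in> NN" "M1 \<subseteq> M"
      "\<forall>M2\<in>NN. M2 \<subseteq> M1 \<longrightarrow> (\<lambda>z. z M) ` {z \<in> V.L. \<forall>M'\<in>NN. z M' \<in> KV M'} = pV M M2 ` KV M2"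
      using V.stable_image[OF compV M] by blast
    obtain M2 where M2: "M2 \<in> NN" "M2 \<subseteq> M"
      "\<forall>M3\<in>NN. M3 \<subseteq> M2 \<longrightarrow> (\<lambda>z. z M) ` {z \<in> E.L. \<forall>M'\<in>NN. z M' \<in> KE M'} = pE M M3 ` KE M3"
      using E.stable_image[OF compE M] by blast
    define K where "K = M1 \<inter> M2"
    have K: "K \<in> NN" "K \<subseteq> M" "K \<subseteq> M1" "K \<subseteq> M2" unfolding K_def using NN_Int M1 M2 by blast+
    have levV: "level M V'' = pV M K ` KV K" using M1(3) K unfolding level_def V''_def by blast
    have levE: "level M E'' = pE M K ` KE K" using M2(3) K unfolding level_def E''_def by blast
    have KE_edge: "KE K \<subseteq> edge K" using compE K(1) unfolding E.compatible_def by blast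
    have from_u: "(u K, s) \<in> (rel K (KE K))\<^sup>*" if "s \<in> KV K" for s
    proof -
      have "(u K, s) \<in> (rel K (B K))\<^sup>*" using that unfolding KV_def by blast
      then show ?thesis
      proof (induction rule: rtrancl_induct)
        case (step s s')
        then obtain e where e: "e \<in> B K" "s = fst e" "s' = trm K e" unfolding edge_relation_def by blast
        then have "e \<in> KE K" using step.hyps(1) unfolding KE_def KV_def by blast
        then have "(s, s') \<in> rel K (KE K)" using e(2,3) unfolding edge_relation_def by blast
        with step.IH show ?case by (rule rtrancl_into_rtrancl)
      qed simp
    qed
    have sym: "sym ((rel K (KE K))\<^sup>*)" using K(1) KE_edge KE_step(2)[OF K(1)] by (rule sym_rel)
    show ?thesis
      unfolding level_connected_def levV
    proof (intro ballI, elim imageE)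
      fix s t s' t' assume st: "s = M <#>\<^bsub>F\<^esub> s'" "s' \<in> KV K" "t = M <#>\<^bsub>F\<^esub> t'" "t' \<in> KV K"
      have "(s', u K) \<in> (rel K (KE K))\<^sup>*" using from_u[OF st(2)] symD[OF sym] by blast
      then have "(s', t') \<in> (rel K (KE K))\<^sup>*" using from_u[OF st(4)] by (rule rtrancl_trans)
      then obtain w where "reads (label_step (trm K) (KE K)) w t' s'"
        unfolding rtrancl_edge_relation_iff by blast
      from reads_bond[OF M K(1,2) KE_edge _ this, of "level M E''"]
      show "(s, t) \<in> (rel M (level M E''))\<^sup>*"
        unfolding rtrancl_edge_relation_iff st levE by blast
    qed
  qed
  then have "profinite_connected (restrict_graph \<Gamma> V'' E'')" using cs'' by (intro profinite_connectedI)
  moreover have "u \<in> V''" using uv unfolding V''_def KV_def by blast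
  moreover have "v \<in> V''"
    using uv meet_connected[OF cs pc mem] unfolding V''_def KV_def B_def by blast
  ultimately have "(V'', E'') \<in> connected_subgraphs \<Gamma> {u, v}"
    using cs'' unfolding connected_subgraphs_def by blast
  then show ?thesis using subV subE by blast
qed

section \<open>The whole graph and minimal connected subgraphs\<close>

lemma whole_graph:
  "closed_subgraph \<Gamma> V.L E.L" "profinite_connected (restrict_graph \<Gamma> V.L E.L)"
  "restrict_graph \<Gamma> V.L E.L = \<Gamma>"
proof -
  show cs: "closed_subgraph \<Gamma> V.L E.L"
    unfolding closed_subgraph_def verts_\<Gamma> edges_\<Gamma> vtop_\<Gamma> etop_\<Gamma>
  proof (intro conjI ballI)
    show "closedin V.limtop V.L" "closedin E.limtop E.L"
      using closedin_topspace[of V.limtop] closedin_topspace[of E.limtop] by simp_all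
    fix e assume e: "e \<in> E.L"
    have eM: "e M \<in> edge M" if "M \<in> NN" for M using E.limit_mem[OF e that] .
    have split: "pE M M' (e M') = (M <#>\<^bsub>F\<^esub> fst (e M'), snd (e M'))" for M M'
      by (simp add: case_prod_unfold)
    have bond: "e M = (M <#>\<^bsub>F\<^esub> fst (e M'), snd (e M'))" if "M \<in> NN" "M' \<in> NN" "M' \<subseteq> M" for M M'
      using E.limit_bond[OF e that] unfolding split by simp
    have tr: "M <#>\<^bsub>F\<^esub> trm M' (e M') = trm M (e M)" if M: "M \<in> NN" "M' \<in> NN" "M' \<subseteq> M" for M M'
    proof -
      have "fst (e M') \<in> vert M'" "snd (e M') \<in> letters A"
        using eM[OF M(2)] unfolding edge_eq by (auto simp: mem_Times_iff)
      then show ?thesis using bond_trm[OF M, of "fst (e M')" "snd (e M')"] bond[OF M] by simp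
    qed
    show "ini \<Gamma> e \<in> V.L"
    proof -
      have "ini \<Gamma> e = (\<lambda>M\<in>NN. fst (e M))"
        by (simp add: pro_cayley_graph_def proj_limit_graph_def ini_eq)
      moreover have "M <#>\<^bsub>F\<^esub> fst (e M') = fst (e M)" if "M \<in> NN" "M' \<in> NN" "M' \<subseteq> M" for M M'
        using bond[OF that] by (metis fst_conv)
      ultimately show ?thesis
        using quotient_serre(1) eM unfolding proj_limit_def by (auto simp: restrict_PiE_iff)
    qed
    show "ter \<Gamma> e \<in> V.L"
    proof -
      have "ter \<Gamma> e = (\<lambda>M\<in>NN. trm M (e M))"
        by (simp add: pro_cayley_graph_def proj_limit_graph_def)
      then show ?thesis
        using quotient_serre(2) eM tr unfolding proj_limit_def by (auto simp: restrict_PiE_iff)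
    qed
    show "einv \<Gamma> e \<in> E.L"
    proof -
      have i: "einvm M (e M) = (trm M (e M), letter_inv (snd (e M)))" for M
        by (metis einvm_eq prod.collapse)
      have "einv \<Gamma> e = (\<lambda>M\<in>NN. einvm M (e M))"
        by (simp add: pro_cayley_graph_def proj_limit_graph_def)
      moreover have "pE M M' (einvm M' (e M')) = einvm M (e M)" if "M \<in> NN" "M' \<in> NN" "M' \<subseteq> M" for M M'
        unfolding i using tr[OF that] edge_label_const[OF e that(1,2)] by simp
      ultimately show ?thesis
        using quotient_serre(3) eM unfolding proj_limit_def by (auto simp: restrict_PiE_iff)
    qed
  qed simp_all
  show "profinite_connected (restrict_graph \<Gamma> V.L E.L)"
  proof (rule profinite_connectedI[OF cs])
    fix M assume M: "M \<in> NN"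
    have levE: "level M E.L = edge M"
    proof
      show "level M E.L \<subseteq> edge M" using level_subgraph(2)[OF cs M] .
      show "edge M \<subseteq> level M E.L"
      proof
        fix e assume "e \<in> edge M"
        then obtain z where "z \<in> E.L" "z M = e" using E.thread[OF M] by blast
        then show "e \<in> level M E.L" unfolding level_def by blast
      qed
    qed
    have levV: "level M V.L \<subseteq> vert M" using level_subgraph(1)[OF cs M] .
    have reach: "(M #>\<^bsub>F\<^esub> [], M #>\<^bsub>F\<^esub> red w) \<in> (rel M (edge M))\<^sup>*" if "w \<in> lists (letters A)" for w
      using that
    proof (induction w rule: rev_induct)
      case (snoc x w)
      then have w: "w \<in> lists (letters A)" and x: "x \<in> letters A" by auto
      have "(M #>\<^bsub>F\<^esub> red w, x) \<in> edge M" unfolding edge_eq using coset_vert red_carrier[OF w] x by blast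
      then have "(fst (M #>\<^bsub>F\<^esub> red w, x), trm M (M #>\<^bsub>F\<^esub> red w, x)) \<in> rel M (edge M)"
        unfolding edge_relation_def by blast
      then have "(M #>\<^bsub>F\<^esub> red w, M #>\<^bsub>F\<^esub> red (w @ [x])) \<in> rel M (edge M)"
        using trm_coset[OF M red_carrier[OF w] x] by simp
      with snoc.IH[OF w] show ?case by (rule rtrancl_into_rtrancl)
    qed simp
    have base: "(M #>\<^bsub>F\<^esub> [], s) \<in> (rel M (edge M))\<^sup>*" if "s \<in> vert M" for s
    proof -
      obtain g where g: "g \<in> carrier F" "s = M #>\<^bsub>F\<^esub> g" using \<open>s \<in> vert M\<close> by (rule vertE)
      then show ?thesis
        using reach[of g] by (simp add: carrier_free_group red_reduced)
    qed
    have sym: "sym ((rel M (edge M))\<^sup>*)"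
      using M quotient_serre(3)[OF M] by (intro sym_rel) blast+
    have "(s, t) \<in> (rel M (edge M))\<^sup>*" if "s \<in> vert M" "t \<in> vert M" for s t
      using symD[OF sym base[OF that(1)]] base[OF that(2)] by (rule rtrancl_trans)
    then show "level_connected M (level M V.L) (level M E.L)"
      unfolding level_connected_def levE using levV by blast
  qed
  have "pos \<Gamma> \<subseteq> E.L"
    unfolding pos_\<Gamma> proj_limit_def using edge_eq pos_eq by (auto simp: PiE_iff)
  then have "pos \<Gamma> \<inter> E.L = pos \<Gamma>" by blast
  moreover have "subtopology V.limtop V.L = V.limtop" "subtopology E.limtop E.L = E.limtop"
    using subtopology_topspace[of V.limtop] subtopology_topspace[of E.limtop] by simp_all
  ultimately show "restrict_graph \<Gamma> V.L E.L = \<Gamma>"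
    unfolding restrict_graph_def using verts_\<Gamma> edges_\<Gamma> vtop_\<Gamma> etop_\<Gamma>
    by (intro top_sgraph.equality) simp_all
qed

text \<open>At each level some connected subgraph has the smallest image, and by directedness this
  image lies in all others. Compactness shows that the intersection of the family has the same
  image, which is connected.\<close>

theorem tree_like: "tree_like \<Gamma>"
  unfolding tree_like_def
proof (intro conjI ballI)
  show "profinite_connected \<Gamma>" using whole_graph by simp
  fix u v assume "u \<in> verts \<Gamma>" "v \<in> verts \<Gamma>"
  then have uv: "u \<in> V.L" "v \<in> V.L" by (simp_all add: verts_\<Gamma>)
  let ?C = "connected_subgraphs \<Gamma> {u, v}"
  have whole: "(V.L, E.L) \<in> ?C"
    unfolding connected_subgraphs_def using whole_graph(1,2) uv by blast
  have C: "closed_subgraph \<Gamma> V E" "profinite_connected (restrict_graph \<Gamma> V E)" if "(V, E) \<in> ?C" for V E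
    using that unfolding connected_subgraphs_def by blast+
  let ?V = "\<Inter>(fst ` ?C)" and ?E = "\<Inter>(snd ` ?C)"
  have ne: "fst ` ?C \<noteq> {}" "snd ` ?C \<noteq> {}" using whole by blast+
  have closed: "closedin V.limtop V" if "V \<in> fst ` ?C" for V
    using that closed_subgraphD(3)[OF C(1)] by force
  have closed': "closedin E.limtop E" if "E \<in> snd ` ?C" for E
    using that closed_subgraphD(4)[OF C(1)] by force
  have cs: "closed_subgraph \<Gamma> ?V ?E"
    unfolding closed_subgraph_def verts_\<Gamma> edges_\<Gamma> vtop_\<Gamma> etop_\<Gamma>
  proof (intro conjI ballI)
    show "?V \<subseteq> V.L" "?E \<subseteq> E.L" using whole by force+
    show "closedin V.limtop ?V" using closed ne by (intro closedin_Inter) auto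
    show "closedin E.limtop ?E" using closed' ne by (intro closedin_Inter) auto
    fix e assume e: "e \<in> ?E"
    have *: "ini \<Gamma> e \<in> V \<and> ter \<Gamma> e \<in> V \<and> einv \<Gamma> e \<in> E" if "(V, E) \<in> ?C" for V E
      using closed_subgraphD(5)[OF C(1)[OF that]] e that by force
    show "ini \<Gamma> e \<in> ?V" "ter \<Gamma> e \<in> ?V" "einv \<Gamma> e \<in> ?E" using * by auto
  qed
  show "profinite_connected (restrict_graph \<Gamma> ?V ?E)"
  proof (rule profinite_connectedI[OF cs])
    fix M assume M: "M \<in> NN"
    let ?size = "\<lambda>c. card (level M (fst c)) + card (level M (snd c))"
    obtain c0 where "c0 \<in> ?C" "\<forall>c. c \<in> ?C \<longrightarrow> ?size c0 \<le> ?size c"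
      using ex_has_least_nat[of "\<lambda>c. c \<in> ?C" "(V.L, E.L)" ?size] whole by blast
    moreover obtain V0 E0 where "c0 = (V0, E0)" by fastforce
    ultimately have c0: "(V0, E0) \<in> ?C"
      "\<And>V E. (V, E) \<in> ?C \<Longrightarrow> card (level M V0) + card (level M E0) \<le> card (level M V) + card (level M E)"
      by auto
    have fin: "finite (level M V0)" "finite (level M E0)"
      using level_subgraph(1,2)[OF C(1)[OF c0(1)] M] V.finite_S[OF M] E.finite_S[OF M]
      by (blast intro: finite_subset)+
    have low: "level M V0 \<subseteq> level M V \<and> level M E0 \<subseteq> level M E" if VE: "(V, E) \<in> ?C" for V E
    proof -
      obtain V1 E1 where c1: "(V1, E1) \<in> ?C" "V1 \<subseteq> V0 \<inter> V" "E1 \<subseteq> E0 \<inter> E"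
        using meet_subgraph[OF uv c0(1) VE] by blast
      then have sub: "level M V1 \<subseteq> level M V0" "level M E1 \<subseteq> level M E0"
        "level M V1 \<subseteq> level M V" "level M E1 \<subseteq> level M E"
        unfolding level_def by blast+
      have "card (level M V1) \<le> card (level M V0)" "card (level M E1) \<le> card (level M E0)"
        using fin sub by (auto intro: card_mono)
      then have "card (level M V0) \<le> card (level M V1)" "card (level M E0) \<le> card (level M E1)"
        using c0(2)[OF c1(1)] by linarith+
      then have "level M V1 = level M V0" "level M E1 = level M E0"
        using card_seteq[OF fin(1) sub(1)] card_seteq[OF fin(2) sub(2)] by blast+
      then show ?thesis using sub by blast
    qed
    have dir: "\<exists>c\<in>?C. fst c \<subseteq> V \<inter> V' \<and> snd c \<subseteq> E \<inter> E'"
      if VE: "(V, E) \<in> ?C" "(V', E') \<in> ?C" for V E V' E'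
    proof -
      obtain V1 E1 where "(V1, E1) \<in> ?C" "V1 \<subseteq> V \<inter> V'" "E1 \<subseteq> E \<inter> E'"
        using meet_subgraph[OF uv VE] by blast
      then show ?thesis by (intro bexI[of _ "(V1, E1)"]) simp_all
    qed
    have "level M ?V = level M V0"
    proof
      show "level M ?V \<subseteq> level M V0" using c0(1) unfolding level_def by (intro image_mono Inter_lower) force
      show "level M V0 \<subseteq> level M ?V"
      proof
        fix y assume y: "y \<in> level M V0"
        have fib: "\<exists>z\<in>V. z M = y" if V: "V \<in> fst ` ?C" for V
        proof -
          obtain E where "(V, E) \<in> ?C" using V by auto
          then show ?thesis using low y unfolding level_iff[symmetric] by blast
        qed
        have dirX: "\<exists>U\<in>fst ` ?C. U \<subseteq> V \<inter> V'" if V: "V \<in> fst ` ?C" "V' \<in> fst ` ?C" for V V'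
        proof -
          obtain E E' where VE: "(V, E) \<in> ?C" "(V', E') \<in> ?C" using V by auto
          obtain c where "c \<in> ?C" "fst c \<subseteq> V \<inter> V'" using dir[OF VE] by blast
          then show ?thesis by (intro bexI[of _ "fst c"]) simp_all
        qed
        have "\<exists>z\<in>?V. z M = y"
          by (rule V.directed_fiber[where \<V> = "fst ` ?C" and M = M and y = y])
            (rule ne(1) | rule M | erule closed | erule (1) dirX | erule fib)+
        then show "y \<in> level M ?V" unfolding level_def by blast
      qed
    qed
    moreover have "level M ?E = level M E0"
    proof
      show "level M ?E \<subseteq> level M E0" using c0(1) unfolding level_def by (intro image_mono Inter_lower) force
      show "level M E0 \<subseteq> level M ?E"
      proof
        fix y assume y: "y \<in> level M E0"
        have fib: "\<exists>z\<in>E. z M = y" if E: "E \<in> snd ` ?C" for E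
        proof -
          obtain V where "(V, E) \<in> ?C" using E by auto
          then show ?thesis using low y unfolding level_iff[symmetric] by blast
        qed
        have dirX: "\<exists>U\<in>snd ` ?C. U \<subseteq> E \<inter> E'" if E: "E \<in> snd ` ?C" "E' \<in> snd ` ?C" for E E'
        proof -
          obtain V V' where VE: "(V, E) \<in> ?C" "(V', E') \<in> ?C" using E by auto
          obtain c where "c \<in> ?C" "snd c \<subseteq> E \<inter> E'" using dir[OF VE] by blast
          then show ?thesis by (intro bexI[of _ "snd c"]) simp_all
        qed
        have "\<exists>z\<in>?E. z M = y"
          by (rule E.directed_fiber[where \<V> = "snd ` ?C" and M = M and y = y])
            (rule ne(2) | rule M | erule closed' | erule (1) dirX | erule fib)+
        then show "y \<in> level M ?E" unfolding level_def by blast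
      qed
    qed
    ultimately show "level_connected M (level M ?V) (level M ?E)"
      using profinite_connectedD[OF C(1)[OF c0(1)] C(2)[OF c0(1)] M] by simp
  qed
qed

end

theorem mainTheorem3:
  fixes A :: "'a set"
  assumes "finite A" and "card A \<ge> 2"
  shows "\<exists>N :: nat \<Rightarrow> 'a letter list set.
    (\<forall>i\<ge>5. N i \<lhd> free_group A \<and> free_group A Mod N i \<cong> alt_group i) \<and>
    tree_like (pro_cayley_graph A (finite_intersections (free_group A) N {5..})) \<and>
    Ribes_Zalesskii (free_group A) (finite_intersections (free_group A) N {5..})"
proof -
  obtain N where N: "separating_sequence A N"
    using separating_sequence_exists[OF assms] by blast
  interpret separating_quotients A N using assms N by unfold_locales
  show ?thesis using N tree_like Ribes_Zalesskii unfolding separating_sequence_def by blast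
qed
end
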